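(* Let $N\in\{2,3,4,6,12\}$ and let $\mathcal{S}$ be the unit sphere in $\mathbb{R}^3$. Let $\tilde Y\subset\mathcal{S}$ be the following $N$-point set: a pair of antipodal points if $N=2$; three equally spaced points on a great circle (vertices of an equilateral triangle) if $N=3$; the vertices of an inscribed regular tetrahedron if $N=4$; the vertices of an inscribed regular octahedron if $N=6$; the vertices of an inscribed regular icosahedron if $N=12$. Then for every $N$-point set $Y\subset\mathcal{S}$ and every real $\alpha<\alpha_{\mathrm{crit}}$ one has $$\lambda_1(\alpha,Y)\le\lambda_1(\alpha,\tilde Y),$$ and the inequality is strict if and only if $Y$ and $\tilde Y$ are not congruent. Here $\lambda_1(\alpha,Y)$ is the lowest eigenvalue of the point-interaction Hamiltonian $H_{\alpha,Y}$ in $L^2(\mathbb{R}^3)$ and $\alpha_{\mathrm{crit}}:=\inf_Y\alpha_{\mathrm{crit}}^Y$, the infimum being taken over all $N$-point sets $Y\subset\mathcal{S}$.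
   Context: Point-interaction Hamiltonians. Let $Y=\{y_j\}_{j=1}^N\subset\mathbb{R}^3$ be a set of $N$ distinct points and $\alpha\in\mathbb{R}$. For $\kappa>0$ let $G_{i\kappa}(x)=\frac{\mathrm{e}^{-\kappa|x|}}{4\pi|x|}$ be the integral kernel of $(-\Delta+\kappa^2)^{-1}$ in $L^2(\mathbb{R}^3)$, and define the $N\times N$ matrix $$\Gamma_{\alpha,Y}(i\kappa)=\Big[\Big(\alpha+\frac{\kappa}{4\pi}\Big)\delta_{jj'}-(1-\delta_{jj'})G_{i\kappa}(y_j-y_{j'})\Big]_{j,j'=1}^N .$$ The operator $H_{\alpha,Y}$ is the self-adjoint operator in $L^2(\mathbb{R}^3)$ whose resolvent is given by Krein's formula $$(H_{\alpha,Y}+\kappa^2)^{-1}=(-\Delta+\kappa^2)^{-1}+\sum_{j,j'=1}^N\big[\Gamma_{\alpha,Y}(i\kappa)^{-1}\big]_{jj'}\big(G_{i\kappa}(\cdot-y_{j'}),\,\cdot\,\big)\,G_{i\kappa}(\cdot-y_j)$$ for all $\kappa>0$ with $\det\Gamma_{\alpha,Y}(i\kappa)\neq0$. Equivalently, it acts as $-\Delta$ away from $Y$ on functions which near each $y_j$ behave as $\psi(x)=\frac{c_j}{4\pi|x-y_j|}+\alpha c_j+o(1)$ with some $c_j\in\mathbb{C}$. The same $\alpha$ is used at all points of $Y$. Spectrum. The essential spectrum of $H_{\alpha,Y}$ is $[0,\infty)$, and $-\kappa^2<0$ is an eigenvalue if and only if $\det\Gamma_{\alpha,Y}(i\kappa)=0$.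 There is a critical value $\alpha_{\mathrm{crit}}^Y\in\mathbb{R}$ such that the discrete spectrum of $H_{\alpha,Y}$ is nonempty if and only if $\alpha<\alpha_{\mathrm{crit}}^Y$. When the discrete spectrum is nonempty, $\lambda_1(\alpha,Y)<0$ denotes the smallest eigenvalue. Two sets are congruent if one is mapped onto the other by an isometry of $\mathbb{R}^3$. *)

theory Defs
  imports "HOL-Analysis.Analysis"
begin

section \<open>Operators in $L^2(\mathbb{R}^3)$\<close>

text \<open>
  The elements of $L^2$ are represented by Borel functions rather than by classes, so equality in
  $L^2$ is almost-everywhere equality. An operator is represented by its graph, the set of pairs
  (u, g) such that u is in the domain and g represents the image of u.
\<close>

type_synonym wave = "real ^ 3 \<Rightarrow> complex"

definition L2 :: "wave set" where
  "L2 = {f \<in> borel_measurable borel. integrable lborel (\<lambda>x. (norm (f x))\<^sup>2)}"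

definition L2norm :: "wave \<Rightarrow> real" where
  "L2norm f = sqrt (LINT x|lborel. (norm (f x))\<^sup>2)"

definition eigenspace :: "(wave \<times> wave) set \<Rightarrow> real \<Rightarrow> wave set" where
  "eigenspace T l = {u. (u, \<lambda>x. of_real l * u x) \<in> T}"

definition is_eigenvalue :: "(wave \<times> wave) set \<Rightarrow> real \<Rightarrow> bool" where
  "is_eigenvalue T l \<longleftrightarrow> (\<exists>u \<in> eigenspace T l. \<not> (AE x in lborel. u x = 0))"

definition finite_multiplicity :: "(wave \<times> wave) set \<Rightarrow> real \<Rightarrow> bool" where
  "finite_multiplicity T l \<longleftrightarrow>
     (\<exists>B. finite B \<and> B \<subseteq> L2 \<and>
        (\<forall>u \<in> eigenspace T l. \<exists>c :: wave \<Rightarrow> complex.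
            AE x in lborel. u x = (\<Sum>b\<in>B. c b * b x)))"

text \<open>
  The real number l is in the resolvent set if T - l maps the domain onto $L^2$ and has a bounded
  inverse. The operators below are self-adjoint, so their spectrum is real and it is enough to
  consider real l.
\<close>

definition resolvent_set :: "(wave \<times> wave) set \<Rightarrow> real set" where
  "resolvent_set T =
     {l. (\<forall>f \<in> L2. \<exists>u. (u, \<lambda>x. f x + of_real l * u x) \<in> T) \<and>
         (\<exists>C. \<forall>(u, g) \<in> T. L2norm u \<le> C * L2norm (\<lambda>x. g x - of_real l * u x))}"

definition spectrum :: "(wave \<times> wave) set \<Rightarrow> real set" where
  "spectrum T = - resolvent_set T"

definition discrete_spectrum :: "(wave \<times> wave) set \<Rightarrow> real set" where
  "discrete_spectrum T =
     {l. l isolated_in spectrum T \<and> is_eigenvalue T l \<and> finite_multiplicity T l}"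


section \<open>Point-interaction Hamiltonians\<close>

text \<open>
  The centres $y_j$ are given by an injective family over a finite index type with N elements.
\<close>

definition G :: "real \<Rightarrow> real ^ 3 \<Rightarrow> real" where
  "G \<kappa> x = exp (- \<kappa> * norm x) / (4 * pi * norm x)"

definition \<Gamma> :: "real \<Rightarrow> ('n::finite \<Rightarrow> real ^ 3) \<Rightarrow> real \<Rightarrow> real ^ 'n ^ 'n" where
  "\<Gamma> \<alpha> y \<kappa> = (\<chi> i j. if i = j then \<alpha> + \<kappa> / (4 * pi) else - G \<kappa> (y i - y j))"

definition free_resolvent :: "real \<Rightarrow> wave \<Rightarrow> wave" where
  "free_resolvent \<kappa> f = (\<lambda>x. LINT z|lborel. of_real (G \<kappa> (x - z)) * f z)"

definition krein_resolvent ::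
    "real \<Rightarrow> ('n::finite \<Rightarrow> real ^ 3) \<Rightarrow> real \<Rightarrow> wave \<Rightarrow> wave" where
  "krein_resolvent \<alpha> y \<kappa> f = (\<lambda>x. free_resolvent \<kappa> f x +
     (\<Sum>i\<in>UNIV. \<Sum>j\<in>UNIV. of_real (matrix_inv (\<Gamma> \<alpha> y \<kappa>) $ i $ j) *
        (LINT z|lborel. of_real (G \<kappa> (z - y j)) * f z) * of_real (G \<kappa> (x - y i))))"

text \<open>
  That the inverse of $H + \kappa^2$ is the Krein resolvent R means that $H u = g$ holds if and only
  if $u = R (g + \kappa^2 u)$. The conditions for different $\kappa$ are equivalent to each other by
  the resolvent identity, and the determinant is nonzero for all large $\kappa$.
\<close>

definition hamiltonian :: "real \<Rightarrow> ('n::finite \<Rightarrow> real ^ 3) \<Rightarrow> (wave \<times> wave) set" where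
  "hamiltonian \<alpha> y =
     {(u, g). u \<in> L2 \<and> g \<in> L2 \<and>
        (\<forall>\<kappa>>0. det (\<Gamma> \<alpha> y \<kappa>) \<noteq> 0 \<longrightarrow>
           (AE x in lborel. u x = krein_resolvent \<alpha> y \<kappa> (\<lambda>z. g z + of_real (\<kappa>\<^sup>2) * u z) x))}"

definition lambda1 :: "real \<Rightarrow> ('n::finite \<Rightarrow> real ^ 3) \<Rightarrow> real" where
  "lambda1 \<alpha> y = (LEAST l. is_eigenvalue (hamiltonian \<alpha> y) l)"

definition \<alpha>_crit :: "('n::finite \<Rightarrow> real ^ 3) \<Rightarrow> real" where
  "\<alpha>_crit y = (THE a. \<forall>\<alpha>. discrete_spectrum (hamiltonian \<alpha> y) \<noteq> {} \<longleftrightarrow> \<alpha> < a)"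

definition spherical_configurations :: "('n::finite \<Rightarrow> real ^ 3) set" where
  "spherical_configurations = {y. inj y \<and> range y \<subseteq> sphere 0 1}"


section \<open>Configurations on the unit sphere\<close>

definition antipodal_pair :: "(real ^ 3) set \<Rightarrow> bool" where
  "antipodal_pair A \<longleftrightarrow> (\<exists>p \<in> sphere 0 1. A = {p, - p})"

definition great_circle_triangle :: "(real ^ 3) set \<Rightarrow> bool" where
  "great_circle_triangle A \<longleftrightarrow>
     (\<exists>u \<in> sphere 0 1. \<exists>v \<in> sphere 0 1. orthogonal u v \<and>
        A = {u, cos (2 * pi / 3) *\<^sub>R u + sin (2 * pi / 3) *\<^sub>R v,
                cos (4 * pi / 3) *\<^sub>R u + sin (4 * pi / 3) *\<^sub>R v})"

definition inscribed_tetrahedron :: "(real ^ 3) set \<Rightarrow> bool" where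
  "inscribed_tetrahedron A \<longleftrightarrow>
     A \<subseteq> sphere 0 1 \<and> card A = 4 \<and> (\<exists>d. pairwise (\<lambda>p q. dist p q = d) A)"

definition inscribed_octahedron :: "(real ^ 3) set \<Rightarrow> bool" where
  "inscribed_octahedron A \<longleftrightarrow>
     (\<exists>f :: real ^ 3 \<Rightarrow> real ^ 3. orthogonal_transformation f \<and> A = f ` (\<Union>i. {axis i 1, - axis i 1}))"

text \<open>
  The vertices of a regular icosahedron are the cyclic permutations of $(0, \pm 1, \pm\varphi)$,
  where $\varphi$ is the golden ratio; they have norm $\sqrt{1 + \varphi^2}$.
\<close>

definition inscribed_icosahedron :: "(real ^ 3) set \<Rightarrow> bool" where
  "inscribed_icosahedron A \<longleftrightarrow>
     (\<exists>f :: real ^ 3 \<Rightarrow> real ^ 3. orthogonal_transformation f \<and>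
        (let \<phi> = (1 + sqrt 5) / 2 in
         A = f ` (\<Union>s \<in> {1, -1}. \<Union>t \<in> {\<phi>, - \<phi>}.
                    (\<lambda>p. p /\<^sub>R sqrt (1 + \<phi>\<^sup>2)) `
                      {vector [0, s, t], vector [s, t, 0], vector [t, 0, s]})))"

definition symmetric_configuration :: "nat \<Rightarrow> (real ^ 3) set \<Rightarrow> bool" where
  "symmetric_configuration N A \<longleftrightarrow>
     (N = 2 \<and> antipodal_pair A) \<or> (N = 3 \<and> great_circle_triangle A) \<or>
     (N = 4 \<and> inscribed_tetrahedron A) \<or> (N = 6 \<and> inscribed_octahedron A) \<or>
     (N = 12 \<and> inscribed_icosahedron A)"

definition congruent_sets :: "(real ^ 3) set \<Rightarrow> (real ^ 3) set \<Rightarrow> bool" where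
  "congruent_sets A B \<longleftrightarrow>
     (\<exists>f :: real ^ 3 \<Rightarrow> real ^ 3. (\<forall>p q. dist (f p) (f q) = dist p q) \<and> f ` A = B)"

end

(* The negative eigenvalues of the Hamiltonian are the numbers -kappa^2 with det Gamma(kappa) = 0, and the
   quadratic form of Gamma increases strictly in kappa, its derivative being the positive definite
   matrix exp (- kappa |y_i - y_j|) / (4 pi). Hence lambda_1 = -K^2, where K is the unique kappa at which the
   smallest eigenvalue of Gamma vanishes. For the symmetric configuration all row sums of Gamma agree, so the
   constant vector spans its ground state; used as a test vector for another configuration it reduces
   the claim to a comparison of the Yukawa energies sum G_kappa (y_i - y_j).

   The Yukawa kernel is a mixture of Gaussians in the distance, which on the sphere are power series in
   1 + <y_i, y_j> with nonnegative coefficients. It therefore suffices to compare the energies of the powers x^n,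
   x = 1 + <y_i, y_j>. Newton interpolation of x^n at the inner products of the symmetric configuration, double except
   at -1 for the octahedron and the icosahedron, has nonnegative coefficients and a nonnegative remainder (Cohn and
   Kumar). The interpolant has degree at most 4, so its energy is controlled by sharp lower bounds for the first four
   power sums of the Gram matrix. Equality for all n forces the inner products and the power sums, hence the
   configuration up to an isometry. *)

theory Submission
  imports Defs "HOL-Probability.Probability" "HOL-Real_Asymp.Real_Asymp"
begin

text \<open>The operator is known only through its resolvent, and no description of its domain is at
  hand. All operator facts are therefore drawn from one kernel identity, \<open>GG_eq_diff\<close>:
  the difference of the Green functions at two parameters is a multiple of their convolution, and
  the same convolution gives the difference of two matrices \<open>\<Gamma>\<close>
  (\<open>\<Gamma>_diff\<close>). Since \<open>\<alpha>_crit\<close> is a definite description about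
  the discrete spectrum, it also has to be shown that no nonnegative number is an isolated point of
  the spectrum; this is what the singular sequence is for. In the interpolation a simple node at x =
  0 is harmless because 0 is the endpoint of the range x >= 0, so the remainder keeps its sign.
  Restricting to powers turns divided differences into synthetic division, which preserves
  nonnegative coefficients. The regular configurations enter only through their inner products and
  two power sums; these replace the symmetry groups, both for the equality of the row sums and for
  rigidity.\<close>

section \<open>The Gaussian distribution function\<close>

text \<open>E is (1 + erf) / 2. Taking it as a rescaled normal distribution function makes both
  limits instances of general facts, so that only the derivative is left to compute.\<close>

lemma gauss_primitive:
  obtains E :: "real \<Rightarrow> real"
  where "\<And>x. (E has_real_derivative exp (- x\<^sup>2) / sqrt pi) (at x)"
    and "(E \<longlongrightarrow> 1) at_top" and "(E \<longlongrightarrow> 0) at_bot"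
proof -
  interpret real_distribution std_normal_distribution
    by (rule real_dist_normal_dist)
  let ?c = "cdf std_normal_distribution"
  have diff: "?c b - ?c a = integral {a..b} std_normal_density" if "a < b" for a b
  proof -
    have "?c b - ?c a = measure std_normal_distribution {a<..b}"
      by (rule cdf_diff_eq[OF that])
    also have "\<dots> = (LINT x|std_normal_distribution. indicator {a<..b} x)"
      by simp
    also have "\<dots> = (LINT x|lborel. std_normal_density x *\<^sub>R indicator {a<..b} x)"
      by (subst integral_density) auto
    also have "\<dots> = (LINT x:{a..b}|lborel. std_normal_density x)"
      unfolding set_lebesgue_integral_def using AE_lborel_singleton[of a]
      by (intro integral_cong_AE) (auto simp: indicator_def)
    also have "\<dots> = integral {a..b} std_normal_density"
      by (intro set_borel_integral_eq_integral borel_integrable_atLeastAtMost')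
         (auto intro!: continuous_intros simp: std_normal_density_def)
    finally show ?thesis .
  qed
  have der: "(?c has_real_derivative std_normal_density x) (at x)" for x
  proof -
    \<comment> \<open>Differentiability is local: near x the distribution function is its value at x
      - 1 plus an integral from that fixed point.\<close>
    have "((\<lambda>t. integral {x-1..t} std_normal_density) has_real_derivative std_normal_density x)
           (at x within {x-1..x+1})"
      by (rule integral_has_real_derivative)
         (auto intro!: continuous_intros simp: std_normal_density_def)
    then have "((\<lambda>t. integral {x-1..t} std_normal_density) has_real_derivative std_normal_density x) (at x)"
      by (subst (asm) at_within_Icc_at) auto
    then have "((\<lambda>t. ?c (x-1) + integral {x-1..t} std_normal_density) has_real_derivative std_normal_density x) (at x)"
      by (auto intro!: derivative_eq_intros)
    moreover have "\<forall>\<^sub>F t in nhds x. ?c (x-1) + integral {x-1..t} std_normal_density = ?c t"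
    proof (rule eventually_mono)
      show "\<forall>\<^sub>F t in nhds x. t \<in> {x-1<..}"
        by (rule eventually_nhds_in_open) auto
      show "?c (x-1) + integral {x-1..t} std_normal_density = ?c t" if "t \<in> {x-1<..}" for t
        using diff[of "x-1" t] that by auto
    qed
    ultimately show ?thesis
      by (subst (asm) DERIV_cong_ev[OF refl _ refl]) auto
  qed
  show ?thesis
  \<comment> \<open>The variance has to be 1/2, hence the factor sqrt 2.\<close>
  proof (rule that[of "\<lambda>x. ?c (sqrt 2 * x)"])
    show "((\<lambda>x. ?c (sqrt 2 * x)) has_real_derivative exp (- x\<^sup>2) / sqrt pi) (at x)" for x
      using DERIV_chain2[where f = ?c and g = "\<lambda>x. sqrt 2 * x", OF der, of "sqrt 2" x UNIV]
      by (auto simp: std_normal_density_def power_mult_distrib real_sqrt_mult intro!: derivative_eq_intros)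
    show "((\<lambda>x. ?c (sqrt 2 * x)) \<longlongrightarrow> 1) at_top"
      by (rule filterlim_compose[OF cdf_lim_at_top_prob]) real_asymp
    show "((\<lambda>x. ?c (sqrt 2 * x)) \<longlongrightarrow> 0) at_bot"
      by (rule filterlim_compose[OF cdf_lim_at_bot]) real_asymp
  qed
qed

section \<open>Heat kernel and Green function\<close>

text \<open>The kernel of exp (t Laplacian) on R^3, i.e. the joint density of three independent
  centred normal variables of variance 2t.\<close>

definition heat :: "real \<Rightarrow> real ^ 3 \<Rightarrow> real" where
  "heat t x = exp (- (norm x)\<^sup>2 / (4 * t)) / (sqrt (4 * pi * t)) ^ 3"

lemma heat_nonneg [simp]: "t > 0 \<Longrightarrow> 0 \<le> heat t x"
  by (simp add: heat_def)

lemma heat_measurable [measurable]: "(\<lambda>(t, x). heat t x) \<in> borel_measurable (borel \<Otimes>\<^sub>M borel)"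
  unfolding heat_def by measurable

lemma heat_eq_prod:
  assumes "t > 0"
  shows "heat t x = (\<Prod>b\<in>Basis. normal_density 0 (sqrt (2 * t)) (x \<bullet> b))"
proof -
  have "(norm x)\<^sup>2 = (\<Sum>b\<in>Basis. (x \<bullet> b)\<^sup>2)"
    unfolding power2_norm_eq_inner[of x] euclidean_inner[of x x] by (simp add: power2_eq_square)
  then show ?thesis using assms
    by (simp add: heat_def normal_density_def prod_dividef power_divide exp_sum sum_divide_distrib sum_negf[symmetric]
        mult.assoc mult.commute mult.left_commute prod.distrib)
qed

text \<open>Semigroup property: the integral factorises over the coordinates, and in each of them
  the variances of normal densities add under convolution.\<close>

lemma nn_integral_heat_conv:
  assumes "t > 0" "s > 0"
  shows "(\<integral>\<^sup>+z. ennreal (heat t (x - z) * heat s z) \<partial>lborel) = ennreal (heat (t + s) x)"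
proof -
  have "(\<integral>\<^sup>+z. ennreal (heat t (x - z) * heat s z) \<partial>lborel) =
     (\<integral>\<^sup>+z. (\<Prod>b\<in>Basis. ennreal (normal_density 0 (sqrt (2 * t)) (x \<bullet> b - z \<bullet> b) * normal_density 0 (sqrt (2 * s)) (z \<bullet> b))) \<partial>lborel)"
    using assms by (simp add: heat_eq_prod prod.distrib[symmetric] inner_diff_left prod_ennreal)
  also have "\<dots> = (\<Prod>b\<in>Basis. (\<integral>\<^sup>+u. ennreal (normal_density 0 (sqrt (2 * t)) (x \<bullet> b - u) * normal_density 0 (sqrt (2 * s)) u) \<partial>lborel))"
    by (rule nn_integral_lborel_prod) auto
  also have "\<dots> = (\<Prod>b\<in>Basis. ennreal (normal_density 0 (sqrt (2 * (t + s))) (x \<bullet> b)))"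
    using conv_normal_density_zero_mean[of "sqrt (2 * t)" "sqrt (2 * s)", THEN fun_cong] assms
    by (simp add: distrib_left)
  also have "\<dots> = ennreal (heat (t + s) x)"
    using assms by (simp add: heat_eq_prod prod_ennreal)
  finally show ?thesis .
qed

lemma nn_integral_lborel_reflect:
  fixes f :: "'a::euclidean_space \<Rightarrow> ennreal"
  assumes [measurable]: "f \<in> borel_measurable borel"
  shows "(\<integral>\<^sup>+z. f (x - z) \<partial>lborel) = (\<integral>\<^sup>+z. f z \<partial>lborel)"
proof -
  have "(\<integral>\<^sup>+z. f z \<partial>lborel) = (\<integral>\<^sup>+z. f z \<partial>density (distr lborel borel (\<lambda>z. x + (-1) *\<^sub>R z)) (\<lambda>_. ennreal (\<bar>-1\<bar>^DIM('a))))"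
    by (rule arg_cong[where f="\<lambda>M. integral\<^sup>N M f"], rule lborel_affine) simp
  also have "\<dots> = (\<integral>\<^sup>+z. f (x - z) \<partial>lborel)"
    by (simp add: nn_integral_density nn_integral_distr)
  finally show ?thesis by simp
qed

lemma nn_integral_lborel_shift:
  fixes f :: "'a::euclidean_space \<Rightarrow> ennreal"
  assumes [measurable]: "f \<in> borel_measurable borel"
  shows "(\<integral>\<^sup>+z. f (z - x) \<partial>lborel) = (\<integral>\<^sup>+z. f z \<partial>lborel)"
  using nn_integral_lborel_reflect[of "\<lambda>z. f (- z)" x] nn_integral_lborel_reflect[of f 0]
  by simp

text \<open>The real part of the characteristic function. Adding 1 to the cosine keeps the integrand
  nonnegative, so the later exchanges of integrals stay within the nonnegative integral.\<close>

lemma nn_integral_normal_cos: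
  assumes "\<sigma> > 0"
  shows "(\<integral>\<^sup>+u. ennreal (normal_density 0 \<sigma> u * (1 + cos (k * u))) \<partial>lborel) = ennreal (1 + exp (- (k * \<sigma>)\<^sup>2 / 2))"
proof -
  have int: "integrable lborel (\<lambda>u. std_normal_density u *\<^sub>R exp (\<i> * complex_of_real (k * \<sigma> * u)))"
    by (rule Bochner_Integration.integrable_bound[of _ "std_normal_density"])
       (auto simp: integrable_normal_moment[of 1 0 0, simplified])
  have "(CLINT u|std_normal_distribution. exp (\<i> * complex_of_real (k * \<sigma> * u))) = complex_of_real (exp (- ((k * \<sigma>)^2) / 2))"
    using char_std_normal_distribution[THEN fun_cong, of "k * \<sigma>"] by (simp add: char_def)
  then have "(CLINT u|lborel. std_normal_density u *\<^sub>R exp (\<i> * complex_of_real (k * \<sigma> * u))) = complex_of_real (exp (- ((k * \<sigma>)^2) / 2))"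
    by (subst (asm) integral_density) (auto simp: normal_density_nonneg)
  then have c: "has_bochner_integral lborel (\<lambda>u. std_normal_density u *\<^sub>R exp (\<i> * complex_of_real (k * \<sigma> * u))) (complex_of_real (exp (- ((k * \<sigma>)^2) / 2)))"
    using int by (auto simp: has_bochner_integral_iff)
  have "has_bochner_integral lborel (\<lambda>u. Re (std_normal_density u *\<^sub>R exp (\<i> * complex_of_real (k * \<sigma> * u)))) (Re (complex_of_real (exp (- ((k * \<sigma>)^2) / 2))))"
    by (rule has_bochner_integral_bounded_linear[OF bounded_linear_Re c])
  moreover have "has_bochner_integral lborel std_normal_density 1"
    by (simp add: has_bochner_integral_iff)
  ultimately have "has_bochner_integral lborel (\<lambda>u. std_normal_density u + Re (std_normal_density u *\<^sub>R exp (\<i> * complex_of_real (k * \<sigma> * u)))) (1 + Re (complex_of_real (exp (- ((k * \<sigma>)^2) / 2))))"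
    by (intro has_bochner_integral_add)
  then have *: "has_bochner_integral lborel (\<lambda>u. std_normal_density u * (1 + cos (k * \<sigma> * u))) (1 + exp (- ((k * \<sigma>)^2) / 2))"
    by (simp add: Re_exp algebra_simps)
  have "(\<integral>\<^sup>+u. ennreal (normal_density 0 \<sigma> u * (1 + cos (k * u))) \<partial>lborel)
      = ennreal \<sigma> * (\<integral>\<^sup>+u. ennreal (normal_density 0 \<sigma> (\<sigma> * u) * (1 + cos (k * (\<sigma> * u)))) \<partial>lborel)"
    using assms by (subst nn_integral_real_affine[where t=0 and c=\<sigma>]) auto
  also have "\<dots> = (\<integral>\<^sup>+u. ennreal (\<sigma> * (normal_density 0 \<sigma> (\<sigma> * u) * (1 + cos (k * (\<sigma> * u))))) \<partial>lborel)"
    using assms cos_ge_minus_one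
    by (subst nn_integral_cmult[symmetric]) (auto simp: ennreal_mult' intro!: nn_integral_cong)
  also have "\<dots> = (\<integral>\<^sup>+u. ennreal (std_normal_density u * (1 + cos (k * \<sigma> * u))) \<partial>lborel)"
    using assms by (intro nn_integral_cong) (simp add: normal_density_def real_sqrt_mult power_mult_distrib mult.assoc)
  also have "\<dots> = ennreal (1 + exp (- (k * \<sigma>)\<^sup>2 / 2))"
    using * cos_ge_minus_one[of "k * \<sigma> * _"] by (subst nn_integral_eq_integral)
      (auto simp: has_bochner_integral_iff real_0_le_add_iff intro!: mult_nonneg_nonneg AE_I2)
  finally show ?thesis .
qed

lemma nn_integral_heat_cos:
  assumes "t > 0"
  shows "(\<integral>\<^sup>+z. ennreal (heat t z * (1 + cos (k * z $ 1))) \<partial>lborel) = ennreal (1 + exp (- k\<^sup>2 * t))"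
proof -
  let ?b = "axis 1 1 :: real ^ 3"
  define F where "F b u = ennreal (normal_density 0 (sqrt (2 * t)) u) * (if b = ?b then ennreal (1 + cos (k * u)) else 1)" for b u
  have c: "0 \<le> 1 + cos u" for u :: real
    using cos_ge_minus_one[of u] by linarith
  have "?b \<in> Basis" by (simp add: axis_in_Basis_iff)
  then have "(\<Prod>b\<in>Basis. if b = ?b then ennreal (1 + cos (k * (z \<bullet> b))) else 1) = ennreal (1 + cos (k * z $ 1))" for z
    by (subst prod.delta) (auto simp: cart_eq_inner_axis)
  then have "(\<integral>\<^sup>+z. ennreal (heat t z * (1 + cos (k * z $ 1))) \<partial>lborel) = (\<integral>\<^sup>+z. (\<Prod>b\<in>Basis. F b (z \<bullet> b)) \<partial>lborel)"
    using assms c by (simp add: heat_eq_prod F_def prod.distrib prod_ennreal ennreal_mult prod_nonneg)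
  also have "\<dots> = (\<Prod>b\<in>Basis. \<integral>\<^sup>+u. F b u \<partial>lborel)"
    by (rule nn_integral_lborel_prod) (auto simp: F_def)
  also have "\<dots> = (\<Prod>b\<in>Basis. if b = ?b then ennreal (1 + exp (- (k * sqrt (2 * t))\<^sup>2 / 2)) else 1)"
  proof (rule prod.cong)
    fix b :: "real ^ 3" assume "b \<in> Basis"
    have "(\<integral>\<^sup>+u. ennreal (normal_density 0 (sqrt (2 * t)) u) \<partial>lborel) = 1"
      using assms by (subst nn_integral_eq_integral) (auto simp: integrable_normal_moment[of _ _ 0, simplified])
    moreover have "(\<integral>\<^sup>+u. ennreal (normal_density 0 (sqrt (2 * t)) u) * ennreal (1 + cos (k * u)) \<partial>lborel)
       = ennreal (1 + exp (- (k * sqrt (2 * t))\<^sup>2 / 2))"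
      using nn_integral_normal_cos[of "sqrt (2 * t)" k] assms c by (simp add: ennreal_mult)
    ultimately show "(\<integral>\<^sup>+u. F b u \<partial>lborel) = (if b = ?b then ennreal (1 + exp (- (k * sqrt (2 * t))\<^sup>2 / 2)) else 1)"
      by (simp add: F_def)
  qed simp
  also have "\<dots> = ennreal (1 + exp (- k\<^sup>2 * t))"
    using assms \<open>?b \<in> Basis\<close> by (subst prod.delta) (simp_all add: power_mult_distrib)
  finally show ?thesis .
qed

lemma nn_integral_heat:
  assumes "t > 0"
  shows "(\<integral>\<^sup>+z. ennreal (heat t z) \<partial>lborel) = 1"
proof -
  have "(\<integral>\<^sup>+z. ennreal (heat t z) * 2 \<partial>lborel) = 2"
    using nn_integral_heat_cos[OF assms, of 0] assms by (simp add: ennreal_mult)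
  then have "(\<integral>\<^sup>+z. ennreal (heat t z) \<partial>lborel) * 2 = 1 * 2"
    by (subst (asm) nn_integral_multc) auto
  then show ?thesis
    using mult_right_ennreal_cancel[of _ 2 1] by simp
qed

text \<open>The resolvent is the Laplace transform of the heat semigroup. In three dimensions the
  time integral has a closed primitive in terms of the Gaussian distribution function.\<close>

lemma nn_integral_heat_time:
  assumes k: "\<kappa> > 0" and x: "x \<noteq> 0"
  shows "(\<integral>\<^sup>+t\<in>{0<..}. ennreal (exp (- \<kappa>\<^sup>2 * t) * heat t x) \<partial>lborel) = ennreal (G \<kappa> x)"
proof -
  obtain E :: "real \<Rightarrow> real" where E: "\<And>x. (E has_real_derivative exp (- x\<^sup>2) / sqrt pi) (at x)"
    and E1: "(E \<longlongrightarrow> 1) at_top" and E0: "(E \<longlongrightarrow> 0) at_bot"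
    using gauss_primitive by blast
  define r where "r = norm x"
  have r: "r > 0" using x by (simp add: r_def)
  define f where "f t = exp (- \<kappa>\<^sup>2 * t) * heat t x" for t
  \<comment> \<open>The squares of the two arguments of \<open>E\<close> differ from kappa^2 t + r^2
    / (4t) only by the constants -2 kappa r / 2 and +2 kappa r / 2. With the weight exp (2 kappa r)
    both terms carry the same Gaussian, the kappa parts of the inner derivatives cancel, and the r
    parts add up to the heat kernel.\<close>
  define F where "F t = exp (- \<kappa> * r) / (4 * pi * r) *
     (E (\<kappa> * sqrt t - r / (2 * sqrt t)) + exp (2 * \<kappa> * r) * E (- \<kappa> * sqrt t - r / (2 * sqrt t)))" for t
  have dF: "(F has_real_derivative f t) (at t)" if t: "t > 0" for t
  proof -
    define w where "w = sqrt t"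
    have w: "w > 0" "w\<^sup>2 = t" "w \<noteq> 0" using t by (auto simp: w_def)
    have d1: "((\<lambda>t. \<kappa> * sqrt t - r / (2 * sqrt t)) has_real_derivative \<kappa> / (2 * w) + r / (4 * w ^ 3)) (at t)"
      using t w by (auto intro!: derivative_eq_intros simp: w_def[symmetric] field_simps power3_eq_cube power2_eq_square)
    have d2: "((\<lambda>t. - \<kappa> * sqrt t - r / (2 * sqrt t)) has_real_derivative - \<kappa> / (2 * w) + r / (4 * w ^ 3)) (at t)"
      using t w by (auto intro!: derivative_eq_intros simp: w_def[symmetric] field_simps power3_eq_cube power2_eq_square)
    define e where "e = exp (- \<kappa>\<^sup>2 * t - r\<^sup>2 / (4 * t))"
    have e1: "exp (- (\<kappa> * w - r / (2 * w))\<^sup>2) = exp (\<kappa> * r) * e"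
      using w unfolding e_def exp_add[symmetric] by (simp add: power2_diff power_divide power_mult_distrib)
    have e2: "exp (- (- \<kappa> * w - r / (2 * w))\<^sup>2) = exp (- \<kappa> * r) * e"
      using w unfolding e_def exp_add[symmetric] by (simp add: power2_diff power_divide power_mult_distrib)
    have "(F has_real_derivative exp (- \<kappa> * r) / (4 * pi * r) *
       (exp (\<kappa> * r) * e / sqrt pi * (\<kappa> / (2 * w) + r / (4 * w ^ 3)) + exp (2 * \<kappa> * r) *
         (exp (- \<kappa> * r) * e / sqrt pi * (- \<kappa> / (2 * w) + r / (4 * w ^ 3))))) (at t)"
      unfolding F_def
      using DERIV_chain2[OF E d1] DERIV_chain2[OF E d2]
      by (intro DERIV_cmult DERIV_add) (simp_all only: e1 e2 w_def[symmetric] times_divide_eq_left)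
    also have "exp (- \<kappa> * r) / (4 * pi * r) *
       (exp (\<kappa> * r) * e / sqrt pi * (\<kappa> / (2 * w) + r / (4 * w ^ 3)) + exp (2 * \<kappa> * r) *
         (exp (- \<kappa> * r) * e / sqrt pi * (- \<kappa> / (2 * w) + r / (4 * w ^ 3)))) =
       (exp (- \<kappa> * r) * exp (\<kappa> * r)) / (4 * pi * r) * (e / sqrt pi) * (r / (2 * w ^ 3))"
      unfolding mult_2[of \<kappa>] distrib_right exp_add by (simp add: algebra_simps exp_minus)
    also have "\<dots> = e / (sqrt (4 * pi * t)) ^ 3"
      using r w by (simp add: exp_minus real_sqrt_mult w_def[symmetric] power_mult_distrib power3_eq_cube)
    also have "\<dots> = f t"
      by (simp add: f_def heat_def e_def r_def exp_diff exp_minus field_simps)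
    finally show ?thesis .
  qed
  have 1: "DERIV F t :> f t" if "0 < ereal t" "ereal t < \<infinity>" for t
    using dF that by (simp add: zero_ereal_def)
  have 2: "isCont f t" if "0 < ereal t" "ereal t < \<infinity>" for t
    using that unfolding f_def heat_def by (auto intro!: continuous_intros simp: zero_ereal_def)
  have 3: "AE t in lborel. 0 < ereal t \<longrightarrow> ereal t < \<infinity> \<longrightarrow> 0 \<le> f t"
    by (auto simp: f_def)
  \<comment> \<open>At 0 both arguments of \<open>E\<close> tend to minus infinity. At infinity the
    first one changes sign, and its limit 1 leaves exactly the prefactor, which is the Green
    function.\<close>
  have 4: "((F \<circ> real_of_ereal) \<longlongrightarrow> 0) (at_right 0)"
  proof -
    have 1: "filterlim (\<lambda>t. \<kappa> * sqrt t - r / (2 * sqrt t)) at_bot (at_right 0)"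
      using k r by real_asymp
    have 2: "filterlim (\<lambda>t. - \<kappa> * sqrt t - r / (2 * sqrt t)) at_bot (at_right 0)"
      using k r by real_asymp
    have "(F \<longlongrightarrow> exp (- \<kappa> * r) / (4 * pi * r) * (0 + exp (2 * \<kappa> * r) * 0)) (at_right 0)"
      unfolding F_def by (intro tendsto_intros filterlim_compose[OF E0 1] filterlim_compose[OF E0 2])
    then show ?thesis by (simp add: zero_ereal_def ereal_tendsto_simps)
  qed
  have 5: "((F \<circ> real_of_ereal) \<longlongrightarrow> G \<kappa> x) (at_left \<infinity>)"
  proof -
    have 1: "filterlim (\<lambda>t. \<kappa> * sqrt t - r / (2 * sqrt t)) at_top at_top"
      using k r by real_asymp
    have 2: "filterlim (\<lambda>t. - \<kappa> * sqrt t - r / (2 * sqrt t)) at_bot at_top"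
      using k r by real_asymp
    have "(F \<longlongrightarrow> exp (- \<kappa> * r) / (4 * pi * r) * (1 + exp (2 * \<kappa> * r) * 0)) at_top"
      unfolding F_def by (intro tendsto_intros filterlim_compose[OF E1 1] filterlim_compose[OF E0 2])
    then show ?thesis by (simp add: ereal_tendsto_simps G_def r_def)
  qed
  have "set_integrable lborel (einterval 0 \<infinity>) f" "(LBINT t=0..\<infinity>. f t) = G \<kappa> x"
    using interval_integral_FTC_nonneg[of 0 \<infinity> F f, OF _ 1 2 3 4 5] by auto
  then have "set_integrable lborel {0<..} f" "(LINT t:{0<..}|lborel. f t) = G \<kappa> x"
    by (auto simp: interval_lebesgue_integral_def zero_ereal_def)
  then have "(\<integral>\<^sup>+t. ennreal (indicator {0<..} t *\<^sub>R f t) \<partial>lborel) = ennreal (G \<kappa> x)"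
    by (subst nn_integral_eq_integral)
       (auto simp: set_integrable_def set_lebesgue_integral_def f_def indicator_def)
  then show ?thesis
    unfolding f_def by (simp add: ennreal_mult' ennreal_indicator mult.commute)
qed

lemma heat_measurable' [measurable (raw)]:
  assumes [measurable]: "f \<in> borel_measurable M" "g \<in> borel_measurable M"
  shows "(\<lambda>z. heat (f z) (g z)) \<in> borel_measurable M"
  unfolding heat_def by measurable

lemma G_measurable [measurable (raw)]:
  assumes [measurable]: "g \<in> borel_measurable M"
  shows "(\<lambda>z. G \<kappa> (g z)) \<in> borel_measurable M"
  unfolding G_def by measurable

lemma G_nonneg [simp]: "0 \<le> G \<kappa> x"
  by (simp add: G_def)

lemma G_commute: "G \<kappa> (x - y) = G \<kappa> (y - x)"
  by (simp add: G_def norm_minus_commute)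

lemma nn_integral_exp:
  fixes a :: real
  assumes "a > 0"
  shows "(\<integral>\<^sup>+t\<in>{0<..}. ennreal (exp (- a * t)) \<partial>lborel) = ennreal (1 / a)"
proof -
  have "(\<integral>\<^sup>+t. ennreal (exp (- a * t)) * indicator {0..} t \<partial>lborel) = 0 - (- exp (- a * 0) / a)"
    using assms
    by (intro nn_integral_FTC_atLeast[where F = "\<lambda>t. - exp (- a * t) / a"])
       (auto intro!: derivative_eq_intros, real_asymp)
  also have "(\<integral>\<^sup>+t. ennreal (exp (- a * t)) * indicator {0..} t \<partial>lborel)
      = (\<integral>\<^sup>+t\<in>{0<..}. ennreal (exp (- a * t)) \<partial>lborel)"
    by (rule nn_integral_cong_AE, rule eventually_mono[OF AE_lborel_singleton[of 0]])
       (auto simp: indicator_def)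
  finally show ?thesis by simp
qed

text \<open>Reduces integrals against the Green function to Gaussian ones, by exchanging the space
  and time integrals.\<close>

lemma nn_integral_G_mult:
  fixes \<phi> :: "real ^ 3 \<Rightarrow> ennreal"
  assumes "\<kappa> > 0" and [measurable]: "\<phi> \<in> borel_measurable borel"
  shows "(\<integral>\<^sup>+z. ennreal (G \<kappa> z) * \<phi> z \<partial>lborel) =
    (\<integral>\<^sup>+t\<in>{0<..}. ennreal (exp (- \<kappa>\<^sup>2 * t)) * (\<integral>\<^sup>+z. ennreal (heat t z) * \<phi> z \<partial>lborel) \<partial>lborel)"
proof -
  have "(\<integral>\<^sup>+z. ennreal (G \<kappa> z) * \<phi> z \<partial>lborel) =
    (\<integral>\<^sup>+z. (\<integral>\<^sup>+t\<in>{0<..}. ennreal (exp (- \<kappa>\<^sup>2 * t) * heat t z) \<partial>lborel) * \<phi> z \<partial>lborel)"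
  \<comment> \<open>The origin is excluded: there the time integral diverges, while \<open>G\<close>
    has the value 0 by the convention for division by zero.\<close>
  proof (rule nn_integral_cong_AE, rule eventually_mono[OF AE_lborel_singleton[of 0]])
    fix z :: "real ^ 3" assume "z \<noteq> 0"
    show "ennreal (G \<kappa> z) * \<phi> z = (\<integral>\<^sup>+t\<in>{0<..}. ennreal (exp (- \<kappa>\<^sup>2 * t) * heat t z) \<partial>lborel) * \<phi> z"
      unfolding nn_integral_heat_time[OF assms(1) \<open>z \<noteq> 0\<close>] ..
  qed
  also have "\<dots> = (\<integral>\<^sup>+z. (\<integral>\<^sup>+t. ennreal (exp (- \<kappa>\<^sup>2 * t) * heat t z) * indicator {0<..} t * \<phi> z \<partial>lborel) \<partial>lborel)"
    by (intro nn_integral_cong nn_integral_multc[symmetric]) measurable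
  also have "\<dots> = (\<integral>\<^sup>+t. (\<integral>\<^sup>+z. ennreal (exp (- \<kappa>\<^sup>2 * t) * heat t z) * indicator {0<..} t * \<phi> z \<partial>lborel) \<partial>lborel)"
    by (rule lborel_pair.Fubini') measurable
  also have "\<dots> = (\<integral>\<^sup>+t. (\<integral>\<^sup>+z. (ennreal (exp (- \<kappa>\<^sup>2 * t)) * indicator {0<..} t) * (ennreal (heat t z) * \<phi> z) \<partial>lborel) \<partial>lborel)"
    by (intro nn_integral_cong) (auto simp: indicator_def ennreal_mult' mult.assoc)
  also have "\<dots> = (\<integral>\<^sup>+t. (ennreal (exp (- \<kappa>\<^sup>2 * t)) * indicator {0<..} t) * (\<integral>\<^sup>+z. (ennreal (heat t z) * \<phi> z) \<partial>lborel) \<partial>lborel)"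
    by (intro nn_integral_cong nn_integral_cmult) measurable
  finally show ?thesis by (simp add: ac_simps)
qed

text \<open>The first summand is the total mass of the Green function, the second its Fourier
  transform at k times the first unit vector.\<close>

lemma nn_integral_G_cos:
  assumes "\<kappa> > 0"
  shows "(\<integral>\<^sup>+z. ennreal (G \<kappa> z * (1 + cos (k * z $ 1))) \<partial>lborel) = ennreal (1 / \<kappa>\<^sup>2 + 1 / (\<kappa>\<^sup>2 + k\<^sup>2))"
proof -
  have c: "0 \<le> 1 + cos u" for u :: real
    using cos_ge_minus_one[of u] by linarith
  have "(\<integral>\<^sup>+z. ennreal (G \<kappa> z * (1 + cos (k * z $ 1))) \<partial>lborel) = (\<integral>\<^sup>+z. ennreal (G \<kappa> z) * ennreal (1 + cos (k * z $ 1)) \<partial>lborel)"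
    using c by (simp add: ennreal_mult)
  also have "\<dots> = (\<integral>\<^sup>+t\<in>{0<..}. ennreal (exp (- \<kappa>\<^sup>2 * t)) * (\<integral>\<^sup>+z. ennreal (heat t z) * ennreal (1 + cos (k * z $ 1)) \<partial>lborel) \<partial>lborel)"
    by (rule nn_integral_G_mult[OF assms]) measurable
  also have "\<dots> = (\<integral>\<^sup>+t. ennreal (exp (- \<kappa>\<^sup>2 * t)) * indicator {0<..} t + ennreal (exp (- (\<kappa>\<^sup>2 + k\<^sup>2) * t)) * indicator {0<..} t \<partial>lborel)"
    using c nn_integral_heat_cos[of _ k]
    by (intro nn_integral_cong)
       (auto simp: indicator_def ennreal_mult[symmetric] distrib_left ring_distribs mult_exp_exp simp flip: ennreal_plus)
  also have "\<dots> = ennreal (1 / \<kappa>\<^sup>2) + ennreal (1 / (\<kappa>\<^sup>2 + k\<^sup>2))"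
    using assms nn_integral_exp[of "\<kappa>\<^sup>2"] nn_integral_exp[of "\<kappa>\<^sup>2 + k\<^sup>2"]
    by (subst nn_integral_add) (auto simp: add_pos_nonneg)
  finally show ?thesis by simp
qed

lemma nn_integral_G:
  assumes "\<kappa> > 0"
  shows "(\<integral>\<^sup>+z. ennreal (G \<kappa> z) \<partial>lborel) = ennreal (1 / \<kappa>\<^sup>2)"
proof -
  have "(\<integral>\<^sup>+z. ennreal (G \<kappa> z) \<partial>lborel) =
    (\<integral>\<^sup>+t\<in>{0<..}. ennreal (exp (- \<kappa>\<^sup>2 * t)) * (\<integral>\<^sup>+z. ennreal (heat t z) * 1 \<partial>lborel) \<partial>lborel)"
    using nn_integral_G_mult[OF assms, of "\<lambda>_. 1"] by simp
  also have "\<dots> = (\<integral>\<^sup>+t\<in>{0<..}. ennreal (exp (- \<kappa>\<^sup>2 * t)) \<partial>lborel)"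
    by (intro nn_integral_cong) (auto simp: indicator_def nn_integral_heat)
  finally show ?thesis using nn_integral_exp[of "\<kappa>\<^sup>2"] assms by simp
qed

section \<open>Convolution of two Green functions\<close>

text \<open>The kernel of the product of two free resolvents as a double Laplace transform. Being a
  nonnegative integral, it makes sense also at w = 0 and for equal parameters, where the closed form
  degenerates.\<close>

definition GG_heat :: "real \<Rightarrow> real \<Rightarrow> real ^ 3 \<Rightarrow> ennreal" where
  "GG_heat \<kappa> \<mu> w = (\<integral>\<^sup>+t. (\<integral>\<^sup>+s. ennreal (exp (- \<kappa>\<^sup>2 * t) * exp (- \<mu>\<^sup>2 * s) * heat (t + s) w) *
      indicator {0<..} s * indicator {0<..} t \<partial>lborel) \<partial>lborel)"

text \<open>Each reflection of the integration variable puts one of the two Green functions into the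
  form required by \<open>nn_integral_G_mult\<close>; the remaining space integral is the semigroup
  property of the heat kernel.\<close>

lemma nn_integral_G_G_heat:
  assumes "\<kappa> > 0" "\<mu> > 0"
  shows "(\<integral>\<^sup>+z. ennreal (G \<kappa> (x - z)) * ennreal (G \<mu> (z - y)) \<partial>lborel) = GG_heat \<kappa> \<mu> (x - y)"
proof -
  have "(\<integral>\<^sup>+z. ennreal (G \<kappa> (x - z)) * ennreal (G \<mu> (z - y)) \<partial>lborel) =
     (\<integral>\<^sup>+z. ennreal (G \<kappa> z) * ennreal (G \<mu> (x - z - y)) \<partial>lborel)"
    using nn_integral_lborel_reflect[of "\<lambda>z. ennreal (G \<kappa> z) * ennreal (G \<mu> (x - z - y))" x]
    by simp
  also have "\<dots> = (\<integral>\<^sup>+t\<in>{0<..}. ennreal (exp (- \<kappa>\<^sup>2 * t)) *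
      (\<integral>\<^sup>+z. ennreal (heat t z) * ennreal (G \<mu> (x - z - y)) \<partial>lborel) \<partial>lborel)"
    by (rule nn_integral_G_mult[OF assms(1)]) measurable
  also have "\<dots> = GG_heat \<kappa> \<mu> (x - y)"
    unfolding GG_heat_def
  proof (rule nn_integral_cong)
    fix t :: real
    have "(\<integral>\<^sup>+z. ennreal (heat t z) * ennreal (G \<mu> (x - z - y)) \<partial>lborel) =
        (\<integral>\<^sup>+s\<in>{0<..}. ennreal (exp (- \<mu>\<^sup>2 * s)) * ennreal (heat (t + s) (x - y)) \<partial>lborel)" if t: "t > 0"
    proof -
      have "(\<integral>\<^sup>+z. ennreal (heat t z) * ennreal (G \<mu> (x - z - y)) \<partial>lborel) =
         (\<integral>\<^sup>+z. ennreal (G \<mu> z) * ennreal (heat t (x - y - z)) \<partial>lborel)"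
        using nn_integral_lborel_reflect[of "\<lambda>z. ennreal (G \<mu> z) * ennreal (heat t (x - y - z))" "x - y"]
        by (simp add: algebra_simps)
      also have "\<dots> = (\<integral>\<^sup>+s\<in>{0<..}. ennreal (exp (- \<mu>\<^sup>2 * s)) *
          (\<integral>\<^sup>+z. ennreal (heat s z) * ennreal (heat t (x - y - z)) \<partial>lborel) \<partial>lborel)"
        by (rule nn_integral_G_mult[OF assms(2)]) measurable
      also have "\<dots> = (\<integral>\<^sup>+s\<in>{0<..}. ennreal (exp (- \<mu>\<^sup>2 * s)) * ennreal (heat (t + s) (x - y)) \<partial>lborel)"
        using nn_integral_heat_conv[OF t, of _ "x - y"] t
        by (intro nn_integral_cong) (auto simp: indicator_def ennreal_mult mult.commute)
      finally show ?thesis .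
    qed
    then show "ennreal (exp (- \<kappa>\<^sup>2 * t)) * (\<integral>\<^sup>+z. ennreal (heat t z) * ennreal (G \<mu> (x - z - y)) \<partial>lborel) *
        indicator {0<..} t = (\<integral>\<^sup>+s. ennreal (exp (- \<kappa>\<^sup>2 * t) * exp (- \<mu>\<^sup>2 * s) * heat (t + s) (x - y)) *
      indicator {0<..} s * indicator {0<..} t \<partial>lborel)"
      by (cases "t > 0")
         (auto simp: nn_integral_cmult[symmetric] ennreal_mult' mult.assoc intro!: nn_integral_cong)
  qed
  finally show ?thesis .
qed

text \<open>With the total time as new variable the heat kernel leaves the inner integral, which
  becomes an elementary exponential one. What remains is a difference of two Laplace
  transforms.\<close>

lemma GG_heat_eq:
  assumes "0 < \<kappa>" "\<kappa> < \<mu>" "w \<noteq> 0"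
  shows "GG_heat \<kappa> \<mu> w = ennreal ((G \<kappa> w - G \<mu> w) / (\<mu>\<^sup>2 - \<kappa>\<^sup>2))"
proof -
  define d where "d = \<mu>\<^sup>2 - \<kappa>\<^sup>2"
  have d: "d > 0" using assms by (simp add: d_def power_strict_mono)
  \<comment> \<open>From here on \<open>s\<close> denotes the total time, so the constraint becomes
    0 < t < s.\<close>
  have "GG_heat \<kappa> \<mu> w = (\<integral>\<^sup>+t. (\<integral>\<^sup>+s. ennreal (exp (- \<kappa>\<^sup>2 * t) * exp (- \<mu>\<^sup>2 * (s - t)) * heat s w) *
      indicator {0<..} (s - t) * indicator {0<..} t \<partial>lborel) \<partial>lborel)"
    unfolding GG_heat_def
  proof (rule nn_integral_cong)
    fix t :: real
    show "(\<integral>\<^sup>+s. ennreal (exp (- \<kappa>\<^sup>2 * t) * exp (- \<mu>\<^sup>2 * s) * heat (t + s) w) *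
      indicator {0<..} s * indicator {0<..} t \<partial>lborel) = (\<integral>\<^sup>+s. ennreal (exp (- \<kappa>\<^sup>2 * t) * exp (- \<mu>\<^sup>2 * (s - t)) * heat s w) *
      indicator {0<..} (s - t) * indicator {0<..} t \<partial>lborel)"
      using nn_integral_lborel_shift[of "\<lambda>s. ennreal (exp (- \<kappa>\<^sup>2 * t) * exp (- \<mu>\<^sup>2 * s) * heat (t + s) w) *
        indicator {0<..} s * indicator {0<..} t" t]
      by simp
  qed
  also have "\<dots> = (\<integral>\<^sup>+s. (\<integral>\<^sup>+t. ennreal (exp (- \<kappa>\<^sup>2 * t) * exp (- \<mu>\<^sup>2 * (s - t)) * heat s w) *
      indicator {0<..} (s - t) * indicator {0<..} t \<partial>lborel) \<partial>lborel)"
    by (rule lborel_pair.Fubini') measurable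
  also have "\<dots> = (\<integral>\<^sup>+s. (\<integral>\<^sup>+t. ennreal (exp (- \<mu>\<^sup>2 * s) * heat s w * exp (d * t)) *
      indicator {0..s} t \<partial>lborel) * indicator {0<..} s \<partial>lborel)"
  proof (rule nn_integral_cong)
    fix s :: real
    have "(\<integral>\<^sup>+t. ennreal (exp (- \<kappa>\<^sup>2 * t) * exp (- \<mu>\<^sup>2 * (s - t)) * heat s w) *
      indicator {0<..} (s - t) * indicator {0<..} t \<partial>lborel) =
      (\<integral>\<^sup>+t. ennreal (exp (- \<mu>\<^sup>2 * s) * heat s w * exp (d * t)) * indicator {0..s} t * indicator {0<..} s \<partial>lborel)"
      using AE_lborel_singleton[of 0] AE_lborel_singleton[of s]
      by (intro nn_integral_cong_AE)
         (auto simp: indicator_def d_def mult_exp_exp algebra_simps)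
    then show "(\<integral>\<^sup>+t. ennreal (exp (- \<kappa>\<^sup>2 * t) * exp (- \<mu>\<^sup>2 * (s - t)) * heat s w) *
      indicator {0<..} (s - t) * indicator {0<..} t \<partial>lborel) =
      (\<integral>\<^sup>+t. ennreal (exp (- \<mu>\<^sup>2 * s) * heat s w * exp (d * t)) * indicator {0..s} t \<partial>lborel) * indicator {0<..} s"
      by (simp add: nn_integral_multc)
  qed
  also have "\<dots> = (\<integral>\<^sup>+s. ennreal ((exp (- \<kappa>\<^sup>2 * s) - exp (- \<mu>\<^sup>2 * s)) * heat s w / d) * indicator {0<..} s \<partial>lborel)"
  proof (rule nn_integral_cong)
    fix s :: real
    show "(\<integral>\<^sup>+t. ennreal (exp (- \<mu>\<^sup>2 * s) * heat s w * exp (d * t)) * indicator {0..s} t \<partial>lborel) * indicator {0<..} s =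
      ennreal ((exp (- \<kappa>\<^sup>2 * s) - exp (- \<mu>\<^sup>2 * s)) * heat s w / d) * indicator {0<..} s"
    proof (cases "s > 0")
      case True
      have "(\<integral>\<^sup>+t. ennreal (exp (- \<mu>\<^sup>2 * s) * heat s w * exp (d * t)) * indicator {0..s} t \<partial>lborel) =
         ennreal (exp (- \<mu>\<^sup>2 * s) * heat s w * exp (d * s) / d - exp (- \<mu>\<^sup>2 * s) * heat s w * exp (d * 0) / d)"
        using True d
        by (intro nn_integral_FTC_Icc[where F = "\<lambda>t. exp (- \<mu>\<^sup>2 * s) * heat s w * exp (d * t) / d"])
           (auto intro!: derivative_eq_intros)
      also have "exp (- \<mu>\<^sup>2 * s) * heat s w * exp (d * s) / d - exp (- \<mu>\<^sup>2 * s) * heat s w * exp (d * 0) / d =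
         (exp (- \<mu>\<^sup>2 * s) * exp (d * s) - exp (- \<mu>\<^sup>2 * s)) * heat s w / d"
        by (simp add: field_simps diff_divide_distrib)
      also have "exp (- \<mu>\<^sup>2 * s) * exp (d * s) = exp (- \<kappa>\<^sup>2 * s)"
        by (simp add: mult_exp_exp d_def algebra_simps)
      finally show ?thesis by (simp only:)
    qed simp
  qed
  also have "\<dots> = ennreal (1 / d) * (\<integral>\<^sup>+s. ennreal (exp (- \<kappa>\<^sup>2 * s) * heat s w) * indicator {0<..} s -
       ennreal (exp (- \<mu>\<^sup>2 * s) * heat s w) * indicator {0<..} s \<partial>lborel)"
    using d by (subst nn_integral_cmult[symmetric])
      (auto intro!: nn_integral_cong simp: indicator_def ennreal_mult[symmetric] ennreal_minus left_diff_distrib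
         simp flip: ennreal_mult')
  also have "(\<integral>\<^sup>+s. ennreal (exp (- \<kappa>\<^sup>2 * s) * heat s w) * indicator {0<..} s -
       ennreal (exp (- \<mu>\<^sup>2 * s) * heat s w) * indicator {0<..} s \<partial>lborel) = ennreal (G \<kappa> w) - ennreal (G \<mu> w)"
    using assms d nn_integral_heat_time[of \<kappa> w] nn_integral_heat_time[of \<mu> w]
    by (subst nn_integral_diff)
       (auto simp: indicator_def d_def intro!: ennreal_leI mult_right_mono)
  finally show ?thesis
    using d ennreal_mult'[of "1 / d" "G \<kappa> w - G \<mu> w"] by (simp add: d_def ennreal_minus)
qed

lemma GG_heat_commute: "GG_heat \<kappa> \<mu> w = GG_heat \<mu> \<kappa> w"
  unfolding GG_heat_def
  by (subst lborel_pair.Fubini') (auto simp: ac_simps intro!: nn_integral_cong)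

text \<open>Monotone convergence: the integrand increases when the second parameter or the distance
  decreases. This gives access to the degenerate cases.\<close>

lemma GG_heat_tendsto:
  assumes "\<kappa> > 0" "decseq m" "m \<longlonglongrightarrow> \<mu>" "\<mu> > 0"
    and "decseq (\<lambda>n. norm (v n))" "(\<lambda>n. norm (v n)) \<longlonglongrightarrow> norm w"
  shows "(\<lambda>n. GG_heat \<kappa> (m n) (v n)) \<longlonglongrightarrow> GG_heat \<kappa> \<mu> w"
proof -
  have m: "m n > 0" for n using decseq_ge[OF assms(2,3), of n] assms by linarith
  have mono: "ennreal (exp (- \<kappa>\<^sup>2 * t) * exp (- (m i)\<^sup>2 * s) * heat (t + s) (v i)) * indicator {0<..} s * indicator {0<..} t
    \<le> ennreal (exp (- \<kappa>\<^sup>2 * t) * exp (- (m j)\<^sup>2 * s) * heat (t + s) (v j)) * indicator {0<..} s * indicator {0<..} t"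
    if "i \<le> j" for i j t s
  proof (cases "s > 0 \<and> t > 0")
    case True
    have "(m j)\<^sup>2 * s \<le> (m i)\<^sup>2 * s" "(norm (v j))\<^sup>2 \<le> (norm (v i))\<^sup>2"
      using True m decseqD[OF assms(2) that] decseqD[OF assms(5) that]
      by (auto intro!: mult_right_mono power_mono simp: less_imp_le)
    then show ?thesis using True
      by (auto simp: heat_def intro!: ennreal_leI mult_mono divide_right_mono)
  qed auto
  have lim: "(\<lambda>n. ennreal (exp (- \<kappa>\<^sup>2 * t) * exp (- (m n)\<^sup>2 * s) * heat (t + s) (v n)) * indicator {0<..} s * indicator {0<..} t)
    \<longlonglongrightarrow> ennreal (exp (- \<kappa>\<^sup>2 * t) * exp (- \<mu>\<^sup>2 * s) * heat (t + s) w) * indicator {0<..} s * indicator {0<..} t" for s t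
  proof (cases "s > 0 \<and> t > 0")
    case True
    then show ?thesis
      unfolding heat_def using assms(3,6) by (auto intro!: tendsto_intros tendsto_ennrealI)
  qed auto
  show ?thesis
    unfolding GG_heat_def
  proof (rule nn_integral_LIMSEQ)
    show "incseq (\<lambda>n t. \<integral>\<^sup>+ s. ennreal (exp (- \<kappa>\<^sup>2 * t) * exp (- (m n)\<^sup>2 * s) * heat (t + s) (v n)) *
                 indicator {0<..} s * indicator {0<..} t \<partial>lborel)"
      using mono by (auto simp: incseq_def le_fun_def intro!: nn_integral_mono)
    show "(\<lambda>n. \<integral>\<^sup>+ s. ennreal (exp (- \<kappa>\<^sup>2 * t) * exp (- (m n)\<^sup>2 * s) * heat (t + s) (v n)) *
                 indicator {0<..} s * indicator {0<..} t \<partial>lborel) \<longlonglongrightarrow>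
       (\<integral>\<^sup>+ s. ennreal (exp (- \<kappa>\<^sup>2 * t) * exp (- \<mu>\<^sup>2 * s) * heat (t + s) w) *
                 indicator {0<..} s * indicator {0<..} t \<partial>lborel)" for t
      by (rule nn_integral_LIMSEQ[OF _ _ lim]) (use mono in \<open>auto simp: incseq_def le_fun_def\<close>)
  qed measurable
qed

text \<open>
  The convolution of two Green functions as a function of the distance, in the limiting form where the
  quotient degenerates.
\<close>

definition GG :: "real \<Rightarrow> real \<Rightarrow> real \<Rightarrow> real" where
  "GG \<kappa> \<mu> r = (if \<kappa> = \<mu> then exp (- \<kappa> * r) / (8 * pi * \<kappa>)
     else if r = 0 then 1 / (4 * pi * (\<kappa> + \<mu>))
     else (exp (- \<kappa> * r) - exp (- \<mu> * r)) / (4 * pi * r * (\<mu>\<^sup>2 - \<kappa>\<^sup>2)))"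

text \<open>The generic case is the closed form. The point w = 0 and then equal parameters are
  reached along decreasing sequences, on which both sides converge.\<close>

lemma GG_heat_eq_GG:
  assumes "\<kappa> > 0" "\<mu> > 0"
  shows "GG_heat \<kappa> \<mu> w = ennreal (GG \<kappa> \<mu> (norm w))"
proof -
  have neq: "GG_heat \<kappa> \<mu> w = ennreal (GG \<kappa> \<mu> (norm w))" if "\<kappa> \<noteq> \<mu>" "w \<noteq> 0" "\<kappa> > 0" "\<mu> > 0" for \<kappa> \<mu> and w :: "real ^ 3"
  proof (cases "\<kappa> < \<mu>")
    case True
    then show ?thesis using GG_heat_eq[of \<kappa> \<mu> w] that
      by (simp add: GG_def G_def diff_divide_distrib)
  next
    case False
    have "(G \<mu> w - G \<kappa> w) / (\<kappa>\<^sup>2 - \<mu>\<^sup>2) = GG \<kappa> \<mu> (norm w)"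
      using that False minus_divide_divide[of "exp (-\<kappa> * norm w) - exp (- \<mu> * norm w)" "4 * pi * norm w * (\<mu>\<^sup>2 - \<kappa>\<^sup>2)"]
      by (simp add: GG_def G_def diff_divide_distrib[symmetric] algebra_simps)
    then show ?thesis using GG_heat_eq[of \<mu> \<kappa> w] that False
      by (simp add: GG_heat_commute[of \<kappa>])
  qed
  have neq': "GG_heat \<kappa> \<mu> 0 = ennreal (GG \<kappa> \<mu> 0)" if "\<kappa> \<noteq> \<mu>" "\<kappa> > 0" "\<mu> > 0" for \<kappa> \<mu>
  proof (rule LIMSEQ_unique)
    define v :: "nat \<Rightarrow> real ^ 3" where "v n = (1 / (real n + 1)) *\<^sub>R axis 1 1" for n
    have v: "norm (v n) = 1 / (real n + 1)" "v n \<noteq> 0" for n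
      by (auto simp: v_def norm_axis_1 axis_eq_0_iff add_nonneg_eq_0_iff)
    show "(\<lambda>n. GG_heat \<kappa> \<mu> (v n)) \<longlonglongrightarrow> GG_heat \<kappa> \<mu> 0"
      by (rule GG_heat_tendsto[where m="\<lambda>_. \<mu>"])
         (use that in \<open>auto simp: v decseq_def frac_le\<close>, real_asymp)
    have "(\<lambda>n. GG \<kappa> \<mu> (norm (v n))) \<longlonglongrightarrow> GG \<kappa> \<mu> 0"
    proof -
      have d: "((\<lambda>r::real. (exp (- \<kappa> * r) - exp (- \<mu> * r)) / r) \<longlongrightarrow> - \<kappa> + \<mu>) (at_right 0)"
        by real_asymp
      have "filterlim (\<lambda>n. 1 / (real n + 1)) (at_right 0) sequentially"
        by real_asymp
      from filterlim_compose[OF d this]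
      have "(\<lambda>n. (exp (- \<kappa> * (1 / (real n + 1))) - exp (- \<mu> * (1 / (real n + 1)))) / (1 / (real n + 1)) / (4 * pi * (\<mu>\<^sup>2 - \<kappa>\<^sup>2)))
         \<longlonglongrightarrow> (- \<kappa> + \<mu>) / (4 * pi * (\<mu>\<^sup>2 - \<kappa>\<^sup>2))"
        using that by (intro tendsto_intros) (auto simp: power2_eq_iff)
      moreover have "(- \<kappa> + \<mu>) / (4 * pi * (\<mu>\<^sup>2 - \<kappa>\<^sup>2)) = GG \<kappa> \<mu> 0"
        using that by (simp add: GG_def power2_eq_square square_diff_square_factored)
      moreover have "GG \<kappa> \<mu> (norm (v n)) = (exp (- \<kappa> * (1 / (real n + 1))) - exp (- \<mu> * (1 / (real n + 1)))) / (1 / (real n + 1)) / (4 * pi * (\<mu>\<^sup>2 - \<kappa>\<^sup>2))" for n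
        using that by (simp add: GG_def v)
      ultimately show ?thesis by simp
    qed
    then show "(\<lambda>n. GG_heat \<kappa> \<mu> (v n)) \<longlonglongrightarrow> ennreal (GG \<kappa> \<mu> 0)"
      using neq[OF that(1) v(2) that(2,3)] by (simp add: tendsto_ennrealI)
  qed
  have eq: "GG_heat \<kappa> \<kappa> w = ennreal (GG \<kappa> \<kappa> (norm w))" if "\<kappa> > 0" for \<kappa>
  proof (rule LIMSEQ_unique)
    define m where "m n = \<kappa> + 1 / (real n + 1)" for n :: nat
    have m: "m n > 0" "\<kappa> \<noteq> m n" for n
      using that by (auto simp: m_def add_pos_pos add_nonneg_eq_0_iff)
    have mt: "m \<longlonglongrightarrow> \<kappa>"
      unfolding m_def by real_asymp
    show "(\<lambda>n. GG_heat \<kappa> (m n) w) \<longlonglongrightarrow> GG_heat \<kappa> \<kappa> w"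
      by (rule GG_heat_tendsto)
         (use that in \<open>auto simp: m_def decseq_def frac_le\<close>, real_asymp)
    have "(\<lambda>n. GG \<kappa> (m n) (norm w)) \<longlonglongrightarrow> GG \<kappa> \<kappa> (norm w)"
    proof (cases "w = 0")
      case True
      have "(\<lambda>n. 1 / (4 * pi * (\<kappa> + m n))) \<longlonglongrightarrow> 1 / (4 * pi * (\<kappa> + \<kappa>))"
        using that mt by (intro tendsto_intros) auto
      then show ?thesis using True m by (simp add: GG_def mult.assoc)
    next
      case False
      define r where "r = norm w"
      have r: "r > 0" using False by (simp add: r_def)
      have "(\<lambda>n. (exp (- \<kappa> * r) - exp (- (m n) * r)) / (4 * pi * r * ((m n)\<^sup>2 - \<kappa>\<^sup>2))) \<longlonglongrightarrow> exp (- \<kappa> * r) / (8 * pi * \<kappa>)"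
      proof -
        have d: "((\<lambda>h::real. (1 - exp (- h * r)) / h) \<longlongrightarrow> r) (at_right 0)"
          by real_asymp
        have "filterlim (\<lambda>n. 1 / (real n + 1)) (at_right 0) sequentially"
          by real_asymp
        from filterlim_compose[OF d this]
        have "(\<lambda>n. exp (- \<kappa> * r) * ((1 - exp (- (1 / (real n + 1)) * r)) / (1 / (real n + 1))) / (4 * pi * r * (m n + \<kappa>)))
          \<longlonglongrightarrow> exp (- \<kappa> * r) * r / (4 * pi * r * (\<kappa> + \<kappa>))"
          using that r mt by (intro tendsto_intros) auto
        moreover have "exp (- \<kappa> * r) * ((1 - exp (- (1 / (real n + 1)) * r)) / (1 / (real n + 1))) / (4 * pi * r * (m n + \<kappa>))
           = (exp (- \<kappa> * r) - exp (- (m n) * r)) / (4 * pi * r * ((m n)\<^sup>2 - \<kappa>\<^sup>2))" for n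
        proof -
          define h where "h = 1 / (real n + 1)"
          have "h > 0" by (simp add: h_def add_pos_nonneg)
          have mh: "m n = \<kappa> + h" by (simp add: m_def h_def)
          have "(m n)\<^sup>2 - \<kappa>\<^sup>2 = h * (m n + \<kappa>)"
            by (simp add: mh power2_eq_square algebra_simps)
          moreover have "exp (- (m n) * r) = exp (- \<kappa> * r) * exp (- h * r)"
            by (simp add: mh mult_exp_exp algebra_simps)
          ultimately show ?thesis
            using r \<open>h > 0\<close> unfolding h_def[symmetric] by (simp add: field_simps)
        qed
        ultimately show ?thesis using r by (simp add: mult.assoc)
      qed
      then show ?thesis using m r unfolding GG_def r_def by simp
    qed
    moreover have "GG_heat \<kappa> (m n) w = ennreal (GG \<kappa> (m n) (norm w))" for n
      using neq[of \<kappa> "m n" w] neq'[of \<kappa> "m n"] m[of n] that by (cases "w = 0") auto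
    ultimately show "(\<lambda>n. GG_heat \<kappa> (m n) w) \<longlonglongrightarrow> ennreal (GG \<kappa> \<kappa> (norm w))"
      by (simp add: tendsto_ennrealI)
  qed
  show ?thesis
    using eq neq neq' assms by (cases "\<kappa> = \<mu>"; cases "w = 0") auto
qed

lemma GG_nonneg: "0 < \<kappa> \<Longrightarrow> 0 < \<mu> \<Longrightarrow> 0 \<le> r \<Longrightarrow> 0 \<le> GG \<kappa> \<mu> r"
  by (cases \<kappa> \<mu> rule: linorder_cases)
     (auto simp: GG_def intro!: divide_nonneg_nonneg divide_nonpos_nonpos mult_nonneg_nonneg mult_nonneg_nonpos
       power_mono mult_right_mono)

lemma nn_integral_G_G:
  assumes "\<kappa> > 0" "\<mu> > 0"
  shows "(\<integral>\<^sup>+z. ennreal (G \<kappa> (x - z) * G \<mu> (z - y)) \<partial>lborel) = ennreal (GG \<kappa> \<mu> (norm (x - y)))"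
  using nn_integral_G_G_heat[OF assms, of x y] GG_heat_eq_GG[OF assms, of "x - y"]
  by (simp add: ennreal_mult)

section \<open>The free resolvent\<close>

lemma L2_measurable: "f \<in> L2 \<Longrightarrow> f \<in> borel_measurable borel"
  by (simp add: L2_def)

lemma L2_integrable: "f \<in> L2 \<Longrightarrow> integrable lborel (\<lambda>x. (norm (f x))\<^sup>2)"
  by (simp add: L2_def)

lemma L2norm_nonneg [simp]: "0 \<le> L2norm f"
  by (simp add: L2norm_def)

lemma L2norm_sq: "(L2norm f)\<^sup>2 = (LINT x|lborel. (norm (f x))\<^sup>2)"
  by (simp add: L2norm_def)

lemma L2_nn_integral:
  assumes "f \<in> L2"
  shows "(\<integral>\<^sup>+x. ennreal ((norm (f x))\<^sup>2) \<partial>lborel) = ennreal ((L2norm f)\<^sup>2)"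
  using assms by (simp add: L2norm_sq L2_def nn_integral_eq_integral)

lemma L2I_nn_integral:
  assumes [measurable]: "f \<in> borel_measurable borel"
    and le: "(\<integral>\<^sup>+x. ennreal ((norm (f x))\<^sup>2) \<partial>lborel) \<le> ennreal C" and "0 \<le> C"
  shows "f \<in> L2" "(L2norm f)\<^sup>2 \<le> C"
proof -
  have int: "integrable lborel (\<lambda>x. (norm (f x))\<^sup>2)"
    using le by (intro integrableI_bounded) (auto intro: le_less_trans)
  then show "f \<in> L2" by (simp add: L2_def)
  from L2_nn_integral[OF this] le show "(L2norm f)\<^sup>2 \<le> C" using \<open>0 \<le> C\<close> by simp
qed

lemma L2norm_cong_AE:
  assumes [measurable]: "f \<in> borel_measurable borel" "g \<in> borel_measurable borel"
    and "AE x in lborel. f x = g x"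
  shows "L2norm f = L2norm g"
  unfolding L2norm_def by (intro arg_cong[where f=sqrt] integral_cong_AE) (use assms(3) in auto)

lemma L2norm_mono:
  assumes "f \<in> L2" "g \<in> L2" "\<And>x. norm (f x) \<le> norm (g x)"
  shows "L2norm f \<le> L2norm g"
  unfolding L2norm_def using assms
  by (intro real_sqrt_le_mono integral_mono L2_integrable power_mono) auto

lemma L2_cmult:
  assumes "f \<in> L2"
  shows "(\<lambda>x. c * f x) \<in> L2" "L2norm (\<lambda>x. c * f x) = norm c * L2norm f"
  using assms by (auto simp: L2_def L2norm_def norm_mult power_mult_distrib real_sqrt_mult)

text \<open>Squared norms with the factor \<open>card I\<close> serve as the triangle inequality for
  the L2 norm throughout; the loss is harmless because only boundedness and orders of growth
  matter.\<close>

lemma norm_sum_sq_le: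
  fixes f :: "'i \<Rightarrow> 'a::real_normed_vector"
  shows "(norm (\<Sum>i\<in>I. f i))\<^sup>2 \<le> real (card I) * (\<Sum>i\<in>I. (norm (f i))\<^sup>2)"
proof -
  have "(norm (\<Sum>i\<in>I. f i))\<^sup>2 \<le> (\<Sum>i\<in>I. norm (f i))\<^sup>2"
    by (intro power_mono norm_sum) auto
  also have "\<dots> \<le> (\<Sum>i\<in>I. (norm (f i))\<^sup>2) * real (card I)"
    by (rule sum_squared_le_sum_of_squares)
  finally show ?thesis by (simp add: mult.commute)
qed

lemma L2_sum:
  assumes "\<And>i. i \<in> I \<Longrightarrow> f i \<in> L2"
  shows "(\<lambda>x. \<Sum>i\<in>I. f i x) \<in> L2"
    and "(L2norm (\<lambda>x. \<Sum>i\<in>I. f i x))\<^sup>2 \<le> real (card I) * (\<Sum>i\<in>I. (L2norm (f i))\<^sup>2)"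
proof -
  have m: "(\<lambda>x. \<Sum>i\<in>I. f i x) \<in> borel_measurable borel"
    using assms by (intro borel_measurable_sum L2_measurable)
  have "(\<integral>\<^sup>+x. ennreal ((norm (\<Sum>i\<in>I. f i x))\<^sup>2) \<partial>lborel)
      \<le> (\<integral>\<^sup>+x. ennreal (real (card I) * (\<Sum>i\<in>I. (norm (f i x))\<^sup>2)) \<partial>lborel)"
    by (intro nn_integral_mono ennreal_leI norm_sum_sq_le)
  also have "\<dots> = ennreal (real (card I) * (\<Sum>i\<in>I. (L2norm (f i))\<^sup>2))"
    using assms by (subst nn_integral_eq_integral)
      (auto simp: L2norm_sq L2_integrable intro!: integrable_sum sum_nonneg mult_nonneg_nonneg AE_I2)
  finally have le: "(\<integral>\<^sup>+x. ennreal ((norm (\<Sum>i\<in>I. f i x))\<^sup>2) \<partial>lborel) \<le> \<dots>" .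
  show "(\<lambda>x. \<Sum>i\<in>I. f i x) \<in> L2"
    "(L2norm (\<lambda>x. \<Sum>i\<in>I. f i x))\<^sup>2 \<le> real (card I) * (\<Sum>i\<in>I. (L2norm (f i))\<^sup>2)"
    using L2I_nn_integral[OF m le] by (simp_all add: sum_nonneg)
qed

lemma L2_add:
  assumes "f \<in> L2" "g \<in> L2"
  shows "(\<lambda>x. f x + g x) \<in> L2"
    and "(L2norm (\<lambda>x. f x + g x))\<^sup>2 \<le> 2 * ((L2norm f)\<^sup>2 + (L2norm g)\<^sup>2)"
  using L2_sum[of UNIV "\<lambda>b. if b then f else g"] assms by (auto simp: UNIV_bool add.commute)

lemma L2_diff:
  assumes "f \<in> L2" "g \<in> L2"
  shows "(\<lambda>x. f x - g x) \<in> L2"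
    and "(L2norm (\<lambda>x. f x - g x))\<^sup>2 \<le> 2 * ((L2norm f)\<^sup>2 + (L2norm g)\<^sup>2)"
  using L2_add[OF assms(1) L2_cmult(1)[OF assms(2), of "-1"]] L2_cmult(2)[OF assms(2), of "-1"] by auto

lemma L2norm_eq_0:
  assumes "f \<in> L2" "L2norm f = 0"
  shows "AE x in lborel. f x = 0"
  using assms integral_nonneg_eq_0_iff_AE[OF L2_integrable[OF assms(1)]] by (simp add: L2norm_def)

section \<open>Mapping properties of the free resolvent\<close>

definition green :: "real \<Rightarrow> real ^ 3 \<Rightarrow> wave" where
  "green \<kappa> p = (\<lambda>x. of_real (G \<kappa> (x - p)))"

lemma integral_G_G:
  assumes "\<kappa> > 0" "\<mu> > 0"
  shows "integrable lborel (\<lambda>z. G \<kappa> (x - z) * G \<mu> (z - y))"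
    and "(LINT z|lborel. G \<kappa> (x - z) * G \<mu> (z - y)) = GG \<kappa> \<mu> (norm (x - y))"
proof -
  have "has_bochner_integral lborel (\<lambda>z. G \<kappa> (x - z) * G \<mu> (z - y)) (GG \<kappa> \<mu> (norm (x - y)))"
    by (rule has_bochner_integral_nn_integral) (use nn_integral_G_G[OF assms] assms in \<open>auto simp: GG_nonneg\<close>)
  then show "integrable lborel (\<lambda>z. G \<kappa> (x - z) * G \<mu> (z - y))"
    and "(LINT z|lborel. G \<kappa> (x - z) * G \<mu> (z - y)) = GG \<kappa> \<mu> (norm (x - y))"
    by (auto simp: has_bochner_integral_iff)
qed

lemma green_L2:
  assumes "\<kappa> > 0"
  shows "green \<kappa> p \<in> L2"
  using integral_G_G(1)[OF assms assms, of p p]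
  by (simp add: L2_def green_def power2_eq_square G_commute[of _ p])

lemma free_resolvent_green:
  assumes "\<kappa> > 0" "\<mu> > 0"
  shows "free_resolvent \<kappa> (green \<mu> p) x = of_real (GG \<kappa> \<mu> (norm (x - p)))"
  using integral_G_G(2)[OF assms, of x p] unfolding free_resolvent_def green_def
  by (simp flip: of_real_mult)

lemma nn_integral_G_shift:
  assumes "\<kappa> > 0"
  shows "(\<integral>\<^sup>+z. ennreal (G \<kappa> (x - z)) \<partial>lborel) = ennreal (1 / \<kappa>\<^sup>2)"
  using nn_integral_lborel_reflect[of "\<lambda>z. ennreal (G \<kappa> z)" x] nn_integral_G[OF assms] by simp

text \<open>Cauchy-Schwarz; 1 / (8 pi kappa) is the squared L2 norm of the Green function, i.e.
  \<open>GG \<kappa> \<kappa> 0\<close>. The bound is uniform in x, so the free resolvent of an L2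
  function has a well-defined value at every centre.\<close>

lemma nn_integral_G_L2:
  assumes "\<kappa> > 0" "f \<in> L2"
  shows "(\<integral>\<^sup>+z. ennreal (G \<kappa> (x - z)) * ennreal (norm (f z)) \<partial>lborel)\<^sup>2 \<le> ennreal (1 / (8 * pi * \<kappa>) * (L2norm f)\<^sup>2)"
proof -
  have [measurable]: "f \<in> borel_measurable borel" using assms by (simp add: L2_measurable)
  have "(\<integral>\<^sup>+z. ennreal (G \<kappa> (x - z)) * ennreal (norm (f z)) \<partial>lborel)\<^sup>2 \<le>
    (\<integral>\<^sup>+z. (ennreal (G \<kappa> (x - z)))\<^sup>2 \<partial>lborel) * (\<integral>\<^sup>+z. (ennreal (norm (f z)))\<^sup>2 \<partial>lborel)"
    by (rule Cauchy_Schwarz_nn_integral) measurable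
  also have "(\<integral>\<^sup>+z. (ennreal (G \<kappa> (x - z)))\<^sup>2 \<partial>lborel) = ennreal (1 / (8 * pi * \<kappa>))"
    using nn_integral_G_G[OF assms(1) assms(1), of x x]
    by (simp add: power2_eq_square ennreal_mult G_commute[of _ _ x] GG_def)
  also have "(\<integral>\<^sup>+z. (ennreal (norm (f z)))\<^sup>2 \<partial>lborel) = ennreal ((L2norm f)\<^sup>2)"
    using L2_nn_integral[OF assms(2)] by (simp add: ennreal_power)
  finally show ?thesis using assms by (simp only: ennreal_mult'[symmetric] zero_le_power2 ennreal_mult''[symmetric])
qed

lemma free_resolvent_integrable:
  assumes "\<kappa> > 0" "f \<in> L2"
  shows "integrable lborel (\<lambda>z. of_real (G \<kappa> (x - z)) * f z)"
proof (rule integrableI_bounded)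
  have [measurable]: "f \<in> borel_measurable borel" using assms by (simp add: L2_measurable)
  show "(\<lambda>z. of_real (G \<kappa> (x - z)) * f z) \<in> borel_measurable lborel" by measurable
  have "(\<integral>\<^sup>+z. ennreal (G \<kappa> (x - z)) * ennreal (norm (f z)) \<partial>lborel)\<^sup>2 < \<infinity>"
    using nn_integral_G_L2[OF assms, of x] by (rule le_less_trans) simp
  then show "(\<integral>\<^sup>+z. ennreal (norm (of_real (G \<kappa> (x - z)) * f z)) \<partial>lborel) < \<infinity>"
    by (simp add: norm_mult ennreal_mult power_less_top_ennreal)
qed

lemma norm_free_resolvent_le:
  assumes "\<kappa> > 0" "f \<in> L2"
  shows "ennreal (norm (free_resolvent \<kappa> f x)) \<le> (\<integral>\<^sup>+z. ennreal (G \<kappa> (x - z)) * ennreal (norm (f z)) \<partial>lborel)"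
  using integral_norm_bound_ennreal[OF free_resolvent_integrable[OF assms, of x]]
  by (simp add: free_resolvent_def norm_mult ennreal_mult)

lemma free_resolvent_pointwise:
  assumes "\<kappa> > 0" "f \<in> L2"
  shows "(norm (free_resolvent \<kappa> f x))\<^sup>2 \<le> 1 / (8 * pi * \<kappa>) * (L2norm f)\<^sup>2"
proof -
  have "(ennreal (norm (free_resolvent \<kappa> f x)))\<^sup>2 \<le> ennreal (1 / (8 * pi * \<kappa>) * (L2norm f)\<^sup>2)"
    using power_mono[OF norm_free_resolvent_le[OF assms, of x], of 2] nn_integral_G_L2[OF assms, of x]
    by (meson order_trans zero_le)
  then show ?thesis using assms by (simp add: ennreal_power)
qed

lemma free_resolvent_measurable:
  assumes "f \<in> L2"
  shows "free_resolvent \<kappa> f \<in> borel_measurable borel"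
proof -
  have [measurable]: "f \<in> borel_measurable borel" using assms by (simp add: L2_measurable)
  show ?thesis unfolding free_resolvent_def by measurable
qed

text \<open>Young's inequality for a kernel of total mass 1 / kappa^2: the kernel is split into two
  square roots, Cauchy-Schwarz is applied pointwise, and the result is integrated over x.\<close>

lemma nn_integral_G_L2_young:
  assumes "\<kappa> > 0" "f \<in> L2"
  shows "(\<integral>\<^sup>+x. (\<integral>\<^sup>+z. ennreal (G \<kappa> (x - z)) * ennreal (norm (f z)) \<partial>lborel)\<^sup>2 \<partial>lborel) \<le> ennreal ((1 / \<kappa>\<^sup>2)\<^sup>2 * (L2norm f)\<^sup>2)"
proof -
  have [measurable]: "f \<in> borel_measurable borel" using assms by (simp add: L2_measurable)
  have "(\<integral>\<^sup>+z. ennreal (G \<kappa> (x - z)) * ennreal (norm (f z)) \<partial>lborel)\<^sup>2 \<le>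
     ennreal (1 / \<kappa>\<^sup>2) * (\<integral>\<^sup>+z. ennreal (G \<kappa> (x - z)) * ennreal ((norm (f z))\<^sup>2) \<partial>lborel)" for x
  proof -
    have "(\<integral>\<^sup>+z. ennreal (sqrt (G \<kappa> (x - z))) * ennreal (sqrt (G \<kappa> (x - z)) * norm (f z)) \<partial>lborel)\<^sup>2 \<le>
      (\<integral>\<^sup>+z. (ennreal (sqrt (G \<kappa> (x - z))))\<^sup>2 \<partial>lborel) * (\<integral>\<^sup>+z. (ennreal (sqrt (G \<kappa> (x - z)) * norm (f z)))\<^sup>2 \<partial>lborel)"
      by (rule Cauchy_Schwarz_nn_integral) measurable
    then show ?thesis
      using nn_integral_G_shift[OF assms(1), of x]
      by (simp add: ennreal_power power_mult_distrib ennreal_mult[symmetric] mult.assoc[symmetric])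
  qed
  then have "(\<integral>\<^sup>+x. (\<integral>\<^sup>+z. ennreal (G \<kappa> (x - z)) * ennreal (norm (f z)) \<partial>lborel)\<^sup>2 \<partial>lborel) \<le>
    (\<integral>\<^sup>+x. ennreal (1 / \<kappa>\<^sup>2) * (\<integral>\<^sup>+z. ennreal (G \<kappa> (x - z)) * ennreal ((norm (f z))\<^sup>2) \<partial>lborel) \<partial>lborel)"
    by (intro nn_integral_mono) auto
  also have "\<dots> = ennreal (1 / \<kappa>\<^sup>2) * (\<integral>\<^sup>+x. (\<integral>\<^sup>+z. ennreal (G \<kappa> (x - z)) * ennreal ((norm (f z))\<^sup>2) \<partial>lborel) \<partial>lborel)"
    by (rule nn_integral_cmult) measurable
  also have "(\<integral>\<^sup>+x. (\<integral>\<^sup>+z. ennreal (G \<kappa> (x - z)) * ennreal ((norm (f z))\<^sup>2) \<partial>lborel) \<partial>lborel) =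
     (\<integral>\<^sup>+z. (\<integral>\<^sup>+x. ennreal (G \<kappa> (x - z)) * ennreal ((norm (f z))\<^sup>2) \<partial>lborel) \<partial>lborel)"
    by (rule lborel_pair.Fubini') measurable
  also have "\<dots> = (\<integral>\<^sup>+z. ennreal (1 / \<kappa>\<^sup>2) * ennreal ((norm (f z))\<^sup>2) \<partial>lborel)"
    using nn_integral_G_shift[OF assms(1)]
    by (intro nn_integral_cong) (simp add: nn_integral_multc G_commute[of _ _ "_ :: real ^ 3"] nn_integral_lborel_shift[of "\<lambda>z. ennreal (G \<kappa> z)"] nn_integral_G[OF assms(1)])
  also have "\<dots> = ennreal (1 / \<kappa>\<^sup>2) * ennreal ((L2norm f)\<^sup>2)"
    by (subst nn_integral_cmult) (auto simp: L2_nn_integral[OF assms(2)])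
  finally show ?thesis
    using assms by (simp add: ennreal_mult[symmetric] power2_eq_square mult.assoc)
qed

lemma free_resolvent_L2:
  assumes "\<kappa> > 0" "f \<in> L2"
  shows "free_resolvent \<kappa> f \<in> L2" "(L2norm (free_resolvent \<kappa> f))\<^sup>2 \<le> (1 / \<kappa>\<^sup>2)\<^sup>2 * (L2norm f)\<^sup>2"
proof -
  have "(\<integral>\<^sup>+x. ennreal ((norm (free_resolvent \<kappa> f x))\<^sup>2) \<partial>lborel) \<le>
     (\<integral>\<^sup>+x. (\<integral>\<^sup>+z. ennreal (G \<kappa> (x - z)) * ennreal (norm (f z)) \<partial>lborel)\<^sup>2 \<partial>lborel)"
    using norm_free_resolvent_le[OF assms] by (intro nn_integral_mono) (simp add: ennreal_power[symmetric] power_mono)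
  also note nn_integral_G_L2_young[OF assms]
  finally show "free_resolvent \<kappa> f \<in> L2" "(L2norm (free_resolvent \<kappa> f))\<^sup>2 \<le> (1 / \<kappa>\<^sup>2)\<^sup>2 * (L2norm f)\<^sup>2"
    using L2I_nn_integral[OF free_resolvent_measurable[OF assms(2)]] by auto
qed

lemma free_resolvent_add:
  assumes "\<kappa> > 0" "f \<in> L2" "g \<in> L2"
  shows "free_resolvent \<kappa> (\<lambda>z. f z + g z) x = free_resolvent \<kappa> f x + free_resolvent \<kappa> g x"
  using free_resolvent_integrable[OF assms(1)] assms(2,3) by (simp add: free_resolvent_def distrib_left)

lemma free_resolvent_cmult:
  "free_resolvent \<kappa> (\<lambda>z. c * f z) x = c * free_resolvent \<kappa> f x"
proof (cases "c = 0")
  case False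
  have "free_resolvent \<kappa> (\<lambda>z. c * f z) x = (LINT z|lborel. c * (of_real (G \<kappa> (x - z)) * f z))"
    by (simp add: free_resolvent_def ac_simps)
  then show ?thesis by (simp add: free_resolvent_def)
qed (simp add: free_resolvent_def)

lemma free_resolvent_sum:
  assumes "\<kappa> > 0" "\<And>i. i \<in> I \<Longrightarrow> f i \<in> L2"
  shows "free_resolvent \<kappa> (\<lambda>z. \<Sum>i\<in>I. f i z) x = (\<Sum>i\<in>I. free_resolvent \<kappa> (f i) x)"
  using free_resolvent_integrable[OF assms(1)] assms(2)
  by (simp add: free_resolvent_def sum_distrib_left Bochner_Integration.integral_sum)

lemma free_resolvent_cong_AE:
  assumes "f \<in> borel_measurable borel" "g \<in> borel_measurable borel" "AE z in lborel. f z = g z"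
  shows "free_resolvent \<kappa> f x = free_resolvent \<kappa> g x"
proof -
  have [measurable]: "f \<in> borel_measurable borel" "g \<in> borel_measurable borel" by fact+
  show ?thesis unfolding free_resolvent_def
    by (intro integral_cong_AE) (use assms(3) in auto)
qed

text \<open>The resolvent identity on the level of kernels. Cleared of its denominator it also
  covers equal parameters.\<close>

lemma GG_eq_diff:
  assumes "\<kappa> > 0" "\<mu> > 0" "x \<noteq> 0"
  shows "(\<mu>\<^sup>2 - \<kappa>\<^sup>2) * GG \<kappa> \<mu> (norm x) = G \<kappa> x - G \<mu> x"
proof (cases "\<kappa> = \<mu>")
  case False
  then have "\<mu>\<^sup>2 - \<kappa>\<^sup>2 \<noteq> 0" using assms by (simp add: power2_eq_iff)
  then have e: "(\<mu>\<^sup>2 - \<kappa>\<^sup>2) * ((a - b) / (c * (\<mu>\<^sup>2 - \<kappa>\<^sup>2))) = a / c - b / c" for a b c :: real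
    by (simp add: diff_divide_distrib[symmetric])
  have "GG \<kappa> \<mu> (norm x) = (exp (- \<kappa> * norm x) - exp (- \<mu> * norm x)) / (4 * pi * norm x * (\<mu>\<^sup>2 - \<kappa>\<^sup>2))"
    using False assms by (simp add: GG_def)
  then show ?thesis by (simp only: e G_def)
qed simp

text \<open>The identity holds at every point and not only almost everywhere, because it will be
  evaluated at the centres.\<close>

lemma free_resolvent_identity:
  assumes "\<kappa> > 0" "\<mu> > 0" "f \<in> L2"
  shows "of_real (\<mu>\<^sup>2 - \<kappa>\<^sup>2) * free_resolvent \<kappa> (free_resolvent \<mu> f) x = free_resolvent \<kappa> f x - free_resolvent \<mu> f x"
proof -
  have [measurable]: "f \<in> borel_measurable borel" using assms by (simp add: L2_measurable)
  define F where "F z w = of_real (G \<kappa> (x - z)) * (of_real (G \<mu> (z - w)) * f w)" for z w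
  have Fm: "case_prod F \<in> borel_measurable (lborel \<Otimes>\<^sub>M lborel)"
    unfolding F_def by measurable
  have int: "integrable (lborel \<Otimes>\<^sub>M lborel) (case_prod F)"
  proof (rule integrableI_bounded[OF Fm])
    have "(\<integral>\<^sup>+p. ennreal (norm (case_prod F p)) \<partial>(lborel \<Otimes>\<^sub>M lborel)) = (\<integral>\<^sup>+z. (\<integral>\<^sup>+w. ennreal (norm (F z w)) \<partial>lborel) \<partial>lborel)"
      using lborel.nn_integral_fst[of "\<lambda>p. ennreal (norm (case_prod F p))" lborel] Fm by simp
    also have "\<dots> = (\<integral>\<^sup>+z. ennreal (G \<kappa> (x - z)) * (\<integral>\<^sup>+w. ennreal (G \<mu> (z - w)) * ennreal (norm (f w)) \<partial>lborel) \<partial>lborel)"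
      unfolding F_def
      by (intro nn_integral_cong, subst nn_integral_cmult[symmetric])
         (auto simp: norm_mult ennreal_mult mult.assoc intro!: nn_integral_cong)
    \<comment> \<open>The outer Green function is square integrable, and so is the inner integral by
      Young's inequality; this justifies the exchange of integrals below.\<close>
    also have "\<dots> < \<infinity>"
    proof -
      have "(\<integral>\<^sup>+z. ennreal (G \<kappa> (x - z)) * (\<integral>\<^sup>+w. ennreal (G \<mu> (z - w)) * ennreal (norm (f w)) \<partial>lborel) \<partial>lborel)\<^sup>2
        \<le> (\<integral>\<^sup>+z. (ennreal (G \<kappa> (x - z)))\<^sup>2 \<partial>lborel) * (\<integral>\<^sup>+z. (\<integral>\<^sup>+w. ennreal (G \<mu> (z - w)) * ennreal (norm (f w)) \<partial>lborel)\<^sup>2 \<partial>lborel)"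
        by (rule Cauchy_Schwarz_nn_integral) measurable
      also have "(\<integral>\<^sup>+z. (ennreal (G \<kappa> (x - z)))\<^sup>2 \<partial>lborel) = ennreal (1 / (8 * pi * \<kappa>))"
        using nn_integral_G_G[OF assms(1) assms(1), of x x]
        by (simp add: power2_eq_square ennreal_mult G_commute[of _ _ x] GG_def)
      also have "ennreal (1 / (8 * pi * \<kappa>)) * (\<integral>\<^sup>+z. (\<integral>\<^sup>+w. ennreal (G \<mu> (z - w)) * ennreal (norm (f w)) \<partial>lborel)\<^sup>2 \<partial>lborel) < \<infinity>"
        using nn_integral_G_L2_young[OF assms(2,3)]
        by (auto simp: ennreal_mult_less_top intro: le_less_trans)
      finally show ?thesis by (simp add: power_less_top_ennreal)
    qed
    finally show "(\<integral>\<^sup>+p. ennreal (norm (case_prod F p)) \<partial>(lborel \<Otimes>\<^sub>M lborel)) < \<infinity>" .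
  qed
  have "free_resolvent \<kappa> (free_resolvent \<mu> f) x = (LINT z|lborel. (LINT w|lborel. F z w))"
    by (simp add: free_resolvent_def F_def)
  also have "\<dots> = (LINT w|lborel. (LINT z|lborel. F z w))"
    by (rule lborel_pair.Fubini_integral[symmetric]) (use int in simp)
  also have "\<dots> = (LINT w|lborel. of_real (GG \<kappa> \<mu> (norm (x - w))) * f w)"
  proof (rule Bochner_Integration.integral_cong)
    fix w
    have "(LINT z|lborel. F z w) = (LINT z|lborel. of_real (G \<kappa> (x - z) * G \<mu> (z - w)) * f w)"
      by (simp add: F_def mult.assoc)
    also have "\<dots> = (LINT z|lborel. complex_of_real (G \<kappa> (x - z) * G \<mu> (z - w))) * f w"
      by (rule integral_mult_left_zero)
    also have "\<dots> = of_real (GG \<kappa> \<mu> (norm (x - w))) * f w"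
      unfolding integral_complex_of_real integral_G_G(2)[OF assms(1,2), of x w] ..
    finally show "(LINT z|lborel. F z w) = of_real (GG \<kappa> \<mu> (norm (x - w))) * f w" .
  qed simp
  finally have "of_real (\<mu>\<^sup>2 - \<kappa>\<^sup>2) * free_resolvent \<kappa> (free_resolvent \<mu> f) x =
     (LINT w|lborel. of_real ((\<mu>\<^sup>2 - \<kappa>\<^sup>2) * GG \<kappa> \<mu> (norm (x - w))) * f w)"
    by (simp only: of_real_mult mult.assoc integral_mult_right_zero)
  also have "\<dots> = (LINT w|lborel. of_real (G \<kappa> (x - w)) * f w - of_real (G \<mu> (x - w)) * f w)"
  proof (rule integral_cong_AE)
    show "AE w in lborel. of_real ((\<mu>\<^sup>2 - \<kappa>\<^sup>2) * GG \<kappa> \<mu> (norm (x - w))) * f w = of_real (G \<kappa> (x - w)) * f w - of_real (G \<mu> (x - w)) * f w"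
      by (rule eventually_mono[OF AE_lborel_singleton[of x]])
         (metis GG_eq_diff[OF assms(1,2)] right_minus_eq of_real_diff left_diff_distrib)
  qed (auto simp: GG_def)
  also have "\<dots> = free_resolvent \<kappa> f x - free_resolvent \<mu> f x"
    using free_resolvent_integrable[OF _ assms(3)] assms by (simp add: free_resolvent_def)
  finally show ?thesis .
qed

section \<open>The Hamiltonian and its resolvent\<close>

definition krein_coeff ::
    "real \<Rightarrow> ('n::finite \<Rightarrow> real ^ 3) \<Rightarrow> real \<Rightarrow> wave \<Rightarrow> 'n \<Rightarrow> complex" where
  "krein_coeff \<alpha> y \<kappa> f i = (\<Sum>j\<in>UNIV. of_real (matrix_inv (\<Gamma> \<alpha> y \<kappa>) $ i $ j) * free_resolvent \<kappa> f (y j))"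

lemma krein_resolvent_eq:
  "krein_resolvent \<alpha> y \<kappa> f x = free_resolvent \<kappa> f x + (\<Sum>i\<in>UNIV. krein_coeff \<alpha> y \<kappa> f i * green \<kappa> (y i) x)"
  unfolding krein_resolvent_def krein_coeff_def green_def
  by (simp add: free_resolvent_def G_commute[of _ _ "y _"] sum_distrib_right)

text \<open>The convolution of Green functions is finite at distance 0, where it produces the
  difference of the diagonal entries. So increments of the matrix are values at the centres of the
  free resolvent applied to Green functions.\<close>

lemma \<Gamma>_diff:
  assumes "inj y" "\<kappa> > 0" "\<mu> > 0"
  shows "\<Gamma> \<alpha> y \<mu> $ i $ j - \<Gamma> \<alpha> y \<kappa> $ i $ j = (\<mu>\<^sup>2 - \<kappa>\<^sup>2) * GG \<mu> \<kappa> (norm (y i - y j))"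
proof (cases "i = j")
  case True
  have "(\<mu>\<^sup>2 - \<kappa>\<^sup>2) / (4 * pi * (\<mu> + \<kappa>)) = (\<mu> - \<kappa>) / (4 * pi)"
    using assms by (simp add: power2_eq_square square_diff_square_factored)
  then show ?thesis using True by (simp add: \<Gamma>_def GG_def diff_divide_distrib)
next
  case False
  then have "y i - y j \<noteq> 0" using assms(1) by (auto dest: injD)
  from GG_eq_diff[OF assms(3,2) this] False show ?thesis
    by (simp add: \<Gamma>_def left_diff_distrib)
qed

lemma matrix_inv_sum:
  fixes A :: "real ^ 'n ^ 'n::finite"
  assumes "det A \<noteq> 0"
  shows "(\<Sum>j\<in>UNIV. matrix_inv A $ i $ j * A $ j $ k) = (if i = k then 1 else 0)"
    and "(\<Sum>j\<in>UNIV. A $ i $ j * matrix_inv A $ j $ k) = (if i = k then 1 else 0)"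
proof -
  have "invertible A" using assms by (simp add: invertible_det_nz)
  then have "matrix_inv A ** A = mat 1" "A ** matrix_inv A = mat 1"
    using someI_ex[of "\<lambda>A'. A ** A' = mat 1 \<and> A' ** A = mat 1"] by (auto simp: invertible_def matrix_inv_def)
  then have "(matrix_inv A ** A) $ i $ k = mat 1 $ i $ k" "(A ** matrix_inv A) $ i $ k = mat 1 $ i $ k"
    by simp_all
  then show "(\<Sum>j\<in>UNIV. matrix_inv A $ i $ j * A $ j $ k) = (if i = k then 1 else 0)"
    and "(\<Sum>j\<in>UNIV. A $ i $ j * matrix_inv A $ j $ k) = (if i = k then 1 else 0)"
    by (simp_all add: matrix_matrix_mult_def mat_def)
qed

lemma matrix_inv_solve:
  fixes A :: "real ^ 'n ^ 'n::finite" and c v :: "'n \<Rightarrow> complex"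
  assumes "det A \<noteq> 0" and v: "\<And>j. v j = (\<Sum>k\<in>UNIV. of_real (A $ j $ k) * c k)"
  shows "(\<Sum>j\<in>UNIV. of_real (matrix_inv A $ i $ j) * v j) = c i"
proof -
  have "(\<Sum>j\<in>UNIV. of_real (matrix_inv A $ i $ j) * v j) =
    (\<Sum>j\<in>UNIV. \<Sum>k\<in>UNIV. of_real (matrix_inv A $ i $ j * A $ j $ k) * c k)"
    by (simp add: v sum_distrib_left mult.assoc)
  also have "\<dots> = (\<Sum>k\<in>UNIV. of_real (\<Sum>j\<in>UNIV. matrix_inv A $ i $ j * A $ j $ k) * c k)"
    by (subst sum.swap) (simp add: sum_distrib_right)
  also have "\<dots> = (\<Sum>k\<in>UNIV. if i = k then c k else 0)"
    unfolding matrix_inv_sum(1)[OF assms(1)] by (intro sum.cong) auto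
  finally show ?thesis by simp
qed

lemma AE_not_in_range:
  fixes y :: "'n::finite \<Rightarrow> real ^ 3"
  shows "AE x in lborel. x \<notin> range y"
  by (rule AE_not_in, rule finite_imp_null_set_lborel) simp

text \<open>The equation for \<open>c\<close> is the boundary condition at the centres. Stated with
  a solution \<open>c\<close> instead of the inverse matrix, the lemma applies also where the
  determinant vanishes at \<open>\<kappa>\<close>, and so yields eigenfunctions as well as the Krein
  resolvent.\<close>

lemma hamiltonian_memI:
  fixes y :: "'n::finite \<Rightarrow> real ^ 3"
  assumes y: "inj y" and k: "\<kappa> > 0" and f: "f \<in> L2"
    and c: "\<And>i. (\<Sum>j\<in>UNIV. of_real (\<Gamma> \<alpha> y \<kappa> $ i $ j) * c j) = free_resolvent \<kappa> f (y i)"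
    and u: "u = (\<lambda>x. free_resolvent \<kappa> f x + (\<Sum>i\<in>UNIV. c i * green \<kappa> (y i) x))"
  shows "u \<in> L2" "(u, \<lambda>x. f x - of_real (\<kappa>\<^sup>2) * u x) \<in> hamiltonian \<alpha> y"
proof -
  have gL: "(\<lambda>x. \<Sum>i\<in>UNIV. c i * green \<kappa> (y i) x) \<in> L2"
    by (intro L2_sum L2_cmult green_L2 k)
  show uL: "u \<in> L2"
    unfolding u by (intro L2_add free_resolvent_L2 k f gL)
  have "AE x in lborel. u x = krein_resolvent \<alpha> y \<mu> (\<lambda>z. f z - of_real (\<kappa>\<^sup>2) * u z + of_real (\<mu>\<^sup>2) * u z) x"
    if m: "\<mu> > 0" and d: "det (\<Gamma> \<alpha> y \<mu>) \<noteq> 0" for \<mu>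
  proof -
    define \<delta> where "\<delta> = \<mu>\<^sup>2 - \<kappa>\<^sup>2"
    define F where "F = (\<lambda>z. f z - of_real (\<kappa>\<^sup>2) * u z + of_real (\<mu>\<^sup>2) * u z)"
    have F: "F = (\<lambda>z. f z + of_real \<delta> * u z)"
      by (auto simp: F_def \<delta>_def algebra_simps)
    \<comment> \<open>The resolvent identity removes the product of the two free resolvents, and the
      free part at \<open>\<mu>\<close> turns into the free part at \<open>\<kappa>\<close>.\<close>
    have RF: "free_resolvent \<mu> F x = free_resolvent \<kappa> f x + (\<Sum>i\<in>UNIV. c i * of_real (\<delta> * GG \<mu> \<kappa> (norm (x - y i))))" for x
    proof -
      have "free_resolvent \<mu> F x = free_resolvent \<mu> f x + of_real \<delta> * free_resolvent \<mu> u x"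
        unfolding F by (simp add: free_resolvent_add[OF m f L2_cmult(1)[OF uL]] free_resolvent_cmult)
      also have "free_resolvent \<mu> u x = free_resolvent \<mu> (free_resolvent \<kappa> f) x + (\<Sum>i\<in>UNIV. c i * of_real (GG \<mu> \<kappa> (norm (x - y i))))"
        unfolding u using free_resolvent_add[OF m free_resolvent_L2(1)[OF k f] gL, of x]
        by (simp add: free_resolvent_sum[OF m L2_cmult(1)[OF green_L2[OF k]]] free_resolvent_cmult free_resolvent_green[OF m k])
      also have "free_resolvent \<mu> f x + of_real \<delta> * (free_resolvent \<mu> (free_resolvent \<kappa> f) x + (\<Sum>i\<in>UNIV. c i * of_real (GG \<mu> \<kappa> (norm (x - y i))))) =
        free_resolvent \<mu> f x - (of_real (\<kappa>\<^sup>2 - \<mu>\<^sup>2) * free_resolvent \<mu> (free_resolvent \<kappa> f) x) + (\<Sum>i\<in>UNIV. c i * of_real (\<delta> * GG \<mu> \<kappa> (norm (x - y i))))"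
        by (simp add: \<delta>_def sum_distrib_left algebra_simps)
      finally show ?thesis unfolding free_resolvent_identity[OF m k f] by simp
    qed
    \<comment> \<open>The coefficients do not depend on the parameter: passing from kappa to mu
      changes the values at the centres by just the increment of the matrix applied to
      \<open>c\<close>.\<close>
    have "krein_coeff \<alpha> y \<mu> F i = c i" for i
      unfolding krein_coeff_def
    proof (rule matrix_inv_solve[OF d])
      fix j
      have "free_resolvent \<mu> F (y j) = (\<Sum>k\<in>UNIV. of_real (\<Gamma> \<alpha> y \<kappa> $ j $ k) * c k) + (\<Sum>k\<in>UNIV. c k * of_real (\<Gamma> \<alpha> y \<mu> $ j $ k - \<Gamma> \<alpha> y \<kappa> $ j $ k))"
        unfolding RF \<delta>_def \<Gamma>_diff[OF y k m] c ..
      also have "\<dots> = (\<Sum>k\<in>UNIV. of_real (\<Gamma> \<alpha> y \<mu> $ j $ k) * c k)"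
        unfolding sum.distrib[symmetric] by (intro sum.cong) (auto simp: algebra_simps)
      finally show "free_resolvent \<mu> F (y j) = (\<Sum>k\<in>UNIV. of_real (\<Gamma> \<alpha> y \<mu> $ j $ k) * c k)" .
    qed
    then have K: "krein_resolvent \<alpha> y \<mu> F x = free_resolvent \<mu> F x + (\<Sum>i\<in>UNIV. c i * green \<mu> (y i) x)" for x
      by (simp add: krein_resolvent_eq)
    have "u x = krein_resolvent \<alpha> y \<mu> F x" if x: "x \<notin> range y" for x
    proof -
      have "x - y i \<noteq> 0" for i using x by auto
      then have e: "of_real (\<delta> * GG \<mu> \<kappa> (norm (x - y i))) = green \<kappa> (y i) x - green \<mu> (y i) x" for i
        using GG_eq_diff[OF m k, of "x - y i"] unfolding green_def \<delta>_def of_real_diff[symmetric] of_real_eq_iff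
        by (simp add: left_diff_distrib)
      show ?thesis
        unfolding K RF e u by (simp add: right_diff_distrib sum_subtractf)
    qed
    then show ?thesis unfolding F_def[symmetric]
      by (intro eventually_mono[OF AE_not_in_range[of y]]) auto
  qed
  then show "(u, \<lambda>x. f x - of_real (\<kappa>\<^sup>2) * u x) \<in> hamiltonian \<alpha> y"
    using uL f by (auto simp: hamiltonian_def intro!: L2_diff L2_cmult)
qed

lemma krein_resolvent_mem:
  fixes y :: "'n::finite \<Rightarrow> real ^ 3"
  assumes y: "inj y" and k: "\<kappa> > 0" and d: "det (\<Gamma> \<alpha> y \<kappa>) \<noteq> 0" and f: "f \<in> L2"
  shows "krein_resolvent \<alpha> y \<kappa> f \<in> L2"
    and "(krein_resolvent \<alpha> y \<kappa> f, \<lambda>x. f x - of_real (\<kappa>\<^sup>2) * krein_resolvent \<alpha> y \<kappa> f x) \<in> hamiltonian \<alpha> y"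
proof -
  have "(\<Sum>j\<in>UNIV. of_real (\<Gamma> \<alpha> y \<kappa> $ i $ j) * krein_coeff \<alpha> y \<kappa> f j) = free_resolvent \<kappa> f (y i)" for i
  proof -
    have "(\<Sum>j\<in>UNIV. of_real (\<Gamma> \<alpha> y \<kappa> $ i $ j) * krein_coeff \<alpha> y \<kappa> f j) =
      (\<Sum>j\<in>UNIV. \<Sum>k\<in>UNIV. of_real (\<Gamma> \<alpha> y \<kappa> $ i $ j * matrix_inv (\<Gamma> \<alpha> y \<kappa>) $ j $ k) * free_resolvent \<kappa> f (y k))"
      by (simp add: krein_coeff_def sum_distrib_left mult.assoc)
    also have "\<dots> = (\<Sum>k\<in>UNIV. of_real (\<Sum>j\<in>UNIV. \<Gamma> \<alpha> y \<kappa> $ i $ j * matrix_inv (\<Gamma> \<alpha> y \<kappa>) $ j $ k) * free_resolvent \<kappa> f (y k))"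
      by (subst sum.swap) (simp add: sum_distrib_right)
    also have "\<dots> = (\<Sum>k\<in>UNIV. if i = k then free_resolvent \<kappa> f (y k) else 0)"
      unfolding matrix_inv_sum(2)[OF d] by (intro sum.cong) auto
    finally show ?thesis by simp
  qed
  from hamiltonian_memI[OF y k f this, of "krein_resolvent \<alpha> y \<kappa> f"]
  show "krein_resolvent \<alpha> y \<kappa> f \<in> L2"
    and "(krein_resolvent \<alpha> y \<kappa> f, \<lambda>x. f x - of_real (\<kappa>\<^sup>2) * krein_resolvent \<alpha> y \<kappa> f x) \<in> hamiltonian \<alpha> y"
    by (auto simp: krein_resolvent_eq[abs_def])
qed

section \<open>Norm bounds for the finite-rank part\<close>

lemma norm_krein_coeff_sq_le:
  fixes y :: "'n::finite \<Rightarrow> real ^ 3"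
  assumes "\<kappa> > 0" "f \<in> L2" and B: "\<And>j. (norm (free_resolvent \<kappa> f (y j)))\<^sup>2 \<le> B"
  shows "(norm (krein_coeff \<alpha> y \<kappa> f i))\<^sup>2 \<le>
     real CARD('n) * (\<Sum>j\<in>UNIV. (matrix_inv (\<Gamma> \<alpha> y \<kappa>) $ i $ j)\<^sup>2) * B"
proof -
  have "(norm (krein_coeff \<alpha> y \<kappa> f i))\<^sup>2 \<le> real CARD('n) * (\<Sum>j\<in>UNIV. (matrix_inv (\<Gamma> \<alpha> y \<kappa>) $ i $ j)\<^sup>2 * (norm (free_resolvent \<kappa> f (y j)))\<^sup>2)"
    using norm_sum_sq_le[of "\<lambda>j. of_real (matrix_inv (\<Gamma> \<alpha> y \<kappa>) $ i $ j) * free_resolvent \<kappa> f (y j)" UNIV]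
    by (simp add: krein_coeff_def norm_mult power_mult_distrib)
  also have "\<dots> \<le> real CARD('n) * (\<Sum>j\<in>UNIV. (matrix_inv (\<Gamma> \<alpha> y \<kappa>) $ i $ j)\<^sup>2 * B)"
    by (intro mult_left_mono sum_mono B) auto
  finally show ?thesis by (simp add: sum_distrib_right mult.assoc)
qed

definition coupling_bound :: "real \<Rightarrow> ('n::finite \<Rightarrow> real ^ 3) \<Rightarrow> real \<Rightarrow> real" where
  "coupling_bound \<alpha> y \<kappa> = real CARD('n) * (\<Sum>i\<in>UNIV. real CARD('n) * (\<Sum>j\<in>UNIV. (matrix_inv (\<Gamma> \<alpha> y \<kappa>) $ i $ j)\<^sup>2) * (L2norm (green \<kappa> (y i)))\<^sup>2)"

lemma coupling_bound_nonneg: "0 \<le> coupling_bound \<alpha> y \<kappa>"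
  unfolding coupling_bound_def by (intro mult_nonneg_nonneg sum_nonneg) auto

text \<open>The bound is in terms of the values at the centres, not of the norm of \<open>f\<close>.
  For the packets below those values stay bounded while the norm grows without limit.\<close>

lemma krein_resolvent_perturbation:
  fixes y :: "'n::finite \<Rightarrow> real ^ 3"
  assumes k: "\<kappa> > 0" and f: "f \<in> L2" and B: "\<And>j. (norm (free_resolvent \<kappa> f (y j)))\<^sup>2 \<le> B"
  shows "(\<lambda>x. krein_resolvent \<alpha> y \<kappa> f x - free_resolvent \<kappa> f x) \<in> L2"
    and "(L2norm (\<lambda>x. krein_resolvent \<alpha> y \<kappa> f x - free_resolvent \<kappa> f x))\<^sup>2 \<le> coupling_bound \<alpha> y \<kappa> * B"
proof -
  have e: "(\<lambda>x. krein_resolvent \<alpha> y \<kappa> f x - free_resolvent \<kappa> f x) = (\<lambda>x. \<Sum>i\<in>UNIV. krein_coeff \<alpha> y \<kappa> f i * green \<kappa> (y i) x)"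
    by (simp add: krein_resolvent_eq)
  show "(\<lambda>x. krein_resolvent \<alpha> y \<kappa> f x - free_resolvent \<kappa> f x) \<in> L2"
    unfolding e by (intro L2_sum L2_cmult green_L2 k)
  have "(L2norm (\<lambda>x. \<Sum>i\<in>UNIV. krein_coeff \<alpha> y \<kappa> f i * green \<kappa> (y i) x))\<^sup>2 \<le>
    real CARD('n) * (\<Sum>i\<in>UNIV. (norm (krein_coeff \<alpha> y \<kappa> f i))\<^sup>2 * (L2norm (green \<kappa> (y i)))\<^sup>2)"
    using L2_sum(2)[of UNIV "\<lambda>i x. krein_coeff \<alpha> y \<kappa> f i * green \<kappa> (y i) x"]
    by (simp add: L2_cmult green_L2[OF k] power_mult_distrib)
  also have "\<dots> \<le> real CARD('n) * (\<Sum>i\<in>UNIV. (real CARD('n) * (\<Sum>j\<in>UNIV. (matrix_inv (\<Gamma> \<alpha> y \<kappa>) $ i $ j)\<^sup>2) * B) * (L2norm (green \<kappa> (y i)))\<^sup>2)"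
    by (intro mult_left_mono sum_mono mult_right_mono norm_krein_coeff_sq_le k f B) auto
  also have "\<dots> = coupling_bound \<alpha> y \<kappa> * B"
    by (simp add: coupling_bound_def sum_distrib_left sum_distrib_right ac_simps)
  finally show "(L2norm (\<lambda>x. krein_resolvent \<alpha> y \<kappa> f x - free_resolvent \<kappa> f x))\<^sup>2 \<le> coupling_bound \<alpha> y \<kappa> * B"
    unfolding e .
qed

lemma L2norm_krein_resolvent_le:
  fixes y :: "'n::finite \<Rightarrow> real ^ 3"
  assumes k: "\<kappa> > 0"
  obtains C where "\<And>f. f \<in> L2 \<Longrightarrow> L2norm (krein_resolvent \<alpha> y \<kappa> f) \<le> C * L2norm f"
proof -
  define C where "C = 2 * (coupling_bound \<alpha> y \<kappa> * (1 / (8 * pi * \<kappa>)) + (1 / \<kappa>\<^sup>2)\<^sup>2)"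
  have C: "C \<ge> 0" using k coupling_bound_nonneg[of \<alpha> y \<kappa>] by (simp add: C_def)
  have "L2norm (krein_resolvent \<alpha> y \<kappa> f) \<le> sqrt C * L2norm f" if f: "f \<in> L2" for f
  proof -
    note p = krein_resolvent_perturbation[OF k f free_resolvent_pointwise[OF k f]]
    have "(L2norm (krein_resolvent \<alpha> y \<kappa> f))\<^sup>2 \<le> 2 * ((L2norm (\<lambda>x. krein_resolvent \<alpha> y \<kappa> f x - free_resolvent \<kappa> f x))\<^sup>2 + (L2norm (free_resolvent \<kappa> f))\<^sup>2)"
      using L2_add(2)[OF p(1) free_resolvent_L2(1)[OF k f]] by simp
    also have "\<dots> \<le> 2 * (coupling_bound \<alpha> y \<kappa> * (1 / (8 * pi * \<kappa>) * (L2norm f)\<^sup>2) + (1 / \<kappa>\<^sup>2)\<^sup>2 * (L2norm f)\<^sup>2)"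
      using p(2) free_resolvent_L2(2)[OF k f] by (intro mult_left_mono add_mono) auto
    also have "\<dots> = (sqrt C * L2norm f)\<^sup>2"
      using C by (simp add: power_mult_distrib) (simp add: C_def algebra_simps)
    finally show ?thesis by (rule power2_le_imp_le) (use C in auto)
  qed
  then show ?thesis by (rule that)
qed

lemma hamiltonianD:
  assumes "(u, g) \<in> hamiltonian \<alpha> y" "\<kappa> > 0" "det (\<Gamma> \<alpha> y \<kappa>) \<noteq> 0"
  shows "u \<in> L2" "g \<in> L2" "AE x in lborel. u x = krein_resolvent \<alpha> y \<kappa> (\<lambda>z. g z + of_real (\<kappa>\<^sup>2) * u z) x"
  using assms by (auto simp: hamiltonian_def)

lemma resolvent_set_if_det_nonzero:
  fixes y :: "'n::finite \<Rightarrow> real ^ 3"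
  assumes y: "inj y" and k: "\<kappa> > 0" and d: "det (\<Gamma> \<alpha> y \<kappa>) \<noteq> 0"
  shows "- \<kappa>\<^sup>2 \<in> resolvent_set (hamiltonian \<alpha> y)"
proof -
  obtain C where C: "\<And>f. f \<in> L2 \<Longrightarrow> L2norm (krein_resolvent \<alpha> y \<kappa> f) \<le> C * L2norm f"
    using L2norm_krein_resolvent_le[OF k] by blast
  have "L2norm u \<le> C * L2norm (\<lambda>x. g x - of_real (- \<kappa>\<^sup>2) * u x)" if "(u, g) \<in> hamiltonian \<alpha> y" for u g
  proof -
    note ug = hamiltonianD[OF that k d]
    define F where "F = (\<lambda>z. g z + of_real (\<kappa>\<^sup>2) * u z)"
    have F: "F \<in> L2" unfolding F_def by (intro L2_add L2_cmult ug)
    have "L2norm u = L2norm (krein_resolvent \<alpha> y \<kappa> F)"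
      by (intro L2norm_cong_AE L2_measurable ug krein_resolvent_mem[OF y k d] F) (use ug(3) in \<open>simp add: F_def\<close>)
    also have "\<dots> \<le> C * L2norm F" by (rule C[OF F])
    finally show ?thesis by (simp add: F_def)
  qed
  moreover have "\<exists>u. (u, \<lambda>x. f x + of_real (- \<kappa>\<^sup>2) * u x) \<in> hamiltonian \<alpha> y" if "f \<in> L2" for f
    using krein_resolvent_mem(2)[OF y k d that] by auto
  ultimately show ?thesis unfolding resolvent_set_def by blast
qed

section \<open>Negative eigenvalues and their multiplicity\<close>

text \<open>For an eigenfunction the argument of the Krein resolvent is zero, so an invertible
  matrix would make the eigenfunction vanish.\<close>

lemma eigenvalue_imp_det_zero:
  assumes "is_eigenvalue (hamiltonian \<alpha> y) (- \<kappa>\<^sup>2)" "\<kappa> > 0"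
  shows "det (\<Gamma> \<alpha> y \<kappa>) = 0"
proof (rule ccontr)
  assume d: "det (\<Gamma> \<alpha> y \<kappa>) \<noteq> 0"
  obtain u where u: "(u, \<lambda>x. of_real (- \<kappa>\<^sup>2) * u x) \<in> hamiltonian \<alpha> y" "\<not> (AE x in lborel. u x = 0)"
    using assms(1) by (auto simp: is_eigenvalue_def eigenspace_def)
  have "krein_resolvent \<alpha> y \<kappa> (\<lambda>_. 0) = (\<lambda>_. 0)"
    by (simp add: krein_resolvent_def free_resolvent_def)
  with hamiltonianD(3)[OF u(1) assms(2) d] u(2) show False by simp
qed

text \<open>A nonempty open set is not negligible, so a set of full measure meets every punctured
  neighbourhood.\<close>

lemma AE_frequently_at:
  fixes a :: "'a::euclidean_space"
  assumes "AE x in lborel. P x"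
  shows "\<exists>\<^sub>F x in at a. P x"
proof (rule ccontr)
  assume "\<not> ?thesis"
  then have "\<forall>\<^sub>F x in at a. \<not> P x"
    by (simp add: frequently_def)
  then obtain S where S: "open S" "a \<in> S" "\<And>x. x \<in> S \<Longrightarrow> x \<noteq> a \<Longrightarrow> \<not> P x"
    unfolding eventually_at_topological by auto
  obtain N where N: "\<And>x. x \<notin> N \<Longrightarrow> P x" "N \<in> null_sets lborel"
    using AE_E3[OF assms] by auto
  have "negligible N"
    using N(2) by (simp add: negligible_iff_null_sets null_sets_completionI)
  then have "negligible (insert a N)" by simp
  moreover have "S \<subseteq> insert a N" using S N(1) by blast
  ultimately have "negligible S" by (rule negligible_subset)
  then show False using open_not_negligible[OF S(1)] S(2) by auto
qed

text \<open>
  Multiplying by the distance to \<open>y j\<close> and letting \<open>x\<close> tend to \<open>y j\<close> isolates the coefficient of the singularity there.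
\<close>

lemma green_independent:
  fixes y :: "'n::finite \<Rightarrow> real ^ 3" and c :: "'n \<Rightarrow> complex"
  assumes y: "inj y" and AE: "AE x in lborel. (\<Sum>i\<in>UNIV. c i * green \<kappa> (y i) x) = 0"
  shows "c j = 0"
proof (rule ccontr)
  assume cj: "c j \<noteq> 0"
  define h where "h x = (\<Sum>i\<in>UNIV. c i * (of_real (norm (x - y j)) * green \<kappa> (y i) x))" for x
  have lim: "((\<lambda>x. of_real (norm (x - y j)) * green \<kappa> (y i) x) \<longlongrightarrow> (if i = j then of_real (1 / (4 * pi)) else 0)) (at (y j))" for i
  proof (cases "i = j")
    case True
    have "((\<lambda>x. complex_of_real (exp (- \<kappa> * norm (x - y j)) / (4 * pi))) \<longlongrightarrow> of_real (exp (- \<kappa> * norm (y j - y j)) / (4 * pi))) (at (y j))"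
      by (intro tendsto_intros) auto
    then have "((\<lambda>x. complex_of_real (exp (- \<kappa> * norm (x - y j)) / (4 * pi))) \<longlongrightarrow> of_real (1 / (4 * pi))) (at (y j))"
      by simp
    moreover have "\<forall>\<^sub>F x in at (y j). complex_of_real (exp (- \<kappa> * norm (x - y j)) / (4 * pi)) = of_real (norm (x - y j)) * green \<kappa> (y j) x"
      unfolding eventually_at_filter by (rule always_eventually) (simp add: green_def G_def)
    ultimately show ?thesis using True by (auto elim: Lim_transform_eventually)
  next
    case False
    then have "norm (y j - y i) \<noteq> 0" using y by (auto dest: injD)
    then have "((\<lambda>x. of_real (norm (x - y j)) * green \<kappa> (y i) x) \<longlongrightarrow> of_real (norm (y j - y j)) * of_real (exp (- \<kappa> * norm (y j - y i)) / (4 * pi * norm (y j - y i)))) (at (y j))"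
      unfolding green_def G_def by (intro tendsto_intros) auto
    then show ?thesis using False by simp
  qed
  have "(h \<longlongrightarrow> (\<Sum>i\<in>UNIV. c i * (if i = j then of_real (1 / (4 * pi)) else 0))) (at (y j))"
    unfolding h_def by (intro tendsto_intros lim)
  also have "(\<Sum>i\<in>UNIV. c i * (if i = j then of_real (1 / (4 * pi)) else 0)) = c j * of_real (1 / (4 * pi))"
    by (simp add: if_distrib cong: if_cong)
  finally have "\<forall>\<^sub>F x in at (y j). h x \<noteq> 0"
    by (rule tendsto_imp_eventually_ne) (use cj in simp)
  moreover have "\<exists>\<^sub>F x in at (y j). (\<Sum>i\<in>UNIV. c i * green \<kappa> (y i) x) = 0"
    by (rule AE_frequently_at[OF AE])
  moreover have "h x = of_real (norm (x - y j)) * (\<Sum>i\<in>UNIV. c i * green \<kappa> (y i) x)" for x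
    by (simp add: h_def sum_distrib_left ac_simps)
  ultimately show False
    unfolding frequently_def by (metis (mono_tags, lifting) eventually_mono mult_zero_right)
qed

lemma det_eq_0_iff:
  fixes A :: "real ^ 'n ^ 'n::finite"
  shows "det A = 0 \<longleftrightarrow> (\<exists>c. c \<noteq> 0 \<and> A *v c = 0)"
  using invertible_det_nz[of A] by (auto simp: invertible_left_inverse matrix_left_invertible_ker)

lemma eigenvalue_if_det_zero:
  fixes y :: "'n::finite \<Rightarrow> real ^ 3"
  assumes y: "inj y" and k: "\<kappa> > 0" and d: "det (\<Gamma> \<alpha> y \<kappa>) = 0"
  shows "is_eigenvalue (hamiltonian \<alpha> y) (- \<kappa>\<^sup>2)"
proof -
  obtain c where c: "c \<noteq> 0" "\<Gamma> \<alpha> y \<kappa> *v c = 0" using d by (auto simp: det_eq_0_iff)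
  have L0: "(\<lambda>_. 0) \<in> L2" by (simp add: L2_def)
  have R0: "free_resolvent \<kappa> (\<lambda>_. 0) x = 0" for x by (simp add: free_resolvent_def)
  \<comment> \<open>The eigenfunction has no regular part: it is the combination of Green functions
    given by a kernel vector.\<close>
  define u where "u = (\<lambda>x. \<Sum>i\<in>UNIV. of_real (c $ i) * green \<kappa> (y i) x)"
  have "(\<Sum>j\<in>UNIV. of_real (\<Gamma> \<alpha> y \<kappa> $ i $ j) * of_real (c $ j)) = complex_of_real ((\<Gamma> \<alpha> y \<kappa> *v c) $ i)" for i
    by (simp add: matrix_vector_mult_def)
  then have "(u, \<lambda>x. 0 - of_real (\<kappa>\<^sup>2) * u x) \<in> hamiltonian \<alpha> y"
    using c(2) by (intro hamiltonian_memI[OF y k L0, where c = "\<lambda>i. of_real (c $ i)"]) (auto simp: R0 u_def)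
  then have "u \<in> eigenspace (hamiltonian \<alpha> y) (- \<kappa>\<^sup>2)"
    by (simp add: eigenspace_def)
  moreover have "\<not> (AE x in lborel. u x = 0)"
    using green_independent[OF y, of "\<lambda>i. of_real (c $ i)" \<kappa>] c(1) by (auto simp: u_def vec_eq_iff)
  ultimately show ?thesis by (auto simp: is_eigenvalue_def)
qed

lemma eigenvalue_in_spectrum:
  assumes "is_eigenvalue (hamiltonian \<alpha> y) l"
  shows "l \<in> spectrum (hamiltonian \<alpha> y)"
proof (rule ccontr)
  assume "l \<notin> spectrum (hamiltonian \<alpha> y)"
  then obtain C where C: "\<And>u g. (u, g) \<in> hamiltonian \<alpha> y \<Longrightarrow> L2norm u \<le> C * L2norm (\<lambda>x. g x - of_real l * u x)"
    by (simp add: spectrum_def resolvent_set_def) blast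
  obtain u where u: "(u, \<lambda>x. of_real l * u x) \<in> hamiltonian \<alpha> y" "\<not> (AE x in lborel. u x = 0)"
    using assms by (auto simp: is_eigenvalue_def eigenspace_def)
  have "L2norm u \<le> 0" using C[OF u(1)] by (simp add: L2norm_def)
  then have "L2norm u = 0" using L2norm_nonneg[of u] by linarith
  moreover have "u \<in> L2" using u(1) by (simp add: hamiltonian_def)
  ultimately show False using L2norm_eq_0 u(2) by blast
qed

text \<open>An auxiliary parameter \<open>\<mu>\<close> with invertible matrix represents the
  eigenfunction by its own free resolvent and Green functions at \<open>\<mu>\<close>. Applying the
  free resolvent at \<open>\<kappa>\<close> and the resolvent identity eliminates the regular part;
  what is left is a combination of the Green functions at \<open>\<kappa>\<close>.\<close>

lemma finite_multiplicity_negative: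
  fixes y :: "'n::finite \<Rightarrow> real ^ 3"
  assumes y: "inj y" and k: "\<kappa> > 0" and m: "\<mu> > 0" "\<mu> \<noteq> \<kappa>" and d: "det (\<Gamma> \<alpha> y \<mu>) \<noteq> 0"
  shows "finite_multiplicity (hamiltonian \<alpha> y) (- \<kappa>\<^sup>2)"
  unfolding finite_multiplicity_def
proof (intro exI[of _ "range (\<lambda>i. green \<kappa> (y i))"] conjI ballI)
  show "range (\<lambda>i. green \<kappa> (y i)) \<subseteq> L2" using green_L2[OF k] by auto
  fix u assume "u \<in> eigenspace (hamiltonian \<alpha> y) (- \<kappa>\<^sup>2)"
  then have mem: "(u, \<lambda>x. of_real (- \<kappa>\<^sup>2) * u x) \<in> hamiltonian \<alpha> y" by (simp add: eigenspace_def)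
  define \<delta> where "\<delta> = \<mu>\<^sup>2 - \<kappa>\<^sup>2"
  have \<delta>: "\<delta> \<noteq> 0" using k m by (simp add: \<delta>_def power2_eq_iff)
  note uL = hamiltonianD(1)[OF mem m(1) d]
  define c where "c = krein_coeff \<alpha> y \<mu> (\<lambda>z. of_real \<delta> * u z)"
  define v where "v = (\<lambda>x. of_real \<delta> * free_resolvent \<mu> u x + (\<Sum>i\<in>UNIV. c i * green \<mu> (y i) x))"
  have "(\<lambda>z. of_real (- \<kappa>\<^sup>2) * u z + of_real (\<mu>\<^sup>2) * u z) = (\<lambda>z. of_real \<delta> * u z)"
    by (auto simp: \<delta>_def algebra_simps)
  then have uv: "AE x in lborel. u x = v x"
    using hamiltonianD(3)[OF mem m(1) d] by (simp add: krein_resolvent_eq c_def v_def free_resolvent_cmult)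
  have gL: "(\<lambda>x. \<Sum>i\<in>UNIV. c i * green \<mu> (y i) x) \<in> L2"
    by (intro L2_sum L2_cmult green_L2 m)
  have RL: "(\<lambda>x. of_real \<delta> * free_resolvent \<mu> u x) \<in> L2"
    by (intro L2_cmult free_resolvent_L2 m uL)
  have vL: "v \<in> L2" unfolding v_def by (intro L2_add RL gL)
  have uc: "u x = (\<Sum>i\<in>UNIV. c i * green \<kappa> (y i) x)" if x: "x \<notin> range y" and ux: "u x = v x" for x
  proof -
    have "free_resolvent \<kappa> u x = free_resolvent \<kappa> v x"
      by (rule free_resolvent_cong_AE[OF L2_measurable[OF uL] L2_measurable[OF vL] uv])
    also have "\<dots> = of_real \<delta> * free_resolvent \<kappa> (free_resolvent \<mu> u) x + (\<Sum>i\<in>UNIV. c i * of_real (GG \<kappa> \<mu> (norm (x - y i))))"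
      unfolding v_def using free_resolvent_add[OF k RL gL, of x]
      by (simp add: free_resolvent_sum[OF k L2_cmult(1)[OF green_L2[OF m(1)]]] free_resolvent_cmult free_resolvent_green[OF k m(1)])
    also have "of_real \<delta> * free_resolvent \<kappa> (free_resolvent \<mu> u) x = free_resolvent \<kappa> u x - free_resolvent \<mu> u x"
      unfolding \<delta>_def by (rule free_resolvent_identity[OF k m(1) uL])
    finally have "of_real \<delta> * free_resolvent \<mu> u x = (\<Sum>i\<in>UNIV. c i * of_real (\<delta> * GG \<kappa> \<mu> (norm (x - y i))))"
      by (simp add: sum_distrib_left algebra_simps)
    moreover have "of_real (\<delta> * GG \<kappa> \<mu> (norm (x - y i))) = green \<kappa> (y i) x - green \<mu> (y i) x" for i
    proof -
      have "x - y i \<noteq> 0" using x by auto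
      then show ?thesis
        using GG_eq_diff[OF k m(1), of "x - y i"] unfolding green_def \<delta>_def of_real_diff[symmetric] of_real_eq_iff
        by (simp add: left_diff_distrib)
    qed
    ultimately show ?thesis
      unfolding ux v_def by (simp add: right_diff_distrib sum_subtractf)
  qed
  have AE: "AE x in lborel. u x = (\<Sum>i\<in>UNIV. c i * green \<kappa> (y i) x)"
    by (rule eventually_mono[OF eventually_conj[OF AE_not_in_range[of y] uv]]) (use uc in blast)
  \<comment> \<open>The spanning family is a set of functions, so the coefficients of all indices
    with the same Green function are added up.\<close>
  have "(\<Sum>i\<in>UNIV. c i * green \<kappa> (y i) x) = (\<Sum>b\<in>range (\<lambda>i. green \<kappa> (y i)). (\<Sum>i | green \<kappa> (y i) = b. c i) * b x)" for x
    by (subst sum.image_gen[where g = "\<lambda>i. green \<kappa> (y i)"]) (auto simp: sum_distrib_right intro!: sum.cong)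
  with AE show "\<exists>c. AE x in lborel. u x = (\<Sum>b\<in>range (\<lambda>i. green \<kappa> (y i)). c b * b x)"
    by (intro exI[of _ "\<lambda>b. \<Sum>i | green \<kappa> (y i) = b. c i"]) simp
qed simp

section \<open>The quadratic form of the matrix\<close>

text \<open>Up to the factor 8 pi kappa the form is the squared L2 norm of the combination of Green
  functions with coefficients \<open>c\<close>, and Green functions at distinct centres are linearly
  independent.\<close>

lemma exp_norm_pos_def:
  fixes y :: "'n::finite \<Rightarrow> real ^ 3" and c :: "real ^ 'n"
  assumes y: "inj y" and k: "\<kappa> > 0" and c: "c \<noteq> 0"
  shows "0 < (\<Sum>i\<in>UNIV. \<Sum>j\<in>UNIV. c $ i * c $ j * exp (- \<kappa> * norm (y i - y j)))"
proof -
  define f where "f x = (\<Sum>i\<in>UNIV. c $ i * G \<kappa> (x - y i))" for x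
  have sq: "(f x)\<^sup>2 = (\<Sum>i\<in>UNIV. \<Sum>j\<in>UNIV. c $ i * c $ j * (G \<kappa> (y i - x) * G \<kappa> (x - y j)))" for x
    by (simp add: f_def power2_eq_square sum_product G_commute[of \<kappa> "y _"] ac_simps)
  have int: "integrable lborel (\<lambda>x. (f x)\<^sup>2)"
    unfolding sq by (intro Bochner_Integration.integrable_sum integrable_mult_right integral_G_G(1) k)
  have "(LINT x|lborel. (f x)\<^sup>2) = (\<Sum>i\<in>UNIV. \<Sum>j\<in>UNIV. c $ i * c $ j * GG \<kappa> \<kappa> (norm (y i - y j)))"
    unfolding sq using integral_G_G[OF k k]
    by (simp add: Bochner_Integration.integral_sum)
  also have "\<dots> = (\<Sum>i\<in>UNIV. \<Sum>j\<in>UNIV. c $ i * c $ j * exp (- \<kappa> * norm (y i - y j))) / (8 * pi * \<kappa>)"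
    by (simp add: GG_def sum_divide_distrib)
  finally have e: "(\<Sum>i\<in>UNIV. \<Sum>j\<in>UNIV. c $ i * c $ j * exp (- \<kappa> * norm (y i - y j))) = 8 * pi * \<kappa> * (LINT x|lborel. (f x)\<^sup>2)"
    using k by (simp add: field_simps)
  have "(LINT x|lborel. (f x)\<^sup>2) \<noteq> 0"
  proof
    assume "(LINT x|lborel. (f x)\<^sup>2) = 0"
    then have "AE x in lborel. f x = 0"
      using integral_nonneg_eq_0_iff_AE[OF int] by simp
    then have "AE x in lborel. (\<Sum>i\<in>UNIV. of_real (c $ i) * green \<kappa> (y i) x) = 0"
      by eventually_elim (simp add: f_def green_def flip: of_real_mult of_real_sum)
    from green_independent[OF y this] c show False by (auto simp: vec_eq_iff)
  qed
  moreover have "0 \<le> (LINT x|lborel. (f x)\<^sup>2)" by simp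
  ultimately have "0 < (LINT x|lborel. (f x)\<^sup>2)" by linarith
  then show ?thesis unfolding e using k by simp
qed

definition qf :: "real \<Rightarrow> ('n::finite \<Rightarrow> real ^ 3) \<Rightarrow> real \<Rightarrow> real ^ 'n \<Rightarrow> real" where
  "qf \<alpha> y \<kappa> c = c \<bullet> (\<Gamma> \<alpha> y \<kappa> *v c)"

lemma qf_eq_sum: "qf \<alpha> y \<kappa> c = (\<Sum>i\<in>UNIV. \<Sum>j\<in>UNIV. c $ i * c $ j * \<Gamma> \<alpha> y \<kappa> $ i $ j)"
  by (simp add: qf_def inner_vec_def matrix_vector_mult_def sum_distrib_left ac_simps)

lemma \<Gamma>_sym: "\<Gamma> \<alpha> y \<kappa> $ i $ j = \<Gamma> \<alpha> y \<kappa> $ j $ i"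
  by (simp add: \<Gamma>_def G_commute)

lemma \<Gamma>_inner_commute: "a \<bullet> (\<Gamma> \<alpha> y \<kappa> *v b) = b \<bullet> (\<Gamma> \<alpha> y \<kappa> *v a)"
  unfolding inner_vec_def matrix_vector_mult_def
  by (simp add: sum_distrib_left, subst sum.swap, simp add: \<Gamma>_sym[of _ _ _ _ "_ :: 'a"] ac_simps)

lemma \<Gamma>_shift: "qf (\<alpha> + a) y \<kappa> c = qf \<alpha> y \<kappa> c + a * (c \<bullet> c)"
proof -
  have "\<Gamma> (\<alpha> + a) y \<kappa> *v c = \<Gamma> \<alpha> y \<kappa> *v c + a *\<^sub>R c"
  proof (rule vec_eq_iff[THEN iffD2], rule allI)
    fix i
    have "(\<Gamma> (\<alpha> + a) y \<kappa> *v c) $ i = (\<Sum>j\<in>UNIV. \<Gamma> \<alpha> y \<kappa> $ i $ j * c $ j + (if i = j then a * c $ j else 0))"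
      unfolding matrix_vector_mult_def by (simp, intro sum.cong) (auto simp: \<Gamma>_def algebra_simps)
    then show "(\<Gamma> (\<alpha> + a) y \<kappa> *v c) $ i = (\<Gamma> \<alpha> y \<kappa> *v c + a *\<^sub>R c) $ i"
      by (simp add: sum.distrib matrix_vector_mult_def)
  qed
  then show ?thesis by (simp add: qf_def inner_add_right)
qed

text \<open>Differentiation cancels the factor 1 / |y_i - y_j|, so the diagonal entries obey the
  same formula.\<close>

lemma \<Gamma>_deriv:
  assumes "inj y"
  shows "((\<lambda>\<kappa>. \<Gamma> \<alpha> y \<kappa> $ i $ j) has_real_derivative exp (- \<kappa> * norm (y i - y j)) / (4 * pi)) (at \<kappa>)"
proof (cases "i = j")
  case True
  then show ?thesis unfolding \<Gamma>_def by (auto intro!: derivative_eq_intros)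
next
  case False
  then have "norm (y i - y j) \<noteq> 0" using assms by (auto dest: injD)
  then show ?thesis using False unfolding \<Gamma>_def G_def by (auto intro!: derivative_eq_intros)
qed

lemma qf_strict_mono:
  assumes y: "inj y" and "0 < \<kappa>" "\<kappa> < \<mu>" "c \<noteq> 0"
  shows "qf \<alpha> y \<kappa> c < qf \<alpha> y \<mu> c"
proof (rule DERIV_pos_imp_increasing[where f = "\<lambda>\<kappa>. qf \<alpha> y \<kappa> c"])
  fix t assume t: "\<kappa> \<le> t" "t \<le> \<mu>"
  let ?D = "\<Sum>i\<in>UNIV. \<Sum>j\<in>UNIV. c $ i * c $ j * (exp (- t * norm (y i - y j)) / (4 * pi))"
  have "((\<lambda>\<kappa>. qf \<alpha> y \<kappa> c) has_real_derivative ?D) (at t)"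
    unfolding qf_eq_sum by (intro DERIV_sum DERIV_cmult \<Gamma>_deriv y)
  moreover have "?D = (\<Sum>i\<in>UNIV. \<Sum>j\<in>UNIV. c $ i * c $ j * exp (- t * norm (y i - y j))) / (4 * pi)"
    by (simp add: sum_divide_distrib)
  ultimately show "\<exists>D. ((\<lambda>\<kappa>. qf \<alpha> y \<kappa> c) has_real_derivative D) (at t) \<and> 0 < D"
    using exp_norm_pos_def[OF y, of t c] t assms by (intro exI[of _ ?D]) auto
qed fact

lemma continuous_on_qf:
  assumes "inj y"
  shows "continuous_on UNIV (\<lambda>p. qf \<alpha> y (fst p) (snd p))"
proof -
  have "continuous_on UNIV (\<lambda>\<kappa>. \<Gamma> \<alpha> y \<kappa> $ i $ j)" for i j
    using \<Gamma>_deriv[OF assms] by (meson DERIV_continuous continuous_at_imp_continuous_on)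
  then have "continuous_on UNIV (\<lambda>p. \<Gamma> \<alpha> y (fst p) $ i $ j)" for i j
    by (rule continuous_on_compose2) (auto intro: continuous_intros)
  note [continuous_intros] = this
  have "continuous_on UNIV (\<lambda>p. snd p $ i)" for i :: 'a and p :: "real \<times> real ^ 'a"
    by (intro continuous_intros)
  then show ?thesis unfolding qf_eq_sum
    by (intro continuous_on_sum continuous_on_mult \<open>\<And>i j. continuous_on UNIV (\<lambda>p. \<Gamma> \<alpha> y (fst p) $ i $ j)\<close>) auto
qed

text \<open>An upper bound for the off-diagonal part that does not depend on kappa. The diagonal
  terms are 0 by the convention for division by zero.\<close>

definition coulomb_sum :: "('n::finite \<Rightarrow> real ^ 3) \<Rightarrow> real" where
  "coulomb_sum y = (\<Sum>i\<in>UNIV. \<Sum>j\<in>UNIV. 1 / (4 * pi * norm (y i - y j)))"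

text \<open>Crude entrywise estimate with c_i c_j <= |c|^2. It makes the form positive definite once
  kappa or alpha is large, which bounds the eigenvalues and the critical coupling.\<close>

lemma qf_lower_bound:
  assumes "\<kappa> > 0"
  shows "(\<alpha> + \<kappa> / (4 * pi) - coulomb_sum y) * (c \<bullet> c) \<le> qf \<alpha> y \<kappa> c"
proof -
  have entry: "c $ i * c $ j * \<Gamma> \<alpha> y \<kappa> $ i $ j \<ge> (if i = j then (\<alpha> + \<kappa> / (4 * pi)) * (c $ i * c $ i) else 0) - (1 / (4 * pi * norm (y i - y j))) * (c \<bullet> c)" for i j
  proof (cases "i = j")
    case False
    have "\<bar>c $ i\<bar> * \<bar>c $ j\<bar> \<le> norm c * norm c"
      by (intro mult_mono component_le_norm_cart) auto
    then have "c $ i * c $ j \<le> c \<bullet> c"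
      by (metis abs_le_D1 abs_mult norm_eq_square order_refl power2_eq_square power2_norm_eq_inner)
    moreover have "G \<kappa> (y i - y j) \<le> 1 / (4 * pi * norm (y i - y j))"
      unfolding G_def using assms by (intro divide_right_mono) auto
    ultimately have "c $ i * c $ j * G \<kappa> (y i - y j) \<le> (c \<bullet> c) * (1 / (4 * pi * norm (y i - y j)))"
      by (meson G_nonneg inner_ge_zero mult_left_mono mult_right_mono order_trans)
    then show ?thesis using False by (simp add: \<Gamma>_def)
  qed (simp add: \<Gamma>_def)
  have "(\<alpha> + \<kappa> / (4 * pi) - coulomb_sum y) * (c \<bullet> c) =
     (\<Sum>i\<in>UNIV. \<Sum>j\<in>UNIV. (if i = j then (\<alpha> + \<kappa> / (4 * pi)) * (c $ i * c $ i) else 0) - (1 / (4 * pi * norm (y i - y j))) * (c \<bullet> c))"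
    by (simp add: sum_subtractf coulomb_sum_def left_diff_distrib sum_distrib_right sum_distrib_left[symmetric])
       (simp add: inner_vec_def)
  also have "\<dots> \<le> qf \<alpha> y \<kappa> c"
    unfolding qf_eq_sum by (intro sum_mono entry)
  finally show ?thesis .
qed

lemma qf_scale: "qf \<alpha> y \<kappa> (t *\<^sub>R c) = t\<^sup>2 * qf \<alpha> y \<kappa> c"
  by (simp add: qf_def matrix_vector_mult_scaleR power2_eq_square)

text \<open>A minimiser of a nonnegative form is a critical point: moving from \<open>c\<close>
  against the direction of the image \<open>v\<close> would otherwise make the form
  negative.\<close>

lemma qf_kernel:
  assumes psd: "\<And>d. 0 \<le> qf \<alpha> y \<kappa> d" and "qf \<alpha> y \<kappa> c = 0"
  shows "\<Gamma> \<alpha> y \<kappa> *v c = 0"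
proof -
  define v where "v = \<Gamma> \<alpha> y \<kappa> *v c"
  define Q where "Q = qf \<alpha> y \<kappa> v"
  \<comment> \<open>With this step length the form at the shifted vector is - s^2 (Q + 2). Adding 1
    to \<open>Q\<close> keeps the denominator positive.\<close>
  define s where "s = (v \<bullet> v) / (Q + 1)"
  have Q: "0 \<le> Q" unfolding Q_def by (rule psd)
  then have s: "s * (Q + 1) = v \<bullet> v" "0 \<le> s" by (auto simp: s_def)
  have "0 \<le> qf \<alpha> y \<kappa> (c - s *\<^sub>R v)" by (rule psd)
  also have "\<dots> = qf \<alpha> y \<kappa> c - 2 * s * (v \<bullet> v) + s * (s * Q)"
    using \<Gamma>_inner_commute[of c \<alpha> y \<kappa> v]
    by (simp add: qf_def Q_def matrix_vector_mult_diff_distrib matrix_vector_mult_scaleR inner_diff_left inner_diff_right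
        v_def[symmetric] algebra_simps)
  also have "\<dots> = - s\<^sup>2 * (Q + 2)"
    unfolding assms(2) s(1)[symmetric] by (simp add: algebra_simps power2_eq_square)
  finally have "s\<^sup>2 * (Q + 2) \<le> 0" by simp
  then have "s = 0" using Q by (simp add: mult_le_0_iff)
  then show ?thesis using s(1) by (simp add: v_def)
qed

section \<open>The essential spectrum\<close>

lemma lborel_distr_reflect: "distr lborel borel (\<lambda>z. x - z) = (lborel :: 'a::euclidean_space measure)"
proof (rule measure_eqI)
  fix A :: "'a set" assume A: "A \<in> sets (distr lborel borel (\<lambda>z. x - z))"
  then have [measurable]: "A \<in> sets borel" by simp
  have "emeasure (distr lborel borel (\<lambda>z. x - z)) A = (\<integral>\<^sup>+z. indicator A z \<partial>distr lborel borel (\<lambda>z. x - z))"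
    by simp
  also have "\<dots> = (\<integral>\<^sup>+z. indicator A (x - z) \<partial>lborel)"
    by (rule nn_integral_distr) measurable
  also have "\<dots> = emeasure lborel A"
    by (subst nn_integral_lborel_reflect) auto
  finally show "emeasure (distr lborel borel (\<lambda>z. x - z)) A = emeasure lborel A" .
qed simp

lemma integral_lborel_reflect:
  fixes f :: "'a::euclidean_space \<Rightarrow> 'b::{banach, second_countable_topology}"
  assumes [measurable]: "f \<in> borel_measurable borel"
  shows "(LINT z|lborel. f (x - z)) = (LINT z|lborel. f z)"
  using integral_distr[of "\<lambda>z. x - z" lborel borel f] by (simp add: lborel_distr_reflect)

lemma integral_G:
  assumes "\<kappa> > 0"
  shows "integrable lborel (G \<kappa>)" "(LINT z|lborel. G \<kappa> z) = 1 / \<kappa>\<^sup>2"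
proof -
  have "has_bochner_integral lborel (G \<kappa>) (1 / \<kappa>\<^sup>2)"
    using nn_integral_G[OF assms] by (intro has_bochner_integral_nn_integral) auto
  then show "integrable lborel (G \<kappa>)" "(LINT z|lborel. G \<kappa> z) = 1 / \<kappa>\<^sup>2"
    by (auto simp: has_bochner_integral_iff)
qed

text \<open>The Fourier transform of the Green function. The real part comes from
  \<open>nn_integral_G_cos\<close> by subtracting the total mass; the imaginary part vanishes
  because the integrand is odd.\<close>

lemma integral_G_cis:
  assumes k: "\<kappa> > 0"
  shows "(LINT w|lborel. of_real (G \<kappa> w) * cis (- k * w $ 1)) = complex_of_real (1 / (\<kappa>\<^sup>2 + k\<^sup>2))"
proof -
  have m[measurable]: "(\<lambda>w::real^3. cis (- k * w $ 1)) \<in> borel_measurable borel"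
    by (intro borel_measurable_continuous_onI continuous_intros)
  have int: "integrable lborel (\<lambda>w. of_real (G \<kappa> w) * cis (- k * w $ 1))"
  proof (rule Bochner_Integration.integrable_bound[OF integral_G(1)[OF k]])
    show "(\<lambda>w. of_real (G \<kappa> w) * cis (- k * w $ 1)) \<in> borel_measurable lborel"
      by measurable
  qed (simp add: norm_mult)
  have "0 \<le> 1 + cos (k * w $ 1)" for w :: "real ^ 3"
    using cos_ge_minus_one[of "k * w $ 1"] by linarith
  then have c: "has_bochner_integral lborel (\<lambda>w. G \<kappa> w * (1 + cos (k * w $ 1))) (1 / \<kappa>\<^sup>2 + 1 / (\<kappa>\<^sup>2 + k\<^sup>2))"
    using nn_integral_G_cos[OF k, of k] k by (intro has_bochner_integral_nn_integral) auto
  have "has_bochner_integral lborel (G \<kappa>) (1 / \<kappa>\<^sup>2)"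
    using integral_G[OF k] by (simp add: has_bochner_integral_iff)
  from has_bochner_integral_diff[OF c this]
  have c': "(LINT w|lborel. G \<kappa> w * cos (k * w $ 1)) = 1 / (\<kappa>\<^sup>2 + k\<^sup>2)"
    by (simp add: has_bochner_integral_iff distrib_left)
  have "(LINT w|lborel. G \<kappa> w * sin (- k * w $ 1)) = (LINT w|lborel. - (G \<kappa> w * sin (- k * w $ 1)))"
    by (subst integral_lborel_reflect[of _ 0, symmetric]) (auto simp: G_def)
  then have s: "(LINT w|lborel. G \<kappa> w * sin (- k * w $ 1)) = 0" by simp
  show ?thesis
  proof (rule complex_eqI)
    show "Re (LINT w|lborel. of_real (G \<kappa> w) * cis (- k * w $ 1)) = Re (complex_of_real (1 / (\<kappa>\<^sup>2 + k\<^sup>2)))"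
      using integral_Re[OF int] c' by simp
    show "Im (LINT w|lborel. of_real (G \<kappa> w) * cis (- k * w $ 1)) = Im (complex_of_real (1 / (\<kappa>\<^sup>2 + k\<^sup>2)))"
      using integral_Im[OF int] s by simp
  qed
qed

text \<open>
  A singular sequence: \<open>packet k \<epsilon>\<close> is an approximate eigenfunction for \<open>k\<^sup>2\<close> as \<open>\<epsilon>\<close> tends to 0.
\<close>

definition packet :: "real \<Rightarrow> real \<Rightarrow> wave" where
  "packet k \<epsilon> x = cis (k * x $ 1) * of_real (exp (- \<epsilon> * norm x))"

lemma norm_packet [simp]: "norm (packet k \<epsilon> x) = exp (- \<epsilon> * norm x)"
  by (simp add: packet_def norm_mult)

lemma packet_measurable [measurable]: "packet k \<epsilon> \<in> borel_measurable borel"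
  unfolding packet_def by (intro borel_measurable_continuous_onI continuous_intros)

text \<open>Since r exp (- r) <= 1, the squared modulus is dominated by a multiple of the Green
  function at \<open>\<epsilon>\<close>, whose integral is known.\<close>

lemma packet_L2:
  assumes e: "\<epsilon> > 0"
  shows "packet k \<epsilon> \<in> L2"
proof (rule L2I_nn_integral)
  have le: "(exp (- \<epsilon> * norm x))\<^sup>2 \<le> 4 * pi / \<epsilon> * G \<epsilon> x" if "x \<noteq> 0" for x :: "real ^ 3"
  proof -
    have "\<epsilon> * norm x \<le> exp (\<epsilon> * norm x)"
      using exp_ge_add_one_self[of "\<epsilon> * norm x"] by linarith
    then have "exp (- \<epsilon> * norm x) * (\<epsilon> * norm x) \<le> 1"
      by (simp add: exp_minus field_simps)
    then have "exp (- \<epsilon> * norm x) * (exp (- \<epsilon> * norm x) * (\<epsilon> * norm x)) \<le> exp (- \<epsilon> * norm x) * 1"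
      by (intro mult_left_mono) auto
    then show ?thesis using that e by (simp add: G_def field_simps power2_eq_square)
  qed
  have "(\<integral>\<^sup>+x. ennreal ((norm (packet k \<epsilon> x))\<^sup>2) \<partial>lborel) \<le> (\<integral>\<^sup>+x. ennreal (4 * pi / \<epsilon> * G \<epsilon> x) \<partial>lborel)"
    by (rule nn_integral_mono_AE, rule eventually_mono[OF AE_lborel_singleton[of 0]])
       (use le in \<open>auto intro!: ennreal_leI\<close>)
  also have "\<dots> = ennreal (4 * pi / \<epsilon> * (1 / \<epsilon>\<^sup>2))"
    using integral_G[OF e] e by (subst nn_integral_eq_integral) auto
  finally show "(\<integral>\<^sup>+x. ennreal ((norm (packet k \<epsilon> x))\<^sup>2) \<partial>lborel) \<le> ennreal (4 * pi / \<epsilon> * (1 / \<epsilon>\<^sup>2))" .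
qed (use e in auto)

text \<open>On the ball of radius 1 / epsilon the modulus is at least exp (- 1). The resulting
  growth like epsilon^(-3) is what outweighs the bounded contribution of the centres.\<close>

lemma L2norm_packet_ge:
  assumes e: "\<epsilon> > 0"
  shows "exp (- 2) * (unit_ball_vol 3 * (1 / \<epsilon>) ^ 3) \<le> (L2norm (packet k \<epsilon>))\<^sup>2"
proof -
  have "ennreal (exp (- 2) * (unit_ball_vol 3 * (1 / \<epsilon>) ^ 3)) = ennreal (exp (- 2)) * emeasure lborel (ball (0 :: real ^ 3) (1 / \<epsilon>))"
    using e by (simp add: emeasure_ball ennreal_mult[symmetric])
  also have "\<dots> = (\<integral>\<^sup>+x. ennreal (exp (- 2)) * indicator (ball (0 :: real ^ 3) (1 / \<epsilon>)) x \<partial>lborel)"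
    by (rule nn_integral_cmult_indicator[symmetric]) simp
  also have "\<dots> \<le> (\<integral>\<^sup>+x. ennreal ((norm (packet k \<epsilon> x))\<^sup>2) \<partial>lborel)"
  proof (intro nn_integral_mono)
    fix x :: "real ^ 3"
    have "norm x < 1 / \<epsilon> \<Longrightarrow> \<epsilon> * norm x \<le> 1" using e by (simp add: field_simps)
    then show "ennreal (exp (- 2)) * indicator (ball 0 (1 / \<epsilon>)) x \<le> ennreal ((norm (packet k \<epsilon> x))\<^sup>2)"
      by (auto simp: indicator_def exp_double[symmetric] intro!: ennreal_leI)
  qed
  also have "\<dots> = ennreal ((L2norm (packet k \<epsilon>))\<^sup>2)"
    by (rule L2_nn_integral[OF packet_L2[OF e]])
  finally show ?thesis by simp
qed

text \<open>On a plane wave the free resolvent is multiplication by 1 / (kappa^2 + k^2). Freezing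
  the envelope at x costs at most exp (epsilon |w|) - 1 relative to its value there, and this weight
  turns the kernel at kappa into the kernel at kappa - epsilon. The error is thus proportional to
  the modulus of the packet itself.\<close>

lemma free_resolvent_packet:
  assumes k: "\<kappa> > 0" and e: "0 < \<epsilon>" "\<epsilon> < \<kappa>"
  shows "norm (free_resolvent \<kappa> (packet k \<epsilon>) x - of_real (1 / (\<kappa>\<^sup>2 + k\<^sup>2)) * packet k \<epsilon> x)
    \<le> (1 / (\<kappa> - \<epsilon>)\<^sup>2 - 1 / \<kappa>\<^sup>2) * exp (- \<epsilon> * norm x)"
proof -
  have m[measurable]: "(\<lambda>w::real^3. cis (- k * w $ 1)) \<in> borel_measurable borel"
    by (intro borel_measurable_continuous_onI continuous_intros)
  define F where "F w = of_real (G \<kappa> w) * packet k \<epsilon> (x - w)" for w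
  define H where "H w = packet k \<epsilon> x * (of_real (G \<kappa> w) * cis (- k * w $ 1))" for w
  have Fm[measurable]: "F \<in> borel_measurable borel" and Hm[measurable]: "H \<in> borel_measurable borel"
    unfolding F_def H_def by measurable
  have "norm (F w) \<le> norm (G \<kappa> w)" "norm (H w) \<le> norm (G \<kappa> w)" for w
    using e by (auto simp: F_def H_def norm_mult intro!: mult_left_le mult_left_le_one_le)
  then have intF: "integrable lborel F" and intH: "integrable lborel H"
    by (auto intro!: Bochner_Integration.integrable_bound[OF integral_G(1)[OF k]])
  have FH: "norm (F w - H w) \<le> exp (- \<epsilon> * norm x) * (G (\<kappa> - \<epsilon>) w - G \<kappa> w)" for w
  proof -
    define a where "a = exp (- \<epsilon> * norm x)"
    define b where "b = exp (\<epsilon> * norm w)"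
    have b: "b \<ge> 1" using e by (simp add: b_def)
    have "\<epsilon> * norm x \<le> \<epsilon> * (norm (x - w) + norm w)" "\<epsilon> * norm (x - w) \<le> \<epsilon> * (norm x + norm w)"
      using norm_triangle_sub[of x w] norm_triangle_ineq4[of x w] e by (auto intro!: mult_left_mono simp: add.commute)
    then have up: "exp (- \<epsilon> * norm (x - w)) \<le> a * b" and lo: "a / b \<le> exp (- \<epsilon> * norm (x - w))"
      unfolding a_def b_def exp_diff[symmetric] exp_add[symmetric] exp_le_cancel_iff by (simp_all add: distrib_left)
    \<comment> \<open>The deviation of the envelope downwards is at most that upwards, so one bound
      covers both signs.\<close>
    have "1 - 1 / b \<le> b - 1"
    proof -
      have "b - 1 - (1 - 1 / b) = (b - 1)\<^sup>2 / b" using b by (simp add: power2_eq_square field_simps)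
      also have "\<dots> \<ge> 0" using b by simp
      finally show ?thesis by simp
    qed
    then have "a * (1 - 1 / b) \<le> a * (b - 1)"
      by (intro mult_left_mono) (auto simp: a_def)
    then have ab: "\<bar>exp (- \<epsilon> * norm (x - w)) - a\<bar> \<le> a * (b - 1)"
      using up lo by (simp add: abs_le_iff right_diff_distrib)
    have "cis (k * (x - w) $ 1) = cis (k * x $ 1) * cis (- k * w $ 1)"
      by (simp add: cis_mult right_diff_distrib)
    then have "F w - H w = of_real (G \<kappa> w) * (cis (k * (x - w) $ 1) * of_real (exp (- \<epsilon> * norm (x - w)) - a))"
      by (simp only: F_def H_def packet_def a_def of_real_diff right_diff_distrib ac_simps)
    then have "norm (F w - H w) = G \<kappa> w * \<bar>exp (- \<epsilon> * norm (x - w)) - a\<bar>"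
      by (simp only: norm_mult norm_of_real norm_cis) simp
    also have "\<dots> \<le> G \<kappa> w * (a * (b - 1))"
      by (intro mult_left_mono ab) simp
    also have "\<dots> = a * (G \<kappa> w * b - G \<kappa> w)"
      by (simp add: algebra_simps)
    also have "G \<kappa> w * b = G (\<kappa> - \<epsilon>) w"
      by (simp add: G_def b_def mult_exp_exp algebra_simps)
    finally show ?thesis by (simp add: a_def)
  qed
  have "free_resolvent \<kappa> (packet k \<epsilon>) x = (LINT w|lborel. F w)"
    unfolding free_resolvent_def F_def
    by (subst integral_lborel_reflect[of _ x, symmetric]) (auto simp: F_def)
  moreover have "of_real (1 / (\<kappa>\<^sup>2 + k\<^sup>2)) * packet k \<epsilon> x = (LINT w|lborel. H w)"
    unfolding H_def integral_mult_right_zero integral_G_cis[OF k] by (rule mult.commute)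
  ultimately have "norm (free_resolvent \<kappa> (packet k \<epsilon>) x - of_real (1 / (\<kappa>\<^sup>2 + k\<^sup>2)) * packet k \<epsilon> x) = norm (LINT w|lborel. F w - H w)"
    using intF intH by simp
  also have "\<dots> \<le> (LINT w|lborel. exp (- \<epsilon> * norm x) * (G (\<kappa> - \<epsilon>) w - G \<kappa> w))"
    using integral_G(1)[of \<kappa>] integral_G(1)[of "\<kappa> - \<epsilon>"] intF intH k e FH
    by (intro Bochner_Integration.integral_norm_bound_integral) auto
  also have "\<dots> = exp (- \<epsilon> * norm x) * (1 / (\<kappa> - \<epsilon>)\<^sup>2 - 1 / \<kappa>\<^sup>2)"
    using integral_G[of \<kappa>] integral_G[of "\<kappa> - \<epsilon>"] k e by simp
  finally show ?thesis by (simp add: mult.commute)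
qed

text \<open>Weyl's criterion applied to the Krein resolvent \<open>u\<close> of a packet
  \<open>f\<close>. If l had a bounded inverse, then u would be controlled by (H - l) u, a multiple
  of \<open>M\<close> f - u. That difference consists of a small multiple of the norm of f and a
  bounded finite-rank part, while M f itself grows.\<close>

lemma nonneg_spectrum:
  fixes y :: "'n::finite \<Rightarrow> real ^ 3"
  assumes y: "inj y" and m: "\<mu> > 0" and d: "det (\<Gamma> \<alpha> y \<mu>) \<noteq> 0" and l: "l > 0"
  shows "l \<in> spectrum (hamiltonian \<alpha> y)"
proof (rule ccontr)
  assume "l \<notin> spectrum (hamiltonian \<alpha> y)"
  then obtain C where C: "\<And>u g. (u, g) \<in> hamiltonian \<alpha> y \<Longrightarrow> L2norm u \<le> C * L2norm (\<lambda>x. g x - of_real l * u x)"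
    by (simp add: spectrum_def resolvent_set_def) blast
  define k where "k = sqrt l"
  have k2: "k\<^sup>2 = l" using l by (simp add: k_def)
  define M where "M = 1 / (\<mu>\<^sup>2 + l)"
  have M: "M > 0" using m l by (simp add: M_def add_pos_pos)
  define b where "b = coupling_bound \<alpha> y \<mu> * (M + 1)\<^sup>2"
  have b: "b \<ge> 0" by (simp add: b_def coupling_bound_nonneg)
  define A where "A = 4 * (C\<^sup>2 * (\<mu>\<^sup>2 + l)\<^sup>2 + 1)"
  have A: "A \<ge> 0" by (simp add: A_def)
  define \<delta> where "\<delta> \<epsilon> = 1 / (\<mu> - \<epsilon>)\<^sup>2 - 1 / \<mu>\<^sup>2" for \<epsilon>
  have main: "M\<^sup>2 * (L2norm (packet k \<epsilon>))\<^sup>2 \<le> A * ((\<delta> \<epsilon>)\<^sup>2 * (L2norm (packet k \<epsilon>))\<^sup>2 + b)"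
    if e: "0 < \<epsilon>" "\<epsilon> < \<mu>" "\<delta> \<epsilon> \<le> 1" for \<epsilon>
  proof -
    define f where "f = packet k \<epsilon>"
    have f: "f \<in> L2" unfolding f_def by (rule packet_L2[OF e(1)])
    have \<delta>0: "\<delta> \<epsilon> \<ge> 0" using e m by (auto simp: \<delta>_def intro!: frac_le power_mono)
    define R where "R = free_resolvent \<mu> f"
    define u where "u = krein_resolvent \<alpha> y \<mu> f"
    have near: "norm (of_real M * f x - R x) \<le> norm (of_real (\<delta> \<epsilon>) * f x)" for x
    proof -
      have "norm (of_real (\<delta> \<epsilon>) * f x) = \<delta> \<epsilon> * exp (- \<epsilon> * norm x)"
        using \<delta>0 by (simp add: f_def norm_mult)
      then show ?thesis
        using free_resolvent_packet[OF m e(1,2), of k x]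
        unfolding k2 M_def[symmetric] R_def[symmetric] f_def[symmetric] \<delta>_def[symmetric]
        by (simp only: R_def norm_minus_commute)
    qed
    have RB: "(norm (free_resolvent \<mu> f (y j)))\<^sup>2 \<le> (M + 1)\<^sup>2" for j
    proof (rule power_mono)
      have "norm (R (y j)) \<le> norm (of_real M * f (y j)) + norm (of_real M * f (y j) - R (y j))"
        using norm_triangle_ineq4[of "of_real M * f (y j)" "of_real M * f (y j) - R (y j)"] by simp
      also have "\<dots> \<le> M * norm (f (y j)) + \<delta> \<epsilon> * norm (f (y j))"
        using near[of "y j"] M \<delta>0 by (simp add: norm_mult)
      also have "\<dots> \<le> M * 1 + 1 * 1"
        using M \<delta>0 e by (intro add_mono mult_mono) (auto simp: f_def)
      finally show "norm (free_resolvent \<mu> f (y j)) \<le> M + 1" by (simp add: R_def)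
    qed simp
    have RL: "R \<in> L2" unfolding R_def by (rule free_resolvent_L2[OF m f])
    have uL: "u \<in> L2" unfolding u_def by (rule krein_resolvent_mem[OF y m d f])
    have pL: "(\<lambda>x. u x - R x) \<in> L2" and p: "(L2norm (\<lambda>x. u x - R x))\<^sup>2 \<le> b"
      using krein_resolvent_perturbation[OF m f RB, of \<alpha>] by (simp_all add: u_def R_def b_def)
    have MfL: "(\<lambda>x. of_real M * f x) \<in> L2" by (rule L2_cmult[OF f])
    have MRL: "(\<lambda>x. of_real M * f x - R x) \<in> L2" by (rule L2_diff[OF MfL RL])
    have "L2norm (\<lambda>x. of_real M * f x - R x) \<le> L2norm (\<lambda>x. of_real (\<delta> \<epsilon>) * f x)"
      by (rule L2norm_mono[OF MRL L2_cmult(1)[OF f] near])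
    then have MR: "(L2norm (\<lambda>x. of_real M * f x - R x))\<^sup>2 \<le> (\<delta> \<epsilon>)\<^sup>2 * (L2norm f)\<^sup>2"
      using \<delta>0 power_mono[of _ "\<delta> \<epsilon> * L2norm f" 2] by (simp add: L2_cmult(2)[OF f] power_mult_distrib)
    define D where "D = (L2norm (\<lambda>x. of_real M * f x - u x))\<^sup>2"
    have D: "D \<le> 2 * ((\<delta> \<epsilon>)\<^sup>2 * (L2norm f)\<^sup>2 + b)"
    proof -
      have "D \<le> 2 * ((L2norm (\<lambda>x. of_real M * f x - R x))\<^sup>2 + (L2norm (\<lambda>x. u x - R x))\<^sup>2)"
        using L2_diff(2)[OF MRL pL] by (simp add: D_def)
      also have "\<dots> \<le> 2 * ((\<delta> \<epsilon>)\<^sup>2 * (L2norm f)\<^sup>2 + b)"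
        by (intro mult_left_mono add_mono MR p) simp
      finally show ?thesis .
    qed
    have DL: "(\<lambda>x. of_real M * f x - u x) \<in> L2" by (rule L2_diff[OF MfL uL])
    have "L2norm u \<le> C * L2norm (\<lambda>x. f x - of_real (\<mu>\<^sup>2) * u x - of_real l * u x)"
      using C[OF krein_resolvent_mem(2)[OF y m d f]] by (simp add: u_def)
    \<comment> \<open>Because \<open>M\<close> is the reciprocal of mu^2 + l, the value of (H - l) u
      measures how far u is from the multiplier applied to the packet.\<close>
    also have "(\<lambda>x. f x - of_real (\<mu>\<^sup>2) * u x - of_real l * u x) = (\<lambda>x. of_real (\<mu>\<^sup>2 + l) * (of_real M * f x - u x))"
    proof
      fix x
      have "complex_of_real ((\<mu>\<^sup>2 + l) * M) = 1" using m l by (simp add: M_def add_pos_pos less_imp_neq[symmetric])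
      then have "f x = complex_of_real (\<mu>\<^sup>2 + l) * of_real M * f x" by simp
      then show "f x - of_real (\<mu>\<^sup>2) * u x - of_real l * u x = of_real (\<mu>\<^sup>2 + l) * (of_real M * f x - u x)"
        by (simp add: algebra_simps)
    qed
    also have "L2norm \<dots> = (\<mu>\<^sup>2 + l) * L2norm (\<lambda>x. of_real M * f x - u x)"
      unfolding L2_cmult(2)[OF DL] norm_of_real using l by simp
    finally have "(L2norm u)\<^sup>2 \<le> (C * ((\<mu>\<^sup>2 + l) * L2norm (\<lambda>x. of_real M * f x - u x)))\<^sup>2"
      by (intro power_mono) auto
    then have uD: "(L2norm u)\<^sup>2 \<le> C\<^sup>2 * (\<mu>\<^sup>2 + l)\<^sup>2 * D"
      by (simp add: D_def power_mult_distrib mult.assoc)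
    have "M\<^sup>2 * (L2norm f)\<^sup>2 = (L2norm (\<lambda>x. of_real M * f x))\<^sup>2"
      using M by (simp add: L2_cmult(2)[OF f] power_mult_distrib)
    also have "\<dots> \<le> 2 * (D + (L2norm u)\<^sup>2)"
      using L2_add(2)[OF DL uL] by (simp add: D_def)
    also have "\<dots> \<le> 2 * (D + C\<^sup>2 * (\<mu>\<^sup>2 + l)\<^sup>2 * D)"
      using uD by simp
    also have "\<dots> = A / 2 * D" by (simp add: A_def algebra_simps)
    also have "\<dots> \<le> A / 2 * (2 * ((\<delta> \<epsilon>)\<^sup>2 * (L2norm f)\<^sup>2 + b))"
      using A D by (intro mult_left_mono) auto
    also have "\<dots> = A * ((\<delta> \<epsilon>)\<^sup>2 * (L2norm f)\<^sup>2 + b)" by simp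
    finally show ?thesis unfolding f_def .
  qed
  have "(\<delta> \<longlongrightarrow> 1 / (\<mu> - 0)\<^sup>2 - 1 / \<mu>\<^sup>2) (at_right 0)"
    unfolding \<delta>_def using m by (intro tendsto_intros) auto
  then have \<delta>0: "(\<delta> \<longlongrightarrow> 0) (at_right 0)" by simp
  then have "((\<lambda>\<epsilon>. A * (\<delta> \<epsilon>)\<^sup>2) \<longlongrightarrow> A * 0\<^sup>2) (at_right 0)"
    by (intro tendsto_intros)
  then have ev1: "\<forall>\<^sub>F \<epsilon> in at_right 0. A * (\<delta> \<epsilon>)\<^sup>2 < M\<^sup>2 / 2"
    by (rule order_tendstoD) (use M in simp)
  have ev2: "\<forall>\<^sub>F \<epsilon> in at_right 0. \<delta> \<epsilon> < 1"
    by (rule order_tendstoD[OF \<delta>0]) simp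
  have ev3: "\<forall>\<^sub>F \<epsilon> in at_right 0. 0 < \<epsilon> \<and> \<epsilon> < \<mu>"
    using eventually_at_right_real[OF m] by (auto elim: eventually_mono)
  \<comment> \<open>A small \<open>\<epsilon>\<close> serves two ends: the error
    \<open>\<delta>\<close> is absorbed into half of the left-hand side, and the norm exceeds the
    fixed contribution of the centres.\<close>
  have "filterlim (\<lambda>\<epsilon>. exp (- 2) * (unit_ball_vol 3 * (1 / \<epsilon>) ^ 3)) at_top (at_right (0::real))"
    using unit_ball_vol_pos[of 3] by real_asymp
  then have ev4: "\<forall>\<^sub>F \<epsilon> in at_right 0. 2 * A * b / M\<^sup>2 < exp (- 2) * (unit_ball_vol 3 * (1 / \<epsilon>) ^ 3)"
    by (simp add: filterlim_at_top_dense)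
  obtain \<epsilon> where e: "A * (\<delta> \<epsilon>)\<^sup>2 < M\<^sup>2 / 2" "\<delta> \<epsilon> < 1" "0 < \<epsilon>" "\<epsilon> < \<mu>"
      "2 * A * b / M\<^sup>2 < exp (- 2) * (unit_ball_vol 3 * (1 / \<epsilon>) ^ 3)"
    using eventually_happens'[OF _ eventually_conj[OF ev1 eventually_conj[OF ev2 eventually_conj[OF ev3 ev4]]]] by auto
  define E where "E = (L2norm (packet k \<epsilon>))\<^sup>2"
  have E: "2 * A * b / M\<^sup>2 < E" using e(5) L2norm_packet_ge[OF e(3), of k] by (simp add: E_def)
  have "M\<^sup>2 * E \<le> A * ((\<delta> \<epsilon>)\<^sup>2 * E + b)" using main[OF e(3,4)] e(2) by (simp add: E_def)
  also have "\<dots> = A * (\<delta> \<epsilon>)\<^sup>2 * E + A * b" by (simp add: algebra_simps)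
  also have "\<dots> \<le> M\<^sup>2 / 2 * E + A * b"
    using e(1) by (intro add_right_mono mult_right_mono) (auto simp: E_def)
  finally have "M\<^sup>2 * E \<le> 2 * A * b" by simp
  moreover have "2 * A * b < M\<^sup>2 * E" using E M by (simp add: divide_less_eq mult.commute)
  ultimately show False by simp
qed

section \<open>The lowest eigenvalue\<close>

lemma qf_pos_imp_det_nonzero:
  assumes "\<And>c. c \<noteq> 0 \<Longrightarrow> 0 < qf \<alpha> y \<kappa> c"
  shows "det (\<Gamma> \<alpha> y \<kappa>) \<noteq> 0"
  using assms by (force simp: det_eq_0_iff qf_def)

text \<open>K is the largest parameter at which the form takes a nonpositive value on some unit
  vector. Choosing the largest one gives positivity above K directly, and at K the form is
  nonnegative with a zero, which must then be a kernel vector.\<close>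

lemma ground_state:
  fixes y :: "'n::finite \<Rightarrow> real ^ 3"
  assumes y: "inj y" and k: "\<kappa> > 0" and c: "c \<noteq> 0" "qf \<alpha> y \<kappa> c \<le> 0"
  shows "\<exists>K\<ge>\<kappa>. det (\<Gamma> \<alpha> y K) = 0 \<and> (\<forall>d. 0 \<le> qf \<alpha> y K d) \<and> (\<forall>\<mu>>K. \<forall>d. d \<noteq> 0 \<longrightarrow> 0 < qf \<alpha> y \<mu> d)"
proof -
  \<comment> \<open>Beyond \<open>B\<close> the bound \<open>qf_lower_bound\<close> makes the form
    positive definite, so the search is confined to a compact set.\<close>
  define B where "B = max \<kappa> (4 * pi * (coulomb_sum y - \<alpha>) + 1)"
  define S where "S = {p \<in> {\<kappa>..B} \<times> sphere 0 1. qf \<alpha> y (fst p) (snd p) \<le> 0}"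
  have beyond: "\<mu> \<le> B" if "\<kappa> \<le> \<mu>" "d \<noteq> 0" "qf \<alpha> y \<mu> d \<le> 0" for \<mu> and d :: "real ^ 'n"
  proof (rule ccontr)
    assume "\<not> \<mu> \<le> B"
    then have "4 * pi * (coulomb_sum y - \<alpha>) < \<mu>" by (simp add: B_def)
    then have "0 < \<alpha> + \<mu> / (4 * pi) - coulomb_sum y"
      by (simp add: field_simps)
    moreover have "0 < d \<bullet> d" using that by simp
    ultimately have "0 < (\<alpha> + \<mu> / (4 * pi) - coulomb_sum y) * (d \<bullet> d)" by simp
    with qf_lower_bound[of \<mu> \<alpha> y d] that k show False by linarith
  qed
  have unit: "(\<mu>, (1 / norm d) *\<^sub>R d) \<in> S" if "\<kappa> \<le> \<mu>" "d \<noteq> 0" "qf \<alpha> y \<mu> d \<le> 0" for \<mu> and d :: "real ^ 'n"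
    using that beyond[OF that] by (auto simp: S_def qf_scale mult_nonneg_nonpos)
  have "compact S"
  proof -
    have "closed S"
      unfolding S_def
      by (intro continuous_on_closed_Collect_le continuous_on_subset[OF continuous_on_qf[OF y]]
          continuous_on_const closed_Times closed_atLeastAtMost closed_sphere) auto
    moreover have "S = ({\<kappa>..B} \<times> sphere 0 1) \<inter> S" by (auto simp: S_def)
    ultimately show ?thesis
      by (metis compact_Icc compact_Int_closed compact_Times compact_sphere)
  qed
  moreover have "S \<noteq> {}" using unit[OF _ c] by auto
  ultimately obtain p where p: "p \<in> S" "\<And>q. q \<in> S \<Longrightarrow> fst q \<le> fst p"
    using continuous_attains_sup[of S fst] continuous_on_fst[OF continuous_on_id] by blast
  define K where "K = fst p"
  define e where "e = snd p"
  have K: "\<kappa> \<le> K" "norm e = 1" "qf \<alpha> y K e \<le> 0" using p(1) by (auto simp: S_def K_def e_def)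
  have above: "0 < qf \<alpha> y \<mu> d" if "K < \<mu>" "d \<noteq> 0" for \<mu> d
  proof (rule ccontr)
    assume "\<not> 0 < qf \<alpha> y \<mu> d"
    then have "(\<mu>, (1 / norm d) *\<^sub>R d) \<in> S" using that K by (intro unit) auto
    from p(2)[OF this] that(1) show False by (simp add: K_def)
  qed
  \<comment> \<open>Positivity above K passes to the limit from the right.\<close>
  have psd: "0 \<le> qf \<alpha> y K d" for d
  proof (cases "d = 0")
    case False
    have "continuous_on UNIV (\<lambda>\<mu>. qf \<alpha> y \<mu> d)"
      using continuous_on_compose2[OF continuous_on_qf[OF y, of \<alpha>], of UNIV "\<lambda>\<mu>. (\<mu>, d)"]
      by (simp add: continuous_on_Pair continuous_on_id continuous_on_const)
    then have "isCont (\<lambda>\<mu>. qf \<alpha> y \<mu> d) K"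
      by (simp add: continuous_on_eq_continuous_at)
    then have "((\<lambda>\<mu>. qf \<alpha> y \<mu> d) \<longlongrightarrow> qf \<alpha> y K d) (at_right K)"
      unfolding isCont_def by (rule tendsto_within_subset) auto
    then show ?thesis
      by (rule tendsto_lowerbound)
         (rule eventually_mono[OF eventually_at_right_less[of K]], use above False less_imp_le in blast, simp)
  qed (simp add: qf_def)
  have "qf \<alpha> y K e = 0" using K(3) psd[of e] by simp
  then have "\<Gamma> \<alpha> y K *v e = 0" by (rule qf_kernel[OF psd])
  moreover have "e \<noteq> 0" using K(2) by auto
  ultimately have "det (\<Gamma> \<alpha> y K) = 0" by (auto simp: det_eq_0_iff)
  then show ?thesis using K(1) psd above by blast
qed

section \<open>Discrete spectrum and critical coupling\<close>

lemma exists_det_nonzero: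
  fixes y :: "'n::finite \<Rightarrow> real ^ 3"
  obtains \<mu> where "\<mu> > a" "\<mu> > 0" "det (\<Gamma> \<alpha> y \<mu>) \<noteq> 0"
proof -
  define \<mu> where "\<mu> = max (max a 0) (4 * pi * (coulomb_sum y - \<alpha>)) + 1"
  have m: "\<mu> > a" "\<mu> > 0" "4 * pi * (coulomb_sum y - \<alpha>) < \<mu>" by (auto simp: \<mu>_def)
  then have "0 < \<alpha> + \<mu> / (4 * pi) - coulomb_sum y" by (simp add: field_simps)
  then have "0 < qf \<alpha> y \<mu> c" if "c \<noteq> 0" for c
    using qf_lower_bound[OF m(2), of \<alpha> y c] that by (meson inner_gt_zero_iff less_le_trans mult_pos_pos)
  then show ?thesis using that m qf_pos_imp_det_nonzero by blast
qed

text \<open>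
  Otherwise unit kernel vectors at zeros accumulating at \<open>\<kappa>\<close> converge along a subsequence to a kernel vector \<open>e\<close>
  at \<open>\<kappa>\<close>, and the difference quotients give \<open>0\<close> for the derivative of the quadratic form at \<open>e\<close>, which is positive.
\<close>

lemma det_zero_isolated:
  fixes y :: "'n::finite \<Rightarrow> real ^ 3"
  assumes y: "inj y" and k: "\<kappa> > 0" and d: "det (\<Gamma> \<alpha> y \<kappa>) = 0"
  shows "\<forall>\<^sub>F \<mu> in at \<kappa>. det (\<Gamma> \<alpha> y \<mu>) \<noteq> 0"
proof (rule ccontr)
  assume "\<not> ?thesis"
  then have "\<exists>\<^sub>F \<mu> in at \<kappa>. det (\<Gamma> \<alpha> y \<mu>) = 0" by (simp add: frequently_def)
  have "\<exists>\<mu>. \<mu> \<noteq> \<kappa> \<and> dist \<mu> \<kappa> < inverse (real (Suc n)) \<and> det (\<Gamma> \<alpha> y \<mu>) = 0" for n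
  proof (rule ccontr)
    assume "\<not> ?thesis"
    then have "\<forall>\<^sub>F \<mu> in at \<kappa>. det (\<Gamma> \<alpha> y \<mu>) \<noteq> 0"
      unfolding eventually_at by (intro exI[of _ "inverse (real (Suc n))"]) auto
    then show False using \<open>\<exists>\<^sub>F \<mu> in at \<kappa>. det (\<Gamma> \<alpha> y \<mu>) = 0\<close> by (simp add: frequently_def)
  qed
  then obtain m where m: "\<And>n. m n \<noteq> \<kappa>" "\<And>n. dist (m n) \<kappa> < inverse (real (Suc n))" "\<And>n. det (\<Gamma> \<alpha> y (m n)) = 0"
    by metis
  have mlim: "m \<longlonglongrightarrow> \<kappa>"
    unfolding tendsto_dist_iff[of m]
    by (rule tendsto_sandwich[OF _ _ tendsto_const LIMSEQ_inverse_real_of_nat])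
       (intro always_eventually allI less_imp_le m(2) zero_le_dist)+
  have "\<exists>c. norm c = 1 \<and> \<Gamma> \<alpha> y (m n) *v c = 0" for n
  proof -
    obtain c where c: "c \<noteq> 0" "\<Gamma> \<alpha> y (m n) *v c = 0" using m(3)[of n] by (auto simp: det_eq_0_iff)
    then show ?thesis by (intro exI[of _ "(1 / norm c) *\<^sub>R c"]) (simp add: matrix_vector_mult_scaleR)
  qed
  then obtain c where c: "\<And>n. norm (c n) = 1" "\<And>n. \<Gamma> \<alpha> y (m n) *v c n = 0" by metis
  have "seq_compact (sphere (0 :: real ^ 'n) 1)" by (simp add: compact_imp_seq_compact)
  moreover have "\<forall>n. c n \<in> sphere 0 1" using c(1) by simp
  ultimately obtain e r where e: "e \<in> sphere 0 1" "strict_mono r" "(c \<circ> r) \<longlonglongrightarrow> e"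
    unfolding seq_compact_def by blast
  have mr: "(\<lambda>n. m (r n)) \<longlonglongrightarrow> \<kappa>"
    using LIMSEQ_subseq_LIMSEQ[OF mlim e(2)] by (simp add: o_def)
  have cr: "(\<lambda>n. c (r n) $ i) \<longlonglongrightarrow> e $ i" for i
    using e(3) by (auto simp: o_def intro: tendsto_vec_nth)
  have G: "(\<lambda>n. \<Gamma> \<alpha> y (m (r n)) $ i $ j) \<longlonglongrightarrow> \<Gamma> \<alpha> y \<kappa> $ i $ j" for i j
    by (rule isCont_tendsto_compose[OF _ mr]) (rule DERIV_isCont[OF \<Gamma>_deriv[OF y]])
  have Ge: "\<Gamma> \<alpha> y \<kappa> *v e = 0"
  proof (rule vec_eq_iff[THEN iffD2], rule allI)
    fix i
    have "(\<lambda>n. \<Sum>j\<in>UNIV. \<Gamma> \<alpha> y (m (r n)) $ i $ j * c (r n) $ j) \<longlonglongrightarrow> (\<Sum>j\<in>UNIV. \<Gamma> \<alpha> y \<kappa> $ i $ j * e $ j)"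
      by (intro tendsto_intros G cr)
    moreover have "(\<Sum>j\<in>UNIV. \<Gamma> \<alpha> y (m (r n)) $ i $ j * c (r n) $ j) = 0" for n
      using c(2)[of "r n"] by (simp add: vec_eq_iff matrix_vector_mult_def)
    ultimately show "(\<Gamma> \<alpha> y \<kappa> *v e) $ i = 0 $ i"
      by (simp add: matrix_vector_mult_def LIMSEQ_const_iff)
  qed
  define q where "q n i j = (\<Gamma> \<alpha> y (m (r n)) $ i $ j - \<Gamma> \<alpha> y \<kappa> $ i $ j) / (m (r n) - \<kappa>)" for n i j
  have q: "(\<lambda>n. q n i j) \<longlonglongrightarrow> exp (- \<kappa> * norm (y i - y j)) / (4 * pi)" for i j
  proof -
    have "((\<lambda>\<mu>. (\<Gamma> \<alpha> y \<mu> $ i $ j - \<Gamma> \<alpha> y \<kappa> $ i $ j) / (\<mu> - \<kappa>)) \<longlongrightarrow> exp (- \<kappa> * norm (y i - y j)) / (4 * pi)) (at \<kappa>)"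
      using \<Gamma>_deriv[OF y, of \<alpha> i j \<kappa>] by (simp add: has_field_derivative_iff)
    then show ?thesis unfolding q_def
      by (rule filterlim_compose) (use mr m(1) in \<open>auto simp: filterlim_at\<close>)
  qed
  have "(\<lambda>n. \<Sum>i\<in>UNIV. \<Sum>j\<in>UNIV. e $ i * c (r n) $ j * q n i j) \<longlonglongrightarrow>
      (\<Sum>i\<in>UNIV. \<Sum>j\<in>UNIV. e $ i * e $ j * (exp (- \<kappa> * norm (y i - y j)) / (4 * pi)))"
    by (intro tendsto_intros q cr)
  \<comment> \<open>The form is mixed in \<open>e\<close> and \<open>c (r n)\<close> because one
    matrix annihilates \<open>c (r n)\<close> and the other, by symmetry, \<open>e\<close>.\<close>
  moreover have "(\<Sum>i\<in>UNIV. \<Sum>j\<in>UNIV. e $ i * c (r n) $ j * q n i j) = 0" for n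
  proof -
    have "(\<Sum>i\<in>UNIV. \<Sum>j\<in>UNIV. e $ i * c (r n) $ j * q n i j) =
      (e \<bullet> (\<Gamma> \<alpha> y (m (r n)) *v c (r n)) - e \<bullet> (\<Gamma> \<alpha> y \<kappa> *v c (r n))) / (m (r n) - \<kappa>)"
      by (simp add: q_def inner_vec_def matrix_vector_mult_def sum_distrib_left sum_subtractf[symmetric] sum_divide_distrib
          right_diff_distrib diff_divide_distrib ac_simps)
    also have "e \<bullet> (\<Gamma> \<alpha> y \<kappa> *v c (r n)) = c (r n) \<bullet> (\<Gamma> \<alpha> y \<kappa> *v e)" by (rule \<Gamma>_inner_commute)
    finally show ?thesis by (simp add: Ge c(2))
  qed
  ultimately have "(\<Sum>i\<in>UNIV. \<Sum>j\<in>UNIV. e $ i * e $ j * (exp (- \<kappa> * norm (y i - y j)) / (4 * pi))) = 0"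
    by (simp add: LIMSEQ_const_iff)
  moreover have "(\<Sum>i\<in>UNIV. \<Sum>j\<in>UNIV. e $ i * e $ j * (exp (- \<kappa> * norm (y i - y j)) / (4 * pi))) =
     (\<Sum>i\<in>UNIV. \<Sum>j\<in>UNIV. e $ i * e $ j * exp (- \<kappa> * norm (y i - y j))) / (4 * pi)"
    by (simp add: sum_divide_distrib)
  moreover have "e \<noteq> 0" using e(1) by auto
  ultimately show False using exp_norm_pos_def[OF y k, of e] by simp
qed

text \<open>The essential spectrum excludes nonnegative isolated points. Conversely a zero of the
  determinant gives an eigenvalue; its isolation is that of the zero, and its multiplicity is finite
  by comparison with a larger parameter.\<close>

lemma discrete_spectrum_nonempty_iff:
  fixes y :: "'n::finite \<Rightarrow> real ^ 3"
  assumes y: "inj y"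
  shows "discrete_spectrum (hamiltonian \<alpha> y) \<noteq> {} \<longleftrightarrow> (\<exists>\<kappa>>0. det (\<Gamma> \<alpha> y \<kappa>) = 0)"
proof
  assume "discrete_spectrum (hamiltonian \<alpha> y) \<noteq> {}"
  then obtain l where l: "l isolated_in spectrum (hamiltonian \<alpha> y)" "is_eigenvalue (hamiltonian \<alpha> y) l"
    by (auto simp: discrete_spectrum_def)
  have "l < 0"
  proof (rule ccontr)
    assume "\<not> l < 0"
    obtain \<mu> where m: "\<mu> > 0" "det (\<Gamma> \<alpha> y \<mu>) \<noteq> 0" using exists_det_nonzero by blast
    obtain \<delta> where \<delta>: "\<delta> > 0" "\<And>x. x \<in> spectrum (hamiltonian \<alpha> y) \<Longrightarrow> dist l x < \<delta> \<Longrightarrow> x = l"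
      using isolated_inE_dist[OF l(1)] by blast
    \<comment> \<open>Shifting to the right covers l = 0 as well: the shifted point is positive,
      hence in the spectrum, and too close to l.\<close>
    have "l + \<delta> / 2 \<in> spectrum (hamiltonian \<alpha> y)"
      by (rule nonneg_spectrum[OF y m]) (use \<open>\<not> l < 0\<close> \<delta>(1) in auto)
    from \<delta>(2)[OF this] \<delta>(1) show False by (simp add: dist_real_def)
  qed
  then have "sqrt (- l) > 0" "- (sqrt (- l))\<^sup>2 = l" by auto
  then show "\<exists>\<kappa>>0. det (\<Gamma> \<alpha> y \<kappa>) = 0"
    using eigenvalue_imp_det_zero[of \<alpha> y "sqrt (- l)"] l(2) by metis
next
  assume "\<exists>\<kappa>>0. det (\<Gamma> \<alpha> y \<kappa>) = 0"
  then obtain \<kappa> where k: "\<kappa> > 0" "det (\<Gamma> \<alpha> y \<kappa>) = 0" by blast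
  have ev: "is_eigenvalue (hamiltonian \<alpha> y) (- \<kappa>\<^sup>2)" by (rule eigenvalue_if_det_zero[OF y k])
  obtain \<mu> where m: "\<mu> > \<kappa>" "\<mu> > 0" "det (\<Gamma> \<alpha> y \<mu>) \<noteq> 0" using exists_det_nonzero by blast
  have "finite_multiplicity (hamiltonian \<alpha> y) (- \<kappa>\<^sup>2)"
    using finite_multiplicity_negative[OF y k(1) m(2) _ m(3)] m(1) by simp
  moreover have "- \<kappa>\<^sup>2 isolated_in spectrum (hamiltonian \<alpha> y)"
    unfolding isolated_in_altdef
  proof
    show "- \<kappa>\<^sup>2 \<in> spectrum (hamiltonian \<alpha> y)" by (rule eigenvalue_in_spectrum[OF ev])
    \<comment> \<open>Isolation is transported from the variable kappa to the energy l = -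
      kappa^2.\<close>
    have lim: "filterlim (\<lambda>l. sqrt (- l)) (at \<kappa>) (at (- \<kappa>\<^sup>2))"
      unfolding filterlim_at
    proof
      have "((\<lambda>l. sqrt (- l)) \<longlongrightarrow> sqrt (- (- \<kappa>\<^sup>2))) (at (- \<kappa>\<^sup>2))"
        by (intro tendsto_intros)
      then show "((\<lambda>l. sqrt (- l)) \<longlongrightarrow> \<kappa>) (at (- \<kappa>\<^sup>2))" using k by simp
      show "\<forall>\<^sub>F l in at (- \<kappa>\<^sup>2). sqrt (- l) \<in> UNIV \<and> sqrt (- l) \<noteq> \<kappa>"
        using eventually_neq_at_within[of "- \<kappa>\<^sup>2" "- \<kappa>\<^sup>2" UNIV]
        by eventually_elim (use k in \<open>auto simp: real_sqrt_eq_iff\<close>)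
    qed
    have neg: "\<forall>\<^sub>F l in at (- \<kappa>\<^sup>2). l < 0"
      using order_tendstoD(2)[OF tendsto_ident_at, of "- \<kappa>\<^sup>2" 0 UNIV] k by simp
    show "\<forall>\<^sub>F l in at (- \<kappa>\<^sup>2). l \<notin> spectrum (hamiltonian \<alpha> y)"
      using eventually_compose_filterlim[OF det_zero_isolated[OF y k] lim] neg
    proof eventually_elim
      case (elim l)
      then have "- (sqrt (- l))\<^sup>2 \<in> resolvent_set (hamiltonian \<alpha> y)"
        by (intro resolvent_set_if_det_nonzero[OF y]) auto
      then show ?case using elim by (simp add: spectrum_def)
    qed
  qed
  ultimately show "discrete_spectrum (hamiltonian \<alpha> y) \<noteq> {}"
    using ev by (auto simp: discrete_spectrum_def)
qed

text \<open>The couplings with a bound state form a nonempty set that is bounded above, closed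
  downwards and without maximum, hence an open half-line ending at its supremum. The lower bound 0
  makes the infimum in the final theorem an actual lower bound.\<close>

lemma \<alpha>_crit:
  fixes y :: "'n::finite \<Rightarrow> real ^ 3"
  assumes y: "inj y"
  shows "(\<exists>\<kappa>>0. det (\<Gamma> \<alpha> y \<kappa>) = 0) \<longleftrightarrow> \<alpha> < \<alpha>_crit y" and "0 \<le> \<alpha>_crit y"
proof -
  define A where "A = {\<alpha>. \<exists>\<kappa>>0. det (\<Gamma> \<alpha> y \<kappa>) = 0}"
  have AI: "\<alpha> \<in> A" if AI: "\<kappa> > 0" "c \<noteq> 0" "qf \<alpha> y \<kappa> c \<le> 0" for \<alpha> \<kappa> c
  proof -
    obtain K where K: "\<kappa> \<le> K" "det (\<Gamma> \<alpha> y K) = 0"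
      using ground_state[OF y AI] by blast
    have "0 < K" using AI(1) K(1) by linarith
    then show ?thesis using K(2) unfolding A_def by blast
  qed
  have down: "\<beta> \<in> A" if a: "\<alpha> \<in> A" "\<beta> \<le> \<alpha>" for \<alpha> \<beta>
  proof -
    obtain \<kappa> c where k: "\<kappa> > 0" "c \<noteq> 0" "\<Gamma> \<alpha> y \<kappa> *v c = 0" using a(1) by (auto simp: A_def det_eq_0_iff)
    have "qf \<alpha> y \<kappa> c = 0" using k(3) by (simp add: qf_def)
    then have "qf \<beta> y \<kappa> c = (\<beta> - \<alpha>) * (c \<bullet> c)" using \<Gamma>_shift[of \<alpha> "\<beta> - \<alpha>" y \<kappa> c] by simp
    also have "\<dots> \<le> 0" using a(2) by (intro mult_nonpos_nonneg) auto
    finally show ?thesis using AI k by blast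
  qed
  have up: "\<exists>\<beta>>\<alpha>. \<beta> \<in> A" if a: "\<alpha> \<in> A" for \<alpha>
  proof -
    obtain \<kappa> c where k: "\<kappa> > 0" "c \<noteq> 0" "\<Gamma> \<alpha> y \<kappa> *v c = 0" using a by (auto simp: A_def det_eq_0_iff)
    have "qf \<alpha> y \<kappa> c = 0" using k(3) by (simp add: qf_def)
    \<comment> \<open>Strict monotonicity leaves room at a smaller parameter: the form is negative
      there and can absorb a slightly larger coupling.\<close>
    then have neg: "qf \<alpha> y (\<kappa> / 2) c < 0" using qf_strict_mono[OF y, of "\<kappa> / 2" \<kappa> c \<alpha>] k by simp
    define t where "t = - qf \<alpha> y (\<kappa> / 2) c / (c \<bullet> c)"
    have "t > 0" using neg k(2) by (simp add: t_def divide_neg_pos)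
    moreover have "\<alpha> + t \<in> A"
    proof (rule AI)
      show "0 < \<kappa> / 2" "c \<noteq> 0" using k by auto
      have "t * (c \<bullet> c) = - qf \<alpha> y (\<kappa> / 2) c" using k(2) by (simp add: t_def)
      then show "qf (\<alpha> + t) y (\<kappa> / 2) c \<le> 0" by (simp add: \<Gamma>_shift)
    qed
    ultimately show ?thesis by (intro exI[of _ "\<alpha> + t"]) simp
  qed
  have neg: "\<alpha> \<in> A" if "\<alpha> < 0" for \<alpha>
  proof -
    \<comment> \<open>A single centre: on a unit coordinate vector the form is alpha + kappa / (4
      pi), which vanishes at kappa = - 4 pi alpha.\<close>
    let ?c = "axis undefined 1 :: real ^ 'n"
    have "qf \<alpha> y (- 4 * pi * \<alpha>) ?c = 0"
      by (simp add: qf_def matrix_vector_mult_basis inner_axis' column_def \<Gamma>_def)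
    moreover have "?c \<noteq> 0" by (simp add: axis_eq_0_iff)
    moreover have "0 < - 4 * pi * \<alpha>" using that by (simp add: mult_pos_neg)
    ultimately show ?thesis by (intro AI[of "- 4 * pi * \<alpha>" ?c]) simp_all
  qed
  have bdd: "\<alpha> \<le> coulomb_sum y" if a: "\<alpha> \<in> A" for \<alpha>
  proof (rule ccontr)
    assume n: "\<not> \<alpha> \<le> coulomb_sum y"
    obtain \<kappa> c where k: "\<kappa> > 0" "c \<noteq> 0" "\<Gamma> \<alpha> y \<kappa> *v c = 0" using a by (auto simp: A_def det_eq_0_iff)
    have "0 < (\<alpha> + \<kappa> / (4 * pi) - coulomb_sum y) * (c \<bullet> c)"
    proof (rule mult_pos_pos)
      have "0 < \<kappa> / (4 * pi)" using k by simp
      then show "0 < \<alpha> + \<kappa> / (4 * pi) - coulomb_sum y" using n by linarith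
    qed (use k in simp)
    then show False using qf_lower_bound[OF k(1), of \<alpha> y c] k(3) by (simp add: qf_def)
  qed
  have ne: "A \<noteq> {}" using neg[of "-1"] by auto
  have bA: "bdd_above A" using bdd by (auto simp: bdd_above_def)
  have A: "\<alpha> \<in> A \<longleftrightarrow> \<alpha> < Sup A" for \<alpha>
  proof
    assume "\<alpha> \<in> A"
    then obtain \<beta> where "\<beta> > \<alpha>" "\<beta> \<in> A" using up by blast
    then show "\<alpha> < Sup A" using cSup_upper[OF _ bA] by (meson less_le_trans)
  next
    assume "\<alpha> < Sup A"
    then obtain \<beta> where "\<beta> \<in> A" "\<alpha> < \<beta>" using less_cSup_iff[OF ne bA] by blast
    then show "\<alpha> \<in> A" using down by (meson less_imp_le)
  qed
  have dA: "discrete_spectrum (hamiltonian \<alpha> y) \<noteq> {} \<longleftrightarrow> \<alpha> < Sup A" for \<alpha>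
    unfolding discrete_spectrum_nonempty_iff[OF y] A[symmetric] by (simp add: A_def)
  \<comment> \<open>A real number is determined by the numbers strictly below it, so the description
    has a unique solution.\<close>
  have crit: "\<alpha>_crit y = Sup A"
    unfolding \<alpha>_crit_def
  proof (rule the_equality)
    show "\<forall>\<alpha>. (discrete_spectrum (hamiltonian \<alpha> y) \<noteq> {}) = (\<alpha> < Sup A)"
      using dA by blast
    fix a assume "\<forall>\<alpha>. (discrete_spectrum (hamiltonian \<alpha> y) \<noteq> {}) = (\<alpha> < a)"
    then have "\<alpha> < a \<longleftrightarrow> \<alpha> < Sup A" for \<alpha>
      using dA by blast
    then show "a = Sup A" by (metis less_irrefl linorder_neqE)
  qed
  show "(\<exists>\<kappa>>0. det (\<Gamma> \<alpha> y \<kappa>) = 0) \<longleftrightarrow> \<alpha> < \<alpha>_crit y"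
    unfolding crit A[symmetric] by (simp add: A_def)
  show "0 \<le> \<alpha>_crit y"
  proof (rule ccontr)
    assume "\<not> 0 \<le> \<alpha>_crit y"
    then have "Sup A / 2 \<in> A" by (intro neg) (simp add: crit)
    then have "Sup A / 2 < Sup A" by (simp only: A)
    then show False using \<open>\<not> 0 \<le> \<alpha>_crit y\<close> by (simp add: crit)
  qed
qed

lemma lambda1_eq:
  fixes y :: "'n::finite \<Rightarrow> real ^ 3"
  assumes y: "inj y" and "0 < K" "det (\<Gamma> \<alpha> y K) = 0"
    and above: "\<And>\<mu> d. K < \<mu> \<Longrightarrow> d \<noteq> 0 \<Longrightarrow> 0 < qf \<alpha> y \<mu> d"
  shows "lambda1 \<alpha> y = - K\<^sup>2"
  unfolding lambda1_def
proof (rule Least_equality)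
  show "is_eigenvalue (hamiltonian \<alpha> y) (- K\<^sup>2)" by (rule eigenvalue_if_det_zero) fact+
  fix l assume l: "is_eigenvalue (hamiltonian \<alpha> y) l"
  show "- K\<^sup>2 \<le> l"
  proof (rule ccontr)
    assume "\<not> - K\<^sup>2 \<le> l"
    then have lK: "K\<^sup>2 < - l" by simp
    then have l0: "l < 0" by (smt (verit) zero_le_power2)
    have "K < sqrt (- l)" using lK assms(2) by (simp add: real_less_rsqrt)
    then have "det (\<Gamma> \<alpha> y (sqrt (- l))) \<noteq> 0" using above qf_pos_imp_det_nonzero by blast
    then show False using eigenvalue_imp_det_zero[of \<alpha> y "sqrt (- l)"] l l0 by simp
  qed
qed

section \<open>Interpolation of powers\<close>

text \<open>The polynomial substitute for absolute monotonicity on the half-line x >= 0.\<close>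

definition nonneg_poly :: "real poly \<Rightarrow> bool" where
  "nonneg_poly p \<longleftrightarrow> (\<forall>i. 0 \<le> coeff p i)"

lemma nonneg_poly_pCons: "nonneg_poly (pCons a p) \<longleftrightarrow> 0 \<le> a \<and> nonneg_poly p"
  unfolding nonneg_poly_def by (auto simp: coeff_pCons split: nat.splits)

lemma poly_nonneg:
  assumes "nonneg_poly p" "0 \<le> x"
  shows "0 \<le> poly p x"
  using assms(1) by (induction p) (auto simp: nonneg_poly_pCons assms(2))

text \<open>The coefficients of the quotient are the values at \<open>c\<close> of the tails of the
  coefficient list, so they are nonnegative. In terms of functions: divided differences of an
  absolutely monotone function are absolutely monotone.\<close>

lemma nonneg_poly_synthetic_div:
  assumes "nonneg_poly p" "0 \<le> c"
  shows "nonneg_poly (synthetic_div p c)"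
  using assms(1)
proof (induction p)
  case (pCons a p)
  then show ?case by (auto simp: nonneg_poly_pCons poly_nonneg assms(2))
qed (simp add: nonneg_poly_def)

lemma nonneg_poly_newton_step:
  assumes "nonneg_poly p" "0 \<le> c"
  obtains b q where "0 \<le> b" "nonneg_poly q" "\<And>x. poly p x = b + (x - c) * poly q x"
proof (rule that[of "poly p c" "synthetic_div p c"])
  show "poly p x = poly p c + (x - c) * poly (synthetic_div p c) x" for x
    using arg_cong[OF synthetic_div_correct'[of c p], of "\<lambda>p. poly p x"] by (simp add: algebra_simps)
qed (use assms poly_nonneg nonneg_poly_synthetic_div in auto)

text \<open>Hermite interpolation at a double node. The constant term contributes equally for all
  configurations, so no sign is recorded for it.\<close>

lemma power_newton_simplex:
  fixes a :: real
  assumes "0 \<le> a"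
  obtains b0 b1 q where "0 \<le> b1" "nonneg_poly q"
    "\<And>x. x ^ n = b0 + b1 * (x - a) + poly q x * (x - a)\<^sup>2"
proof -
  have "nonneg_poly (monom 1 n)" by (simp add: nonneg_poly_def)
  from nonneg_poly_newton_step[OF this assms] obtain b0 q0 where
    0: "nonneg_poly q0" "\<And>x. poly (monom 1 n) x = b0 + (x - a) * poly q0 x" by metis
  from nonneg_poly_newton_step[OF 0(1) assms] obtain b1 q1 where
    1: "0 \<le> b1" "nonneg_poly q1" "\<And>x. poly q0 x = b1 + (x - a) * poly q1 x" by metis
  have "x ^ n = b0 + b1 * (x - a) + poly q1 x * (x - a)\<^sup>2" for x
    using 0(2)[of x] by (simp add: poly_monom 1(3) algebra_simps power2_eq_square)
  then show ?thesis using that 1 by blast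
qed

text \<open>The nodes are x = 0, simple, and x = 1, double; they correspond to the inner products -1
  and 0.\<close>

lemma power_newton_octahedron:
  obtains b0 b1 b2 :: real and q where "0 \<le> b1" "0 \<le> b2" "nonneg_poly q"
    "\<And>x. x ^ n = b0 + b1 * x + b2 * (x * (x - 1)) + poly q x * (x * (x - 1)\<^sup>2)"
proof -
  have "nonneg_poly (monom 1 n)" by (simp add: nonneg_poly_def)
  from nonneg_poly_newton_step[OF this, of 0] obtain b0 q0 where
    0: "nonneg_poly q0" "\<And>x. poly (monom 1 n) x = b0 + (x - 0) * poly q0 x" by (metis order_refl)
  from nonneg_poly_newton_step[OF 0(1), of 1] obtain b1 q1 where
    1: "0 \<le> b1" "nonneg_poly q1" "\<And>x. poly q0 x = b1 + (x - 1) * poly q1 x" by (metis zero_le_one)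
  from nonneg_poly_newton_step[OF 1(2), of 1] obtain b2 q2 where
    2: "0 \<le> b2" "nonneg_poly q2" "\<And>x. poly q1 x = b2 + (x - 1) * poly q2 x" by (metis zero_le_one)
  have "x ^ n = b0 + b1 * x + b2 * (x * (x - 1)) + poly q2 x * (x * (x - 1)\<^sup>2)" for x
    using 0(2)[of x] by (simp add: poly_monom 1(3) 2(3) algebra_simps power2_eq_square)
  then show ?thesis using that 1 2 by blast
qed

text \<open>The nodes are 0, simple, and \<open>a\<close>, \<open>b\<close>, both double. The order
  of the nodes makes the last Newton polynomial x (x - a)^2 (x - b), of degree four.\<close>

lemma power_newton_icosahedron:
  fixes a b :: real
  assumes "0 \<le> a" "0 \<le> b"
  obtains b0 b1 b2 b3 b4 :: real and q where "0 \<le> b1" "0 \<le> b2" "0 \<le> b3" "0 \<le> b4" "nonneg_poly q"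
    "\<And>x. x ^ n = b0 + b1 * x + b2 * (x * (x - a)) + b3 * (x * (x - a)\<^sup>2) + b4 * (x * (x - a)\<^sup>2 * (x - b))
      + poly q x * (x * (x - a)\<^sup>2 * (x - b)\<^sup>2)"
proof -
  have "nonneg_poly (monom 1 n)" by (simp add: nonneg_poly_def)
  from nonneg_poly_newton_step[OF this, of 0] obtain b0 q0 where
    0: "nonneg_poly q0" "\<And>x. poly (monom 1 n) x = b0 + (x - 0) * poly q0 x" by (metis order_refl)
  from nonneg_poly_newton_step[OF 0(1) assms(1)] obtain b1 q1 where
    1: "0 \<le> b1" "nonneg_poly q1" "\<And>x. poly q0 x = b1 + (x - a) * poly q1 x" by metis
  from nonneg_poly_newton_step[OF 1(2) assms(1)] obtain b2 q2 where
    2: "0 \<le> b2" "nonneg_poly q2" "\<And>x. poly q1 x = b2 + (x - a) * poly q2 x" by metis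
  from nonneg_poly_newton_step[OF 2(2) assms(2)] obtain b3 q3 where
    3: "0 \<le> b3" "nonneg_poly q3" "\<And>x. poly q2 x = b3 + (x - b) * poly q3 x" by metis
  from nonneg_poly_newton_step[OF 3(2) assms(2)] obtain b4 q4 where
    4: "0 \<le> b4" "nonneg_poly q4" "\<And>x. poly q3 x = b4 + (x - b) * poly q4 x" by metis
  have "x ^ n = b0 + b1 * x + b2 * (x * (x - a)) + b3 * (x * (x - a)\<^sup>2) + b4 * (x * (x - a)\<^sup>2 * (x - b))
      + poly q4 x * (x * (x - a)\<^sup>2 * (x - b)\<^sup>2)" for x
    using 0(2)[of x] unfolding poly_monom 1(3) 2(3) 3(3) 4(3)
    by (simp add: power2_eq_square ring_distribs ac_simps)
  then show ?thesis using that 1 2 3 4 by blast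
qed

section \<open>Power sums of the Gram matrix\<close>

definition pow_sum :: "nat \<Rightarrow> ('n::finite \<Rightarrow> real ^ 3) \<Rightarrow> real" where
  "pow_sum k y = (\<Sum>i\<in>UNIV. \<Sum>j\<in>UNIV. (y i \<bullet> y j) ^ k)"

lemma sum_product_sq: "(\<Sum>i\<in>A. \<Sum>j\<in>A. f i * f j) = (\<Sum>i\<in>A. f i)\<^sup>2" for f :: "'a \<Rightarrow> real"
  by (simp add: power2_eq_square sum_product)

lemma pow_sum_1: "pow_sum 1 y = (norm (\<Sum>i\<in>UNIV. y i))\<^sup>2"
  by (simp add: pow_sum_def power2_norm_eq_inner inner_sum_left inner_sum_right, rule sum.swap)

lemma pow_sum_1_nonneg: "0 \<le> pow_sum 1 y"
  unfolding pow_sum_1 by simp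

lemma inner_3: "x \<bullet> y = x $ 1 * y $ 1 + x $ 2 * y $ 2 + x $ 3 * y $ 3" for x y :: "real ^ 3"
  by (simp add: inner_vec_def sum_3)

text \<open>
  The trace-free part of \<open>x x\<^sup>T\<close>, i.e. the degree-two spherical harmonics.
\<close>

definition traceless :: "real ^ 3 \<Rightarrow> 3 \<Rightarrow> 3 \<Rightarrow> real" where
  "traceless x a b = x $ a * x $ b - (if a = b then 1 / 3 else 0)"

text \<open>Addition formula in degree two: the kernel is 2/3 of the Legendre polynomial P_2. For
  general vectors the two sides differ by (2 - |x|^2 - |z|^2) / 3.\<close>

lemma traceless_inner:
  assumes "norm x = 1" "norm z = 1"
  shows "(\<Sum>a\<in>UNIV. \<Sum>b\<in>UNIV. traceless x a b * traceless z a b) = (x \<bullet> z)\<^sup>2 - 1 / 3"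
proof -
  have "x \<bullet> x = 1" "z \<bullet> z = 1" using assms by (simp_all add: power2_norm_eq_inner[symmetric])
  then have x: "x $ 3 * x $ 3 = 1 - x $ 1 * x $ 1 - x $ 2 * x $ 2" and z: "z $ 3 * z $ 3 = 1 - z $ 1 * z $ 1 - z $ 2 * z $ 2"
    by (simp_all add: inner_3)
  have "(\<Sum>a\<in>UNIV. \<Sum>b\<in>UNIV. traceless x a b * traceless z a b) - ((x \<bullet> z)\<^sup>2 - 1 / 3) =
    (2 - (x $ 1 * x $ 1 + x $ 2 * x $ 2 + x $ 3 * x $ 3) - (z $ 1 * z $ 1 + z $ 2 * z $ 2 + z $ 3 * z $ 3)) / 3"
    by (simp add: traceless_def sum_3 inner_3 power2_eq_square algebra_simps)
  then show ?thesis unfolding x z by simp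
qed

text \<open>A kernel given as an inner product of feature vectors has as its energy the squared
  length of the summed features.\<close>

lemma sum_kernel_nonneg:
  fixes F :: "'k \<Rightarrow> 'n \<Rightarrow> real"
  shows "(\<Sum>i\<in>A. \<Sum>j\<in>A. \<Sum>k\<in>K. F k i * F k j) = (\<Sum>k\<in>K. (\<Sum>i\<in>A. F k i)\<^sup>2)"
proof -
  have "(\<Sum>i\<in>A. \<Sum>j\<in>A. \<Sum>k\<in>K. F k i * F k j) = (\<Sum>i\<in>A. \<Sum>k\<in>K. \<Sum>j\<in>A. F k i * F k j)"
    by (intro sum.cong refl sum.swap)
  also have "\<dots> = (\<Sum>k\<in>K. \<Sum>i\<in>A. \<Sum>j\<in>A. F k i * F k j)"
    by (rule sum.swap)
  finally show ?thesis by (simp add: sum_product_sq)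
qed

lemma pow_sum_2:
  fixes y :: "'n::finite \<Rightarrow> real ^ 3"
  assumes "\<And>i. norm (y i) = 1"
  shows "pow_sum 2 y - (real CARD('n))\<^sup>2 / 3 = (\<Sum>(a, b)\<in>UNIV. (\<Sum>i\<in>UNIV. traceless (y i) a b)\<^sup>2)"
proof -
  have "pow_sum 2 y - (real CARD('n))\<^sup>2 / 3 = (\<Sum>i\<in>UNIV. \<Sum>j\<in>UNIV. (y i \<bullet> y j)\<^sup>2 - 1 / 3)"
    by (simp add: pow_sum_def sum_subtractf power2_eq_square)
  also have "\<dots> = (\<Sum>i\<in>UNIV. \<Sum>j\<in>UNIV. \<Sum>p\<in>UNIV. traceless (y i) (fst p) (snd p) * traceless (y j) (fst p) (snd p))"
    using traceless_inner[OF assms assms, symmetric]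
    by (simp add: sum.cartesian_product case_prod_beta)
  also have "\<dots> = (\<Sum>p\<in>UNIV. (\<Sum>i\<in>UNIV. traceless (y i) (fst p) (snd p))\<^sup>2)"
    by (rule sum_kernel_nonneg)
  finally show ?thesis by (simp add: case_prod_beta)
qed

lemma pow_sum_2_ge:
  fixes y :: "'n::finite \<Rightarrow> real ^ 3"
  assumes "\<And>i. norm (y i) = 1"
  shows "(real CARD('n))\<^sup>2 / 3 \<le> pow_sum 2 y"
proof -
  have "0 \<le> (\<Sum>(a, b)\<in>UNIV. (\<Sum>i\<in>UNIV. traceless (y i) a b)\<^sup>2)"
    by (auto intro!: sum_nonneg)
  then show ?thesis using pow_sum_2[of y, OF assms] by linarith
qed

text \<open>Equality in the second-moment bound forces the summed traceless tensor to vanish, i.e.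
  the sum of the matrices y y^T is N/3 times the identity: the points form a tight frame.\<close>

lemma frame_identity:
  fixes y :: "'n::finite \<Rightarrow> real ^ 3"
  assumes "\<And>i. norm (y i) = 1" and eq: "pow_sum 2 y = (real CARD('n))\<^sup>2 / 3"
  shows "(\<Sum>i\<in>UNIV. (x \<bullet> y i) * (z \<bullet> y i)) = real CARD('n) / 3 * (x \<bullet> z)"
proof -
  have "(\<Sum>(a, b)\<in>UNIV. (\<Sum>i\<in>UNIV. traceless (y i) a b)\<^sup>2) = 0"
    using pow_sum_2[of y, OF assms(1)] eq by simp
  then have "\<forall>p\<in>UNIV. (case p of (a, b) \<Rightarrow> (\<Sum>i\<in>UNIV. traceless (y i) a b)\<^sup>2) = 0"
    by (subst (asm) sum_nonneg_eq_0_iff) auto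
  then have "(\<Sum>i\<in>UNIV. traceless (y i) a b) = 0" for a b by auto
  then have m: "(\<Sum>i\<in>UNIV. y i $ a * y i $ b) = real CARD('n) * (if a = b then 1 / 3 else 0)" for a b
    by (simp add: traceless_def sum_subtractf)
  have "(\<Sum>i\<in>UNIV. (x \<bullet> y i) * (z \<bullet> y i)) = (\<Sum>i\<in>UNIV. \<Sum>a\<in>UNIV. \<Sum>b\<in>UNIV. x $ a * z $ b * (y i $ a * y i $ b))"
    by (simp add: inner_vec_def sum_product ac_simps)
  also have "\<dots> = (\<Sum>a\<in>UNIV. \<Sum>b\<in>UNIV. \<Sum>i\<in>UNIV. x $ a * z $ b * (y i $ a * y i $ b))"
    by (subst sum.swap, intro sum.cong refl, subst sum.swap) simp
  also have "\<dots> = (\<Sum>a\<in>UNIV. \<Sum>b\<in>UNIV. x $ a * z $ b * (\<Sum>i\<in>UNIV. y i $ a * y i $ b))"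
    by (simp add: sum_distrib_left)
  also have "\<dots> = real CARD('n) / 3 * (x \<bullet> z)"
    unfolding m by (simp add: inner_vec_def sum_3 algebra_simps)
  finally show ?thesis .
qed

text \<open>The kernel t^3 - t/3 is the product of the positive kernels t^2 - 1/3 and t, with the
  products of their features as features. The Legendre polynomial P_3 would give 3/5 in place of
  1/3, but 1/3 suffices for the icosahedron.\<close>

lemma pow_sum_3_ge:
  fixes y :: "'n::finite \<Rightarrow> real ^ 3"
  assumes "\<And>i. norm (y i) = 1"
  shows "pow_sum 1 y / 3 \<le> pow_sum 3 y"
proof -
  have "pow_sum 3 y - pow_sum 1 y / 3 = (\<Sum>i\<in>UNIV. \<Sum>j\<in>UNIV. ((y i \<bullet> y j)\<^sup>2 - 1 / 3) * (y i \<bullet> y j))"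
    by (simp add: pow_sum_def sum_subtractf left_diff_distrib power2_eq_square power3_eq_cube sum_divide_distrib)
  also have "\<dots> = (\<Sum>i\<in>UNIV. \<Sum>j\<in>UNIV. \<Sum>p\<in>UNIV.
      (traceless (y i) (fst (fst p)) (snd (fst p)) * y i $ snd p) * (traceless (y j) (fst (fst p)) (snd (fst p)) * y j $ snd p))"
  proof (intro sum.cong refl)
    fix i j
    have "((y i \<bullet> y j)\<^sup>2 - 1 / 3) * (y i \<bullet> y j) =
      (\<Sum>q\<in>UNIV. traceless (y i) (fst q) (snd q) * traceless (y j) (fst q) (snd q)) * (\<Sum>c\<in>UNIV. y i $ c * y j $ c)"
      using traceless_inner[OF assms assms, of i j, symmetric]
      by (simp add: sum.cartesian_product case_prod_beta inner_vec_def)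
    then show "((y i \<bullet> y j)\<^sup>2 - 1 / 3) * (y i \<bullet> y j) = (\<Sum>p\<in>UNIV.
      (traceless (y i) (fst (fst p)) (snd (fst p)) * y i $ snd p) * (traceless (y j) (fst (fst p)) (snd (fst p)) * y j $ snd p))"
      unfolding sum_product sum.cartesian_product UNIV_Times_UNIV case_prod_beta
      by (simp only: mult.assoc mult.commute mult.left_commute)
  qed
  also have "\<dots> = (\<Sum>p\<in>UNIV. (\<Sum>i\<in>UNIV. traceless (y i) (fst (fst p)) (snd (fst p)) * y i $ snd p)\<^sup>2)"
    by (rule sum_kernel_nonneg)
  also have "\<dots> \<ge> 0" by (auto intro!: sum_nonneg)
  finally show ?thesis by simp
qed

text \<open>The multinomial expansion writes the sum as a weighted sum of squares of the fourth
  moments \<open>S\<close>. Only the six moments with even exponents are kept; they are tied by the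
  linear relation |y|^4 = 1 summed over the points, and the quadratic form is minimised under
  it.\<close>

lemma pow_sum_4_ge:
  fixes y :: "'n::finite \<Rightarrow> real ^ 3"
  assumes n: "\<And>i. norm (y i) = 1"
  shows "(real CARD('n))\<^sup>2 / 5 \<le> pow_sum 4 y"
proof -
  define S where "S a b c = (\<Sum>i\<in>UNIV. y i $ 1 ^ a * y i $ 2 ^ b * y i $ 3 ^ c)" for a b c
  have SS: "(\<Sum>i\<in>UNIV. \<Sum>j\<in>UNIV. (y i $ 1 ^ a * y i $ 2 ^ b * y i $ 3 ^ c) * (y j $ 1 ^ a * y j $ 2 ^ b * y j $ 3 ^ c)) = (S a b c)\<^sup>2" for a b c
    unfolding S_def by (rule sum_product_sq)
  have SSw: "(\<Sum>i\<in>UNIV. \<Sum>j\<in>UNIV. w * ((y i $ 1 ^ a * y i $ 2 ^ b * y i $ 3 ^ c) * (y j $ 1 ^ a * y j $ 2 ^ b * y j $ 3 ^ c))) = w * (S a b c)\<^sup>2" for w a b c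
    unfolding SS[symmetric] sum_distrib_left ..
  let ?T = "\<lambda>a b c i j. (y i $ 1 ^ a * y i $ 2 ^ b * y i $ 3 ^ c) * (y j $ 1 ^ a * y j $ 2 ^ b * y j $ 3 ^ c)"
  have "(y i \<bullet> y j) ^ 4 = ?T 4 0 0 i j + ?T 0 4 0 i j + ?T 0 0 4 i j + 6 * ?T 2 2 0 i j + 6 * ?T 2 0 2 i j + 6 * ?T 0 2 2 i j
      + 4 * ?T 3 1 0 i j + 4 * ?T 3 0 1 i j + 4 * ?T 1 3 0 i j + 4 * ?T 0 3 1 i j + 4 * ?T 1 0 3 i j + 4 * ?T 0 1 3 i j
      + 12 * ?T 2 1 1 i j + 12 * ?T 1 2 1 i j + 12 * ?T 1 1 2 i j" for i j
    by (simp add: inner_3 power4_eq_xxxx power3_eq_cube power2_eq_square algebra_simps)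
  then have "pow_sum 4 y = (S 4 0 0)\<^sup>2 + (S 0 4 0)\<^sup>2 + (S 0 0 4)\<^sup>2 + 6 * (S 2 2 0)\<^sup>2 + 6 * (S 2 0 2)\<^sup>2 + 6 * (S 0 2 2)\<^sup>2
     + 4 * (S 3 1 0)\<^sup>2 + 4 * (S 3 0 1)\<^sup>2 + 4 * (S 1 3 0)\<^sup>2 + 4 * (S 0 3 1)\<^sup>2 + 4 * (S 1 0 3)\<^sup>2 + 4 * (S 0 1 3)\<^sup>2
     + 12 * (S 2 1 1)\<^sup>2 + 12 * (S 1 2 1)\<^sup>2 + 12 * (S 1 1 2)\<^sup>2"
    by (simp only: pow_sum_def sum.distrib SS SSw)
  then have le: "(S 4 0 0)\<^sup>2 + (S 0 4 0)\<^sup>2 + (S 0 0 4)\<^sup>2 + 6 * (S 2 2 0)\<^sup>2 + 6 * (S 2 0 2)\<^sup>2 + 6 * (S 0 2 2)\<^sup>2 \<le> pow_sum 4 y"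
    by simp
  define N where "N = real CARD('n)"
  have "((y i \<bullet> y i)\<^sup>2 :: real) = 1" for i using n[of i] by (simp add: power2_norm_eq_inner[symmetric])
  then have "N = (\<Sum>i\<in>UNIV. (y i \<bullet> y i)\<^sup>2)" by (simp add: N_def)
  also have "\<dots> = S 4 0 0 + S 0 4 0 + S 0 0 4 + 2 * S 2 2 0 + 2 * S 2 0 2 + 2 * S 0 2 2"
    unfolding S_def sum_distrib_left sum.distrib[symmetric]
    by (intro sum.cong refl) (simp add: inner_3 power4_eq_xxxx power2_eq_square algebra_simps)
  finally have N: "S 4 0 0 + S 0 4 0 + S 0 0 4 + 2 * S 2 2 0 + 2 * S 2 0 2 + 2 * S 0 2 2 = N" by simp
  have "N\<^sup>2 / 5 \<le> A\<^sup>2 + B\<^sup>2 + C\<^sup>2 + 6 * D\<^sup>2 + 6 * E\<^sup>2 + 6 * F\<^sup>2"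
    if "A + B + C + 2 * D + 2 * E + 2 * F = N" for A B C D E F :: real
  proof -
    \<comment> \<open>N/5 and N/15 are the fourth moments of the uniform distribution on the sphere
      with total mass N, the minimiser under the constraint.\<close>
    have "(A - N / 5)\<^sup>2 + (B - N / 5)\<^sup>2 + (C - N / 5)\<^sup>2 + 6 * (D - N / 15)\<^sup>2 + 6 * (E - N / 15)\<^sup>2 + 6 * (F - N / 15)\<^sup>2
      = A\<^sup>2 + B\<^sup>2 + C\<^sup>2 + 6 * D\<^sup>2 + 6 * E\<^sup>2 + 6 * F\<^sup>2 + N\<^sup>2 / 5 - 2 / 5 * N * (A + B + C + 2 * D + 2 * E + 2 * F)"
      by (simp add: power2_diff power_divide) (simp add: power2_eq_square algebra_simps)
    then have "(A - N / 5)\<^sup>2 + (B - N / 5)\<^sup>2 + (C - N / 5)\<^sup>2 + 6 * (D - N / 15)\<^sup>2 + 6 * (E - N / 15)\<^sup>2 + 6 * (F - N / 15)\<^sup>2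
      = A\<^sup>2 + B\<^sup>2 + C\<^sup>2 + 6 * D\<^sup>2 + 6 * E\<^sup>2 + 6 * F\<^sup>2 - N\<^sup>2 / 5"
      unfolding that by (simp add: power2_eq_square)
    moreover have "0 \<le> (A - N / 5)\<^sup>2 + (B - N / 5)\<^sup>2 + (C - N / 5)\<^sup>2 + 6 * (D - N / 15)\<^sup>2 + 6 * (E - N / 15)\<^sup>2 + 6 * (F - N / 15)\<^sup>2"
      by (intro add_nonneg_nonneg mult_nonneg_nonneg zero_le_power2) auto
    ultimately show ?thesis by linarith
  qed
  from this[OF N]
  show ?thesis using le by (simp add: N_def)
qed

section \<open>Energies\<close>

definition offdiag :: "('n \<times> 'n) set" where
  "offdiag = {p. fst p \<noteq> snd p}"

lemma sum_offdiag:
  fixes f :: "'n::finite \<Rightarrow> 'n \<Rightarrow> real"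
  shows "(\<Sum>p\<in>offdiag. f (fst p) (snd p)) = (\<Sum>i\<in>UNIV. \<Sum>j\<in>UNIV. f i j) - (\<Sum>i\<in>UNIV. f i i)"
proof -
  have "(\<Sum>i\<in>UNIV. \<Sum>j\<in>UNIV. f i j) = (\<Sum>p\<in>UNIV. f (fst p) (snd p))"
    by (simp add: sum.cartesian_product case_prod_beta)
  also have "\<dots> = (\<Sum>p\<in>offdiag. f (fst p) (snd p)) + (\<Sum>p\<in>range (\<lambda>i. (i, i)). f (fst p) (snd p))"
    by (subst sum.union_disjoint[symmetric]) (auto simp: offdiag_def intro!: sum.cong)
  also have "(\<Sum>p\<in>range (\<lambda>i. (i, i)). f (fst p) (snd p)) = (\<Sum>i\<in>UNIV. f i i)"
    by (subst sum.reindex) (auto simp: inj_on_def)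
  finally show ?thesis by simp
qed

lemma sum_offdiag_rows:
  fixes f :: "'n::finite \<Rightarrow> 'n \<Rightarrow> real"
  shows "(\<Sum>p\<in>offdiag. f (fst p) (snd p)) = (\<Sum>i\<in>UNIV. \<Sum>j\<in>UNIV - {i}. f i j)"
  by (simp add: sum_offdiag sum_subtractf[symmetric] sum_diff1)

abbreviation off_inner :: "('n \<Rightarrow> real ^ 3) \<Rightarrow> 'n \<times> 'n \<Rightarrow> real" where
  "off_inner y p \<equiv> y (fst p) \<bullet> y (snd p)"

lemma sum_offdiag_inner_power:
  fixes y :: "'n::finite \<Rightarrow> real ^ 3"
  assumes "\<And>i. norm (y i) = 1"
  shows "(\<Sum>p\<in>offdiag. off_inner y p ^ k) = pow_sum k y - real CARD('n)"
  using assms by (simp add: sum_offdiag[of "\<lambda>i j. (y i \<bullet> y j) ^ k"] pow_sum_def power2_norm_eq_inner[symmetric])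

lemma sum_offdiag_const: "(\<Sum>p\<in>(offdiag :: ('n::finite \<times> 'n) set). c) = c * ((real CARD('n))\<^sup>2 - real CARD('n))"
  using sum_offdiag[of "\<lambda>i j :: 'n. c"] by (simp add: power2_eq_square algebra_simps)

lemma sum_offdiag_quartic:
  fixes y :: "'n::finite \<Rightarrow> real ^ 3"
  assumes "\<And>i. norm (y i) = 1"
  defines "N \<equiv> real CARD('n)"
  shows "(\<Sum>p\<in>offdiag. c4 * off_inner y p ^ 4 + c3 * off_inner y p ^ 3 + c2 * off_inner y p ^ 2 + c1 * off_inner y p + c0) =
    c4 * (pow_sum 4 y - N) + c3 * (pow_sum 3 y - N) + c2 * (pow_sum 2 y - N) + c1 * (pow_sum 1 y - N) + c0 * (N\<^sup>2 - N)"
proof -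
  have 1: "(\<Sum>p\<in>offdiag. off_inner y p) = pow_sum 1 y - N"
    using sum_offdiag_inner_power[of y 1, OF assms(1)] by (simp add: N_def)
  show ?thesis
    unfolding sum.distrib sum_distrib_left[symmetric] sum_offdiag_inner_power[of y, OF assms(1)] sum_offdiag_const 1
    unfolding N_def ..
qed

definition power_energy :: "nat \<Rightarrow> ('n::finite \<Rightarrow> real ^ 3) \<Rightarrow> real" where
  "power_energy n y = (\<Sum>p\<in>offdiag. (1 + off_inner y p) ^ n)"

text \<open>
  The only properties of the symmetric configurations that the energy estimates need; they also
  characterise these configurations up to congruence.
\<close>

definition sharp :: "('n::finite \<Rightarrow> real ^ 3) \<Rightarrow> bool" where
  "sharp y \<longleftrightarrow> (\<forall>i. norm (y i) = 1) \<and>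
    (CARD('n) \<in> {2, 3, 4} \<and> (\<forall>i j. i \<noteq> j \<longrightarrow> y i \<bullet> y j = - 1 / (real CARD('n) - 1)) \<or>
     CARD('n) = 6 \<and> (\<forall>i j. i \<noteq> j \<longrightarrow> y i \<bullet> y j \<in> {-1, 0}) \<and> pow_sum 1 y = 0 \<and> pow_sum 2 y = 12 \<or>
     CARD('n) = 12 \<and> (\<forall>i j. i \<noteq> j \<longrightarrow> y i \<bullet> y j \<in> {-1, 1 / sqrt 5, - 1 / sqrt 5}) \<and> pow_sum 1 y = 0 \<and> pow_sum 2 y = 48)"

lemma inner_ge_minus_1:
  fixes a b :: "real ^ 3"
  assumes "norm a = 1" "norm b = 1"
  shows "0 \<le> 1 + a \<bullet> b"
  using Cauchy_Schwarz_ineq2[of a b] assms by (simp add: abs_le_iff)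

lemma off_inner_ge:
  assumes "\<And>i. norm (y i) = 1"
  shows "0 \<le> 1 + off_inner y p"
  by (rule inner_ge_minus_1) (auto simp: assms)

text \<open>The interpolant has degree one, so the only bound needed is that the squared length of
  the sum of all points is nonnegative.\<close>

lemma power_energy_simplex:
  fixes y y' :: "'n::finite \<Rightarrow> real ^ 3"
  assumes N: "2 \<le> CARD('n)"
    and y: "\<And>i. norm (y i) = 1" and y': "\<And>i. norm (y' i) = 1"
    and t: "\<And>i j. i \<noteq> j \<Longrightarrow> y' i \<bullet> y' j = - 1 / (real CARD('n) - 1)"
  shows "power_energy n y' \<le> power_energy n y"
proof -
  define N where "N = real CARD('n)"
  define a where "a = 1 - 1 / (N - 1)"
  have N2: "N \<ge> 2" using N by (simp add: N_def)
  then have a: "0 \<le> a" by (simp add: a_def field_simps)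
  obtain b0 b1 q where b: "0 \<le> b1" "nonneg_poly q" "\<And>x. x ^ n = b0 + b1 * (x - a) + poly q x * (x - a)\<^sup>2"
    using power_newton_simplex[OF a] by metis
  have ay: "1 + off_inner y' p - a = 0" if "p \<in> offdiag" for p
    using t[of "fst p" "snd p"] that by (simp add: offdiag_def a_def N_def)
  then have "power_energy n y' = (\<Sum>p\<in>(offdiag :: ('n \<times> 'n) set). b0)"
    unfolding power_energy_def by (intro sum.cong) (simp_all add: b(3))
  also have "\<dots> \<le> (\<Sum>p\<in>offdiag. b0 + b1 * (1 + off_inner y p - a))"
  proof -
    have "(\<Sum>p\<in>offdiag. 1 + off_inner y p - a) = (\<Sum>p\<in>offdiag. 0 * off_inner y p ^ 4 + 0 * off_inner y p ^ 3 + 0 * off_inner y p ^ 2 + 1 * off_inner y p + (1 - a))"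
      by (intro sum.cong) auto
    also have "\<dots> = (pow_sum 1 y - N) + (1 - a) * (N\<^sup>2 - N)"
      unfolding sum_offdiag_quartic[of y, OF y] by (simp add: N_def)
    \<comment> \<open>The node is such that this constant cancels the diagonal contribution, and the
      linear term becomes exactly \<open>pow_sum 1 y\<close>.\<close>
    also have "(1 - a) * (N\<^sup>2 - N) = N" using N2 by (simp add: a_def power2_eq_square field_simps)
    finally have "0 \<le> (\<Sum>p\<in>offdiag. 1 + off_inner y p - a)" using pow_sum_1_nonneg[of y] by simp
    then show ?thesis using b(1) by (simp add: sum.distrib sum_distrib_left[symmetric])
  qed
  also have "\<dots> \<le> power_energy n y"
    unfolding power_energy_def b(3)
    using poly_nonneg[OF b(2) off_inner_ge[of y, OF y]] by (intro sum_mono) auto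
  finally show ?thesis .
qed

text \<open>The values 0 and 12 = 6^2 / 3 are the minima of the first two power sums, and both enter
  the quadratic interpolant with nonnegative coefficients.\<close>

lemma power_energy_octahedron:
  fixes y y' :: "'n::finite \<Rightarrow> real ^ 3"
  assumes N: "CARD('n) = 6"
    and y: "\<And>i. norm (y i) = 1" and y': "\<And>i. norm (y' i) = 1"
    and t: "\<And>i j. i \<noteq> j \<Longrightarrow> y' i \<bullet> y' j \<in> {-1, 0}"
    and P: "pow_sum 1 y' = 0" "pow_sum 2 y' = 12"
  shows "power_energy n y' \<le> power_energy n y"
proof -
  obtain b0 b1 b2 q where b: "0 \<le> b1" "0 \<le> b2" "nonneg_poly q"
    "\<And>x. x ^ n = b0 + b1 * x + b2 * (x * (x - 1)) + poly q x * (x * (x - 1)\<^sup>2)"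
    using power_newton_octahedron by metis
  define h where "h x = b0 + b1 * x + b2 * (x * (x - 1))" for x
  have sum_h: "(\<Sum>p\<in>offdiag. h (1 + off_inner z p)) = b2 * (pow_sum 2 z - 6) + (b1 + b2) * (pow_sum 1 z - 6) + (b0 + b1) * 30"
    if z: "\<And>i. norm (z i) = 1" for z :: "'n \<Rightarrow> real ^ 3"
  proof -
    have "(\<Sum>p\<in>offdiag. h (1 + off_inner z p)) = (\<Sum>p\<in>offdiag. 0 * off_inner z p ^ 4 + 0 * off_inner z p ^ 3 + b2 * off_inner z p ^ 2 + (b1 + b2) * off_inner z p + (b0 + b1))"
      by (intro sum.cong) (auto simp: h_def power2_eq_square algebra_simps)
    then show ?thesis unfolding sum_offdiag_quartic[of z, OF z] by (simp add: N)
  qed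
  have "1 + off_inner y' p = 0 \<or> 1 + off_inner y' p = 1" if "p \<in> offdiag" for p
    using t[of "fst p" "snd p"] that by (auto simp: offdiag_def)
  then have "power_energy n y' = (\<Sum>p\<in>offdiag. h (1 + off_inner y' p))"
    unfolding power_energy_def b(4) h_def by (intro sum.cong) fastforce+
  also have "\<dots> \<le> (\<Sum>p\<in>offdiag. h (1 + off_inner y p))"
    unfolding sum_h[of y, OF y] sum_h[of y', OF y'] P
    using pow_sum_1_nonneg[of y] pow_sum_2_ge[of y, OF y] b N
    by (intro add_right_mono add_mono mult_left_mono) auto
  also have "\<dots> \<le> power_energy n y"
    unfolding power_energy_def b(4) h_def
    using poly_nonneg[OF b(3) off_inner_ge[of y, OF y]] off_inner_ge[of y, OF y] by (intro sum_mono) auto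
  finally show ?thesis .
qed

text \<open>The three inner products are the roots of (t + 1) (t^2 - 1/5), so higher powers reduce
  to lower ones on them.\<close>

lemma icosahedron_node_identities:
  fixes t :: real
  assumes "t \<in> {-1, 1 / sqrt 5, - 1 / sqrt 5}"
  shows "t ^ 3 = - t\<^sup>2 + t / 5 + 1 / 5" "t ^ 4 = - (t ^ 3) + t\<^sup>2 / 5 + t / 5"
proof -
  have "t = -1 \<or> t\<^sup>2 = 1 / 5" using assms by (auto simp: power_divide)
  then have "(t + 1) * (t\<^sup>2 - 1 / 5) = 0" by auto
  then show 1: "t ^ 3 = - t\<^sup>2 + t / 5 + 1 / 5" by (simp add: power3_eq_cube power2_eq_square algebra_simps)
  have "t ^ 4 = t ^ 3 * t" by (simp add: power_numeral_reduce)
  also have "\<dots> = (- t\<^sup>2 + t / 5 + 1 / 5) * t" by (simp only: 1)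
  also have "\<dots> = - (t ^ 3) + t\<^sup>2 / 5 + t / 5" by (simp add: power3_eq_cube power2_eq_square algebra_simps)
  finally show "t ^ 4 = - (t ^ 3) + t\<^sup>2 / 5 + t / 5" .
qed

text \<open>The node relations, summed over all pairs, determine the third and fourth power sums
  from the first two. The fourth attains the bound N^2 / 5.\<close>

lemma icosahedron_pow_sums:
  fixes y :: "'n::finite \<Rightarrow> real ^ 3"
  assumes N: "CARD('n) = 12"
    and y: "\<And>i. norm (y i) = 1"
    and t: "\<And>i j. i \<noteq> j \<Longrightarrow> y i \<bullet> y j \<in> {-1, 1 / sqrt 5, - 1 / sqrt 5}"
    and P: "pow_sum 1 y = 0" "pow_sum 2 y = 48"
  shows "pow_sum 3 y = 0" "pow_sum 4 y = 144 / 5"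
proof -
  have "(\<Sum>p\<in>offdiag. off_inner y p ^ 3) = (\<Sum>p\<in>offdiag. 0 * off_inner y p ^ 4 + 0 * off_inner y p ^ 3 + (- 1) * off_inner y p ^ 2 + 1 / 5 * off_inner y p + 1 / 5)"
    using t by (intro sum.cong) (auto simp: offdiag_def icosahedron_node_identities(1))
  then show 3: "pow_sum 3 y = 0"
    unfolding sum_offdiag_quartic[of y, OF y] sum_offdiag_inner_power[of y, OF y] N P by simp
  have "(\<Sum>p\<in>offdiag. off_inner y p ^ 4) = (\<Sum>p\<in>offdiag. 0 * off_inner y p ^ 4 + (- 1) * off_inner y p ^ 3 + 1 / 5 * off_inner y p ^ 2 + 1 / 5 * off_inner y p + 0)"
    using t by (intro sum.cong) (auto simp: offdiag_def icosahedron_node_identities(2))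
  then show "pow_sum 4 y = 144 / 5"
    unfolding sum_offdiag_quartic[of y, OF y] sum_offdiag_inner_power[of y, OF y] N P 3 by simp
qed

lemma power_energy_icosahedron:
  fixes y y' :: "'n::finite \<Rightarrow> real ^ 3"
  assumes N: "CARD('n) = 12"
    and y: "\<And>i. norm (y i) = 1" and y': "\<And>i. norm (y' i) = 1"
    and t: "\<And>i j. i \<noteq> j \<Longrightarrow> y' i \<bullet> y' j \<in> {-1, 1 / sqrt 5, - 1 / sqrt 5}"
    and P: "pow_sum 1 y' = 0" "pow_sum 2 y' = 48"
  shows "power_energy n y' \<le> power_energy n y"
proof -
  define \<sigma> where "\<sigma> = 1 / sqrt 5"
  have \<sigma>: "1 / 5 < \<sigma>" "\<sigma> < 1" "\<sigma>\<^sup>2 = 1 / 5"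
  proof -
    have "sqrt 5 < 5" "1 < sqrt 5" by (simp_all add: real_less_lsqrt real_less_rsqrt)
    then show "1 / 5 < \<sigma>" "\<sigma> < 1" by (simp_all add: \<sigma>_def frac_less2)
  qed (simp add: \<sigma>_def power_divide)
  have s0: "0 \<le> 1 - \<sigma>" "0 \<le> 1 + \<sigma>" using \<sigma> by linarith+
  obtain b0 b1 b2 b3 b4 q where b: "0 \<le> b1" "0 \<le> b2" "0 \<le> b3" "0 \<le> b4" "nonneg_poly q"
    "\<And>x. x ^ n = b0 + b1 * x + b2 * (x * (x - (1 - \<sigma>))) + b3 * (x * (x - (1 - \<sigma>))\<^sup>2) + b4 * (x * (x - (1 - \<sigma>))\<^sup>2 * (x - (1 + \<sigma>)))
      + poly q x * (x * (x - (1 - \<sigma>))\<^sup>2 * (x - (1 + \<sigma>))\<^sup>2)"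
    using power_newton_icosahedron[OF s0] by metis
  define h where "h x = b0 + b1 * x + b2 * (x * (x - (1 - \<sigma>))) + b3 * (x * (x - (1 - \<sigma>))\<^sup>2) + b4 * (x * (x - (1 - \<sigma>))\<^sup>2 * (x - (1 + \<sigma>)))" for x
  \<comment> \<open>Coefficients of the interpolant after passing from x to the inner product x - 1;
    1/5 stands for \<open>\<sigma>\<close> squared.\<close>
  define c3 where "c3 = b3 + b4 * (1 + \<sigma>)"
  define c2 where "c2 = b2 + b3 * (1 + 2 * \<sigma>) + b4 * (\<sigma> - 1 / 5)"
  define c1 where "c1 = b1 + b2 * (1 + \<sigma>) + b3 * (2 * \<sigma> + 1 / 5) - b4 * (1 + \<sigma>) / 5"
  define c0 where "c0 = b0 + b1 + b2 * \<sigma> + b3 / 5 - b4 * \<sigma> / 5"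
  have h: "h (1 + x) = b4 * x ^ 4 + c3 * x ^ 3 + c2 * x\<^sup>2 + c1 * x + c0" for x
  proof -
    have "(x + \<sigma>)\<^sup>2 * (x - \<sigma>) = (x + \<sigma>) * (x\<^sup>2 - \<sigma>\<^sup>2)" by (simp add: power2_eq_square algebra_simps)
    then have 4: "(1 + x) * (x + \<sigma>)\<^sup>2 * (x - \<sigma>) = (1 + x) * (x + \<sigma>) * (x\<^sup>2 - 1 / 5)" by (simp add: \<sigma>(3) mult.assoc)
    have 3: "(x + \<sigma>)\<^sup>2 = x\<^sup>2 + 2 * \<sigma> * x + 1 / 5" using \<sigma>(3) by (simp add: power2_sum)
    have "h (1 + x) = b0 + b1 * (1 + x) + b2 * ((1 + x) * (x + \<sigma>)) + b3 * ((1 + x) * (x + \<sigma>)\<^sup>2) + b4 * ((1 + x) * (x + \<sigma>)\<^sup>2 * (x - \<sigma>))"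
      by (simp add: h_def)
    also have "\<dots> = b0 + b1 * (1 + x) + b2 * ((1 + x) * (x + \<sigma>)) + b3 * ((1 + x) * (x\<^sup>2 + 2 * \<sigma> * x + 1 / 5)) + b4 * ((1 + x) * (x + \<sigma>) * (x\<^sup>2 - 1 / 5))"
      unfolding 4 unfolding 3 ..
    also have "\<dots> = b4 * x ^ 4 + c3 * x ^ 3 + c2 * x\<^sup>2 + c1 * x + c0"
      by (simp add: c3_def c2_def c1_def c0_def power4_eq_xxxx power3_eq_cube power2_eq_square algebra_simps add_divide_distrib)
    finally show ?thesis .
  qed
  have sum_h: "(\<Sum>p\<in>offdiag. h (1 + off_inner z p)) =
      b4 * (pow_sum 4 z - 12) + c3 * (pow_sum 3 z - 12) + c2 * (pow_sum 2 z - 12) + c1 * (pow_sum 1 z - 12) + c0 * 132"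
    if z: "\<And>i. norm (z i) = 1" for z :: "'n \<Rightarrow> real ^ 3"
    unfolding h sum_offdiag_quartic[of z, OF z] by (simp add: N)
  have "1 + off_inner y' p = 0 \<or> 1 + off_inner y' p = 1 - \<sigma> \<or> 1 + off_inner y' p = 1 + \<sigma>" if "p \<in> offdiag" for p
    using t[of "fst p" "snd p"] that by (auto simp: offdiag_def \<sigma>_def)
  then have "power_energy n y' = (\<Sum>p\<in>offdiag. h (1 + off_inner y' p))"
    unfolding power_energy_def b(6) h_def by (intro sum.cong) fastforce+
  also have "\<dots> \<le> (\<Sum>p\<in>offdiag. h (1 + off_inner y p))"
  proof -
    have P34: "pow_sum 3 y' = 0" "pow_sum 4 y' = 144 / 5"
      by (rule icosahedron_pow_sums[of y']; use N y' t P in simp)+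
    \<comment> \<open>\<open>c1\<close> has a negative contribution from \<open>b4\<close>. The
      bound for the third power sum moves \<open>c3 / 3\<close> onto the first power sum, where it
      outweighs it: b4 (1 + sigma) enters with 1/3 - 1/5 = 2/15.\<close>
    have c3: "0 \<le> c3" and c2: "0 \<le> c2" and c31: "0 \<le> c3 / 3 + c1"
    proof -
      show "0 \<le> c3" "0 \<le> c2" using b \<sigma> by (auto simp: c3_def c2_def)
      have "c3 / 3 + c1 = b3 / 3 + b1 + b2 * (1 + \<sigma>) + b3 * (2 * \<sigma> + 1 / 5) + b4 * ((1 + \<sigma>) * (2 / 15))"
        by (simp add: c3_def c1_def field_simps)
      also have "\<dots> \<ge> 0" using b \<sigma> by (intro add_nonneg_nonneg mult_nonneg_nonneg) auto
      finally show "0 \<le> c3 / 3 + c1" .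
    qed
    have "b4 * (144 / 5) \<le> b4 * pow_sum 4 y" using pow_sum_4_ge[of y, OF y] b(4) N by (intro mult_left_mono) auto
    moreover have "c3 * (pow_sum 1 y / 3) \<le> c3 * pow_sum 3 y" using pow_sum_3_ge[of y, OF y] c3 by (intro mult_left_mono) auto
    moreover have "c2 * 48 \<le> c2 * pow_sum 2 y" using pow_sum_2_ge[of y, OF y] c2 N by (intro mult_left_mono) auto
    moreover have "0 \<le> (c3 / 3 + c1) * pow_sum 1 y" using c31 pow_sum_1_nonneg[of y] by (intro mult_nonneg_nonneg) auto
    ultimately show ?thesis
      unfolding sum_h[of y, OF y] sum_h[of y', OF y'] P P34 by (simp add: algebra_simps)
  qed
  also have "\<dots> \<le> power_energy n y"
    unfolding power_energy_def b(6) h_def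
    using poly_nonneg[OF b(5) off_inner_ge[of y, OF y]] off_inner_ge[of y, OF y] by (intro sum_mono) auto
  finally show ?thesis .
qed

lemma sharp_power_energy_le:
  fixes y y' :: "'n::finite \<Rightarrow> real ^ 3"
  assumes "sharp y'" "\<And>i. norm (y i) = 1"
  shows "power_energy n y' \<le> power_energy n y"
proof -
  have y': "\<And>i. norm (y' i) = 1" using assms(1) by (simp add: sharp_def)
  from assms(1) consider "2 \<le> CARD('n)" "\<And>i j. i \<noteq> j \<Longrightarrow> y' i \<bullet> y' j = - 1 / (real CARD('n) - 1)"
    | "CARD('n) = 6" "\<And>i j. i \<noteq> j \<Longrightarrow> y' i \<bullet> y' j \<in> {-1, 0}" "pow_sum 1 y' = 0" "pow_sum 2 y' = 12"
    | "CARD('n) = 12" "\<And>i j. i \<noteq> j \<Longrightarrow> y' i \<bullet> y' j \<in> {-1, 1 / sqrt 5, - 1 / sqrt 5}" "pow_sum 1 y' = 0" "pow_sum 2 y' = 48"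
    unfolding sharp_def by auto
  then show ?thesis
  proof cases
    case 1 then show ?thesis by (intro power_energy_simplex[of y y', OF _ assms(2) y'])
  next
    case 2 then show ?thesis by (intro power_energy_octahedron[of y y', OF _ assms(2) y'])
  next
    case 3 then show ?thesis by (intro power_energy_icosahedron[of y y', OF _ assms(2) y'])
  qed
qed

lemma power_energy_eq_imp_poly:
  assumes "\<And>n. power_energy n y = power_energy n y'"
  shows "(\<Sum>p\<in>offdiag. poly Q (1 + off_inner y p)) = (\<Sum>p\<in>offdiag. poly Q (1 + off_inner y' p))"
  unfolding poly_altdef
  by (subst (1 2) sum.swap) (simp add: sum_distrib_left[symmetric] assms[unfolded power_energy_def])

text \<open>Equal energies of all powers give equal energies of all polynomials. A polynomial that
  is nonnegative on the range and zero at the nodes of \<open>y'\<close> then has energy zero for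
  \<open>y\<close>, hence vanishes on every pair.\<close>

lemma power_energy_eq_imp_nodes:
  fixes y y' :: "'n::finite \<Rightarrow> real ^ 3"
  assumes eq: "\<And>n. power_energy n y = power_energy n y'"
    and y: "\<And>i. norm (y i) = 1"
    and Q: "\<And>x. 0 \<le> x \<Longrightarrow> 0 \<le> poly Q x"
    and zero: "\<And>p. p \<in> offdiag \<Longrightarrow> poly Q (1 + off_inner y' p) = 0"
    and p: "p \<in> offdiag"
  shows "poly Q (1 + off_inner y p) = 0"
proof -
  have "(\<Sum>p\<in>offdiag. poly Q (1 + off_inner y p)) = 0"
    unfolding power_energy_eq_imp_poly[of y y', OF eq] using zero by (intro sum.neutral) auto
  then show ?thesis using Q[OF off_inner_ge[of y, OF y]] p by (subst (asm) sum_nonneg_eq_0_iff) auto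
qed

text \<open>The polynomial tested is the interpolation remainder with constant factor 1: its roots
  are the nodes, and it is nonnegative for x >= 0.\<close>

lemma power_energy_eq_imp_sharp:
  fixes y y' :: "'n::finite \<Rightarrow> real ^ 3"
  assumes s: "sharp y'" and y: "\<And>i. norm (y i) = 1" and eq: "\<And>n. power_energy n y = power_energy n y'"
  shows "sharp y"
proof -
  have y': "\<And>i. norm (y' i) = 1" using s by (simp add: sharp_def)
  have P1: "pow_sum 1 y = pow_sum 1 y'"
    using power_energy_eq_imp_poly[of y y' "[:-1, 1:]", OF eq]
      sum_offdiag_inner_power[of y 1, OF y] sum_offdiag_inner_power[of y' 1, OF y'] by simp
  \<comment> \<open>The polynomial (x - 1)^2 is the square of the inner product and so recovers the
    second power sum.\<close>
  have "poly [:1, -2, 1:] (1 + x) = x\<^sup>2" for x :: real by (simp add: power2_eq_square algebra_simps)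
  then have P2: "pow_sum 2 y = pow_sum 2 y'"
    using power_energy_eq_imp_poly[of y y' "[:1, -2, 1:]", OF eq]
      sum_offdiag_inner_power[of y 2, OF y] sum_offdiag_inner_power[of y' 2, OF y'] by simp
  note nodes = power_energy_eq_imp_nodes[of y y', OF eq y]
  from s consider "CARD('n) \<in> {2, 3, 4}" "\<And>i j. i \<noteq> j \<Longrightarrow> y' i \<bullet> y' j = - 1 / (real CARD('n) - 1)"
    | "CARD('n) = 6" "\<And>i j. i \<noteq> j \<Longrightarrow> y' i \<bullet> y' j \<in> {-1, 0}" "pow_sum 1 y' = 0" "pow_sum 2 y' = 12"
    | "CARD('n) = 12" "\<And>i j. i \<noteq> j \<Longrightarrow> y' i \<bullet> y' j \<in> {-1, 1 / sqrt 5, - 1 / sqrt 5}" "pow_sum 1 y' = 0" "pow_sum 2 y' = 48"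
    unfolding sharp_def by auto
  then show ?thesis
  proof cases
    case 1
    define a where "a = 1 + - 1 / (real CARD('n) - 1)"
    have "y i \<bullet> y j = - 1 / (real CARD('n) - 1)" if "i \<noteq> j" for i j
      using nodes[of "[:-a, 1:] ^ 2" "(i, j)"] 1(2) that by (auto simp: offdiag_def a_def)
    then show ?thesis using 1(1) y unfolding sharp_def by blast
  next
    case 2
    have "poly ([:0, 1:] * [:-1, 1:] ^ 2) (1 + y i \<bullet> y j) = 0" if "i \<noteq> j" for i j
      using nodes[of "[:0, 1:] * [:-1, 1:] ^ 2" "(i, j)"] 2(2) that by (fastforce simp: offdiag_def)
    then have "y i \<bullet> y j \<in> {-1, 0}" if "i \<noteq> j" for i j using that by fastforce
    then show ?thesis using 2 y P1 P2 unfolding sharp_def by auto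
  next
    case 3
    define Q where "Q = [:0, 1:] * [:-(1 - 1 / sqrt 5), 1:] ^ 2 * [:-(1 + 1 / sqrt 5), 1:] ^ 2"
    have Q: "poly Q x = x * (x - 1 + 1 / sqrt 5)\<^sup>2 * (x - 1 - 1 / sqrt 5)\<^sup>2" for x
      by (simp add: Q_def algebra_simps)
    have "poly Q (1 + y i \<bullet> y j) = 0" if "i \<noteq> j" for i j
    proof -
      have "poly Q (1 + off_inner y' p) = 0" if "p \<in> offdiag" for p
        using 3(2)[of "fst p" "snd p"] that by (auto simp: Q offdiag_def)
      then show ?thesis using nodes[of Q "(i, j)"] that by (auto simp: offdiag_def Q)
    qed
    then have "y i \<bullet> y j \<in> {-1, 1 / sqrt 5, - 1 / sqrt 5}" if "i \<noteq> j" for i j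
      using that by (fastforce simp: Q)
    then show ?thesis using 3 y P1 P2 unfolding sharp_def by auto
  qed
qed

section \<open>From powers to the Yukawa kernel\<close>

definition yukawa_energy :: "real \<Rightarrow> ('n::finite \<Rightarrow> real ^ 3) \<Rightarrow> real" where
  "yukawa_energy \<kappa> y = (\<Sum>p\<in>offdiag. G \<kappa> (y (fst p) - y (snd p)))"

lemma exp_energy_sums:
  "(\<lambda>n. b ^ n / fact n * power_energy n y) sums (\<Sum>p\<in>offdiag. exp (b * (1 + off_inner y p)))"
proof -
  have "(\<lambda>n. \<Sum>p\<in>offdiag. (b * (1 + off_inner y p)) ^ n /\<^sub>R fact n) sums (\<Sum>p\<in>offdiag. exp (b * (1 + off_inner y p)))"
    by (intro sums_sum exp_converges)
  also have "(\<lambda>n. \<Sum>p\<in>offdiag. (b * (1 + off_inner y p)) ^ n /\<^sub>R fact n) = (\<lambda>n. b ^ n / fact n * power_energy n y)"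
    by (simp add: power_energy_def sum_distrib_left power_mult_distrib divide_inverse ac_simps)
  finally show ?thesis .
qed

text \<open>The difference of the two sides is a series of nonnegative terms with positive weights,
  so equality for one \<open>b\<close> already forces equality of every power energy.\<close>

lemma exp_energy_le:
  assumes le: "\<And>n. power_energy n y' \<le> power_energy n y" and b: "b > 0"
  shows "(\<Sum>p\<in>offdiag. exp (b * (1 + off_inner y' p))) \<le> (\<Sum>p\<in>offdiag. exp (b * (1 + off_inner y p)))"
    and "(\<Sum>p\<in>offdiag. exp (b * (1 + off_inner y' p))) = (\<Sum>p\<in>offdiag. exp (b * (1 + off_inner y p))) \<Longrightarrow>
      power_energy n y = power_energy n y'"
proof -
  let ?d = "\<lambda>n. b ^ n / fact n * power_energy n y - b ^ n / fact n * power_energy n y'"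
  have d: "?d sums ((\<Sum>p\<in>offdiag. exp (b * (1 + off_inner y p))) - (\<Sum>p\<in>offdiag. exp (b * (1 + off_inner y' p))))"
    by (intro sums_diff exp_energy_sums)
  have nonneg: "0 \<le> ?d n" for n
    using mult_left_mono[OF le[of n], of "b ^ n / fact n"] b by simp
  show "(\<Sum>p\<in>offdiag. exp (b * (1 + off_inner y' p))) \<le> (\<Sum>p\<in>offdiag. exp (b * (1 + off_inner y p)))"
    using suminf_nonneg[OF sums_summable[OF d] nonneg] sums_unique[OF d] by simp
  show "power_energy n y = power_energy n y'"
    if "(\<Sum>p\<in>offdiag. exp (b * (1 + off_inner y' p))) = (\<Sum>p\<in>offdiag. exp (b * (1 + off_inner y p)))"
  proof -
    have "suminf ?d = 0" using sums_unique[OF d] that by simp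
    then have "?d n = 0" using suminf_eq_zero_iff[OF sums_summable[OF d] nonneg] by blast
    then show ?thesis using b by simp
  qed
qed

text \<open>On the unit sphere the squared distance is 4 - 2x with x = 1 + <y_i, y_j>, so the heat
  kernel is a positive multiple of exp (x / (2t)).\<close>

lemma heat_energy_eq:
  assumes "\<And>i. norm (y i) = 1" "t > 0"
  shows "(\<Sum>p\<in>offdiag. heat t (y (fst p) - y (snd p))) =
    exp (- 1 / t) / sqrt (4 * pi * t) ^ 3 * (\<Sum>p\<in>offdiag. exp (1 / (2 * t) * (1 + off_inner y p)))"
  unfolding sum_distrib_left
proof (rule sum.cong[OF refl])
  fix p :: "'a \<times> 'a"
  have e: "(norm (y (fst p) - y (snd p)))\<^sup>2 = 4 - 2 * (1 + off_inner y p)"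
    using assms(1) by (simp add: power2_norm_eq_inner inner_diff_left inner_diff_right inner_commute) (simp add: power2_norm_eq_inner[symmetric])
  have "- (norm (y (fst p) - y (snd p)))\<^sup>2 / (4 * t) = - 1 / t + 1 / (2 * t) * (1 + off_inner y p)"
    unfolding e using assms(2) by (simp add: field_simps)
  then show "heat t (y (fst p) - y (snd p)) = exp (- 1 / t) / sqrt (4 * pi * t) ^ 3 * exp (1 / (2 * t) * (1 + off_inner y p))"
    unfolding heat_def by (simp only: exp_add) simp
qed

lemma yukawa_energy_integral:
  fixes y :: "'n::finite \<Rightarrow> real ^ 3"
  assumes "inj y" "\<kappa> > 0"
  shows "has_bochner_integral lborel
    (\<lambda>t. indicator {0<..} t * exp (- \<kappa>\<^sup>2 * t) * (\<Sum>p\<in>offdiag. heat t (y (fst p) - y (snd p)))) (yukawa_energy \<kappa> y)"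
proof -
  have "has_bochner_integral lborel (\<lambda>t. indicator {0<..} t * exp (- \<kappa>\<^sup>2 * t) * heat t (y (fst p) - y (snd p))) (G \<kappa> (y (fst p) - y (snd p)))"
    if "p \<in> offdiag" for p
  proof (rule has_bochner_integral_nn_integral)
    have "y (fst p) - y (snd p) \<noteq> 0" using that assms(1) by (auto simp: offdiag_def dest: injD)
    from nn_integral_heat_time[OF assms(2) this]
    show "(\<integral>\<^sup>+t. ennreal (indicator {0<..} t * exp (- \<kappa>\<^sup>2 * t) * heat t (y (fst p) - y (snd p))) \<partial>lborel) = ennreal (G \<kappa> (y (fst p) - y (snd p)))"
      by (subst (asm) nn_integral_cong[where v = "\<lambda>t. ennreal (indicator {0<..} t * exp (- \<kappa>\<^sup>2 * t) * heat t (y (fst p) - y (snd p)))"])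
         (auto simp: indicator_def)
  qed (auto simp: indicator_def intro!: AE_I2)
  then show ?thesis
    unfolding yukawa_energy_def sum_distrib_left by (intro has_bochner_integral_sum) auto
qed

lemma yukawa_energy_le:
  fixes y y' :: "'n::finite \<Rightarrow> real ^ 3"
  assumes le: "\<And>n. power_energy n y' \<le> power_energy n y" and k: "\<kappa> > 0"
    and y: "\<And>i. norm (y i) = 1" "inj y" and y': "\<And>i. norm (y' i) = 1" "inj y'"
  shows "yukawa_energy \<kappa> y' \<le> yukawa_energy \<kappa> y"
    and "yukawa_energy \<kappa> y' = yukawa_energy \<kappa> y \<Longrightarrow> power_energy n y = power_energy n y'"
proof -
  define h where "h z t = indicator {0<..} t * exp (- \<kappa>\<^sup>2 * t) * (\<Sum>p\<in>offdiag. heat t (z (fst p) - z (snd p)))" for z :: "'n \<Rightarrow> real ^ 3" and t :: real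
  have hh: "h y' t \<le> h y t" for t
  proof (cases "t > 0")
    case True
    then have "(\<Sum>p\<in>offdiag. heat t (y' (fst p) - y' (snd p))) \<le> (\<Sum>p\<in>offdiag. heat t (y (fst p) - y (snd p)))"
      unfolding heat_energy_eq[of y', OF y'(1) True] heat_energy_eq[of y, OF y(1) True]
      by (intro mult_left_mono exp_energy_le(1) le) auto
    then show ?thesis unfolding h_def by (intro mult_left_mono) auto
  qed (simp add: h_def)
  note D = has_bochner_integral_diff[OF yukawa_energy_integral[OF y(2) k] yukawa_energy_integral[OF y'(2) k], folded h_def]
  then have int: "integrable lborel (\<lambda>t. h y t - h y' t)" and val: "(LINT t|lborel. h y t - h y' t) = yukawa_energy \<kappa> y - yukawa_energy \<kappa> y'"
    by (auto simp: has_bochner_integral_iff)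
  have "0 \<le> (LINT t|lborel. h y t - h y' t)" using hh by (intro integral_nonneg_AE) auto
  then show "yukawa_energy \<kappa> y' \<le> yukawa_energy \<kappa> y" using val by simp
  assume "yukawa_energy \<kappa> y' = yukawa_energy \<kappa> y"
  then have "(LINT t|lborel. h y t - h y' t) = 0" using val by simp
  then have "AE t in lborel. h y t - h y' t = 0"
    using integral_nonneg_eq_0_iff_AE[OF int] hh by auto
  \<comment> \<open>A single positive time with equal heat energies is enough; one is picked near
    1.\<close>
  then have "\<exists>\<^sub>F t in at (1::real). h y t - h y' t = 0" by (rule AE_frequently_at)
  moreover have "\<forall>\<^sub>F t in at (1::real). 0 < t"
    by (rule order_tendstoD(1)[OF tendsto_ident_at]) simp
  ultimately have "\<exists>\<^sub>F t in at (1::real). h y t - h y' t = 0 \<and> 0 < t"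
    by (rule frequently_eventually_frequently)
  then obtain t where t: "h y t - h y' t = 0" "t > 0"
    using frequently_ex by blast
  then have "(\<Sum>p\<in>offdiag. heat t (y' (fst p) - y' (snd p))) = (\<Sum>p\<in>offdiag. heat t (y (fst p) - y (snd p)))"
    by (simp add: h_def)
  then have "(\<Sum>p\<in>offdiag. exp (1 / (2 * t) * (1 + off_inner y' p))) = (\<Sum>p\<in>offdiag. exp (1 / (2 * t) * (1 + off_inner y p)))"
    unfolding heat_energy_eq[of y', OF y'(1) t(2)] heat_energy_eq[of y, OF y(1) t(2)] using t(2) by simp
  then show "power_energy n y = power_energy n y'"
    using t(2) by (intro exp_energy_le(2)[OF le, of "1 / (2 * t)"]) auto
qed

section \<open>Row sums and comparison of the ground states\<close>

lemma qf_ones: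
  fixes y :: "'n::finite \<Rightarrow> real ^ 3"
  shows "qf \<alpha> y \<kappa> 1 = real CARD('n) * (\<alpha> + \<kappa> / (4 * pi)) - yukawa_energy \<kappa> y"
proof -
  have "qf \<alpha> y \<kappa> 1 = (\<Sum>i\<in>UNIV. \<Sum>j\<in>UNIV. \<Gamma> \<alpha> y \<kappa> $ i $ j)" by (simp add: qf_eq_sum)
  also have "\<dots> = (\<Sum>i\<in>UNIV. \<Gamma> \<alpha> y \<kappa> $ i $ i) + (\<Sum>p\<in>offdiag. \<Gamma> \<alpha> y \<kappa> $ fst p $ snd p)"
    by (simp add: sum_offdiag[of "\<lambda>i j. \<Gamma> \<alpha> y \<kappa> $ i $ j"])
  also have "(\<Sum>p\<in>offdiag. \<Gamma> \<alpha> y \<kappa> $ fst p $ snd p) = - yukawa_energy \<kappa> y"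
    unfolding yukawa_energy_def sum_negf[symmetric] by (intro sum.cong) (auto simp: \<Gamma>_def offdiag_def)
  finally show ?thesis by (simp add: \<Gamma>_def)
qed

text \<open>The off-diagonal Green matrix is nonnegative with all row sums R, so its form is at most
  R |c|^2; this follows from 2 c_i c_j <= c_i^2 + c_j^2.\<close>

lemma qf_ge_if_rows_equal:
  fixes y :: "'n::finite \<Rightarrow> real ^ 3"
  assumes rows: "\<And>i. (\<Sum>j\<in>UNIV - {i}. G \<kappa> (y i - y j)) = R"
  shows "(\<alpha> + \<kappa> / (4 * pi) - R) * (c \<bullet> c) \<le> qf \<alpha> y \<kappa> c"
proof -
  have cc: "(\<Sum>p\<in>offdiag. (c $ fst p)\<^sup>2 * G \<kappa> (y (fst p) - y (snd p))) = R * (c \<bullet> c)"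
    unfolding sum_offdiag_rows[of "\<lambda>i j. (c $ i)\<^sup>2 * G \<kappa> (y i - y j)"] sum_distrib_left[symmetric] rows
    by (simp add: inner_vec_def power2_eq_square sum_distrib_left mult.commute)
  have cc': "(\<Sum>p\<in>offdiag. (c $ snd p)\<^sup>2 * G \<kappa> (y (fst p) - y (snd p))) = R * (c \<bullet> c)"
    unfolding cc[symmetric]
    by (rule sum.reindex_bij_witness[of _ prod.swap prod.swap]) (auto simp: offdiag_def G_commute)
  have "qf \<alpha> y \<kappa> c = (\<Sum>i\<in>UNIV. c $ i * c $ i * \<Gamma> \<alpha> y \<kappa> $ i $ i) + (\<Sum>p\<in>offdiag. c $ fst p * c $ snd p * \<Gamma> \<alpha> y \<kappa> $ fst p $ snd p)"
    by (simp add: qf_eq_sum sum_offdiag[of "\<lambda>i j. c $ i * c $ j * \<Gamma> \<alpha> y \<kappa> $ i $ j"])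
  also have "(\<Sum>i\<in>UNIV. c $ i * c $ i * \<Gamma> \<alpha> y \<kappa> $ i $ i) = (\<alpha> + \<kappa> / (4 * pi)) * (c \<bullet> c)"
    by (simp add: \<Gamma>_def inner_vec_def sum_distrib_left mult.commute)
  finally have q: "qf \<alpha> y \<kappa> c = (\<alpha> + \<kappa> / (4 * pi)) * (c \<bullet> c) + (\<Sum>p\<in>offdiag. c $ fst p * c $ snd p * \<Gamma> \<alpha> y \<kappa> $ fst p $ snd p)" .
  have ge: "(\<Sum>p\<in>offdiag. c $ fst p * c $ snd p * \<Gamma> \<alpha> y \<kappa> $ fst p $ snd p) \<ge>
    (\<Sum>p\<in>offdiag. - (((c $ fst p)\<^sup>2 * G \<kappa> (y (fst p) - y (snd p)) + (c $ snd p)\<^sup>2 * G \<kappa> (y (fst p) - y (snd p))) / 2))"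
  proof (rule sum_mono)
    fix p :: "'n \<times> 'n" assume "p \<in> offdiag"
    have "2 * (c $ fst p * c $ snd p) \<le> (c $ fst p)\<^sup>2 + (c $ snd p)\<^sup>2"
      using sum_squares_bound[of "c $ fst p" "c $ snd p"] by (simp add: mult.assoc)
    then have "2 * (c $ fst p * c $ snd p) * G \<kappa> (y (fst p) - y (snd p)) \<le> ((c $ fst p)\<^sup>2 + (c $ snd p)\<^sup>2) * G \<kappa> (y (fst p) - y (snd p))"
      by (intro mult_right_mono) auto
    then show "- (((c $ fst p)\<^sup>2 * G \<kappa> (y (fst p) - y (snd p)) + (c $ snd p)\<^sup>2 * G \<kappa> (y (fst p) - y (snd p))) / 2) \<le> c $ fst p * c $ snd p * \<Gamma> \<alpha> y \<kappa> $ fst p $ snd p"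
      using \<open>p \<in> offdiag\<close> by (simp add: \<Gamma>_def offdiag_def distrib_right)
  qed
  have "(\<Sum>p\<in>offdiag. - (((c $ fst p)\<^sup>2 * G \<kappa> (y (fst p) - y (snd p)) + (c $ snd p)\<^sup>2 * G \<kappa> (y (fst p) - y (snd p))) / 2)) = - (R * (c \<bullet> c))"
    unfolding sum_negf sum_divide_distrib[symmetric] sum.distrib cc cc' by simp
  then show ?thesis using q ge by (simp add: left_diff_distrib)
qed

text \<open>The points sum to zero and form a tight frame, so the row sums of 1, t and t^2 are the
  same in every row. This takes the place of a transitive symmetry group.\<close>

lemma row_sum_quadratic:
  fixes y :: "'n::finite \<Rightarrow> real ^ 3"
  assumes y: "\<And>i. norm (y i) = 1" and P: "pow_sum 1 y = 0" "pow_sum 2 y = (real CARD('n))\<^sup>2 / 3"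
    and g: "\<And>j. j \<noteq> i \<Longrightarrow> g j = a + b * (y i \<bullet> y j) + c * (y i \<bullet> y j)\<^sup>2"
  shows "(\<Sum>j\<in>UNIV - {i}. g j) = a * (real CARD('n) - 1) - b + c * (real CARD('n) / 3 - 1)"
proof -
  have "(\<Sum>j\<in>UNIV. y j) = 0" using P(1) by (simp only: pow_sum_1) simp
  then have "(\<Sum>j\<in>UNIV. y i \<bullet> y j) = 0" by (simp add: inner_sum_right[symmetric])
  moreover have "(\<Sum>j\<in>UNIV. (y i \<bullet> y j)\<^sup>2) = real CARD('n) / 3"
    using frame_identity[of y "y i" "y i", OF y P(2)] y by (simp add: power2_eq_square dot_square_norm)
  moreover have "y i \<bullet> y i = 1" using y[of i] by (simp add: dot_square_norm)
  moreover have "(\<Sum>j\<in>UNIV - {i}. g j) = (\<Sum>j\<in>UNIV - {i}. a + b * (y i \<bullet> y j) + c * (y i \<bullet> y j)\<^sup>2)"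
    using g by (intro sum.cong) auto
  ultimately show ?thesis
    by (simp add: sum_diff1 sum.distrib sum_distrib_left[symmetric])
qed

lemma G_unit:
  fixes a b :: "real ^ 3"
  assumes "norm a = 1" "norm b = 1"
  shows "G \<kappa> (a - b) = exp (- \<kappa> * sqrt (2 - 2 * (a \<bullet> b))) / (4 * pi * sqrt (2 - 2 * (a \<bullet> b)))"
proof -
  have "(norm (a - b))\<^sup>2 = 2 - 2 * (a \<bullet> b)"
    using assms by (simp add: power2_norm_eq_inner inner_diff_left inner_diff_right inner_commute) (simp add: dot_square_norm)
  then have "norm (a - b) = sqrt (2 - 2 * (a \<bullet> b))" by (metis norm_ge_zero real_sqrt_unique)
  then show ?thesis by (simp add: G_def)
qed

text \<open>At most three inner products occur, so on them the Green function agrees with a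
  polynomial of degree at most two in the inner product.\<close>

lemma sharp_rows_equal:
  fixes y :: "'n::finite \<Rightarrow> real ^ 3"
  assumes s: "sharp y"
  obtains R where "\<And>i. (\<Sum>j\<in>UNIV - {i}. G \<kappa> (y i - y j)) = R"
proof -
  have y: "\<And>i. norm (y i) = 1" using s by (simp add: sharp_def)
  define g where "g t = exp (- \<kappa> * sqrt (2 - 2 * t)) / (4 * pi * sqrt (2 - 2 * t))" for t
  have G: "G \<kappa> (y i - y j) = g (y i \<bullet> y j)" for i j unfolding g_def by (rule G_unit[OF y y])
  from s consider "\<And>i j. i \<noteq> j \<Longrightarrow> y i \<bullet> y j = - 1 / (real CARD('n) - 1)"
    | "CARD('n) = 6" "\<And>i j. i \<noteq> j \<Longrightarrow> y i \<bullet> y j \<in> {-1, 0}" "pow_sum 1 y = 0" "pow_sum 2 y = 12"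
    | "CARD('n) = 12" "\<And>i j. i \<noteq> j \<Longrightarrow> y i \<bullet> y j \<in> {-1, 1 / sqrt 5, - 1 / sqrt 5}" "pow_sum 1 y = 0" "pow_sum 2 y = 48"
    unfolding sharp_def by auto
  then show ?thesis
  proof cases
    case 1
    have "(\<Sum>j\<in>UNIV - {i}. G \<kappa> (y i - y j)) = (\<Sum>j\<in>UNIV - {i}. g (- 1 / (real CARD('n) - 1)))" for i
      unfolding G using 1 by (intro sum.cong) auto
    then show ?thesis using that by simp
  next
    case 2
    \<comment> \<open>The polynomial is the line through the values of \<open>g\<close> at -1 and
      0.\<close>
    have "(\<Sum>j\<in>UNIV - {i}. G \<kappa> (y i - y j)) = g 0 * (real CARD('n) - 1) - (g 0 - g (- 1)) + 0 * (real CARD('n) / 3 - 1)" for i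
      unfolding G
    proof (rule row_sum_quadratic[of y, OF y])
      fix j assume "j \<noteq> i"
      then have "y i \<bullet> y j \<in> {-1, 0}" using 2(2) by auto
      then show "g (y i \<bullet> y j) = g 0 + (g 0 - g (- 1)) * (y i \<bullet> y j) + 0 * (y i \<bullet> y j)\<^sup>2" by auto
    qed (use 2 in auto)
    then show ?thesis using that by blast
  next
    case 3
    define \<sigma> where "\<sigma> = 1 / sqrt 5"
    have \<sigma>: "\<sigma>\<^sup>2 = 1 / 5" "\<sigma> \<noteq> 0" by (auto simp: \<sigma>_def power_divide)
    \<comment> \<open>The parabola through -1 and the two points +-sigma: the odd part at +-sigma
      gives \<open>b\<close>, and comparing their mean with the value at -1 gives \<open>c\<close>,
      with 4/5 = 1 - sigma^2.\<close>
    define b where "b = (g \<sigma> - g (- \<sigma>)) / (2 * \<sigma>)"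
    define c where "c = (g (- 1) + b - (g \<sigma> + g (- \<sigma>)) / 2) / (4 / 5)"
    define a where "a = g (- 1) + b - c"
    have node: "g t = a + b * t + c * t\<^sup>2" if "t \<in> {-1, \<sigma>, - \<sigma>}" for t
    proof -
      have bs: "b * \<sigma> = (g \<sigma> - g (- \<sigma>)) / 2" using \<sigma>(2) by (simp add: b_def)
      have c: "c * (4 / 5) = g (- 1) + b - (g \<sigma> + g (- \<sigma>)) / 2" by (simp add: c_def)
      have cs: "c * \<sigma>\<^sup>2 = c / 5" by (simp add: \<sigma>(1))
      have "g \<sigma> = a + b * \<sigma> + c * \<sigma>\<^sup>2" unfolding a_def cs using bs c by (simp add: field_simps)
      moreover have "g (- \<sigma>) = a + b * - \<sigma> + c * (- \<sigma>)\<^sup>2"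
        unfolding a_def power2_minus cs mult_minus_right using bs c by (simp add: field_simps)
      moreover have "g (- 1) = a + b * - 1 + c * (- 1)\<^sup>2" by (simp add: a_def)
      ultimately show ?thesis using that by blast
    qed
    have "(\<Sum>j\<in>UNIV - {i}. G \<kappa> (y i - y j)) = a * (real CARD('n) - 1) - b + c * (real CARD('n) / 3 - 1)" for i
      unfolding G
    proof (rule row_sum_quadratic[of y, OF y])
      fix j assume "j \<noteq> i"
      then show "g (y i \<bullet> y j) = a + b * (y i \<bullet> y j) + c * (y i \<bullet> y j)\<^sup>2"
        using 3(2)[of i j] by (intro node) (auto simp: \<sigma>_def)
    qed (use 3 in auto)
    then show ?thesis using that by blast
  qed
qed

lemma sharp_inj:
  fixes y :: "'n::finite \<Rightarrow> real ^ 3"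
  assumes s: "sharp y"
  shows "inj y"
proof (rule injI, rule ccontr)
  fix i j assume ij: "y i = y j" "i \<noteq> j"
  then have "y i \<bullet> y j = 1" using s by (simp add: sharp_def dot_square_norm)
  moreover have "1 / sqrt 5 < (1 :: real)" by simp
  moreover have "1 / sqrt 5 \<noteq> (- 1 :: real)"
  proof -
    have "0 < 1 / sqrt (5 :: real)" by simp
    then show ?thesis by linarith
  qed
  moreover have "- 1 / (real CARD('n) - 1) \<noteq> 1" if "2 \<le> CARD('n)"
  proof -
    have "- 1 / (real CARD('n) - 1) < 0" using that by simp
    then show ?thesis by linarith
  qed
  moreover from s have "2 \<le> CARD('n) \<and> y i \<bullet> y j = - 1 / (real CARD('n) - 1) \<or> y i \<bullet> y j \<in> {-1, 0} \<or>
      y i \<bullet> y j \<in> {-1, 1 / sqrt 5, - 1 / sqrt 5}"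
    unfolding sharp_def using ij(2) by auto
  ultimately show False by auto
qed

text \<open>Both configurations are compared at the single parameter K' of the symmetric one. The
  form of \<open>y\<close> at the constant vector is nonpositive there, so its own parameter K is at
  least K'.\<close>

lemma lambda1_sharp_optimal:
  fixes y y' :: "'n::finite \<Rightarrow> real ^ 3"
  assumes s: "sharp y'" and y: "\<And>i. norm (y i) = 1" "inj y" and \<alpha>: "\<alpha> < \<alpha>_crit y'"
  shows "lambda1 \<alpha> y \<le> lambda1 \<alpha> y'" and "\<not> sharp y \<Longrightarrow> lambda1 \<alpha> y < lambda1 \<alpha> y'"
proof -
  have y': "\<And>i. norm (y' i) = 1" "inj y'" using s sharp_inj by (auto simp: sharp_def)
  obtain \<kappa> where k: "\<kappa> > 0" "det (\<Gamma> \<alpha> y' \<kappa>) = 0" using \<alpha>_crit(1)[OF y'(2)] \<alpha> by blast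
  then obtain c where c: "c \<noteq> 0" "\<Gamma> \<alpha> y' \<kappa> *v c = 0" by (auto simp: det_eq_0_iff)
  then have "qf \<alpha> y' \<kappa> c \<le> 0" by (simp add: qf_def)
  from ground_state[OF y'(2) k(1) c(1) this]
  obtain K' where K': "\<kappa> \<le> K'" "det (\<Gamma> \<alpha> y' K') = 0" "\<forall>\<mu>>K'. \<forall>d. d \<noteq> 0 \<longrightarrow> 0 < qf \<alpha> y' \<mu> d"
    by blast
  have K'0: "0 < K'" using k K' by linarith
  have l': "lambda1 \<alpha> y' = - K'\<^sup>2" using K' K'0 by (intro lambda1_eq y') auto
  obtain R where R: "\<And>i. (\<Sum>j\<in>UNIV - {i}. G K' (y' i - y' j)) = R" using sharp_rows_equal[OF s] by metis
  have "yukawa_energy K' y' = real CARD('n) * R"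
    unfolding yukawa_energy_def sum_offdiag_rows[of "\<lambda>i j. G K' (y' i - y' j)"] R by simp
  \<comment> \<open>An arbitrary kernel vector is enough here: the lower bound through the row sum
    applies to it without identifying it as constant.\<close>
  moreover have "\<alpha> + K' / (4 * pi) \<le> R"
  proof -
    obtain d where d: "d \<noteq> 0" "\<Gamma> \<alpha> y' K' *v d = 0" using K'(2) by (auto simp: det_eq_0_iff)
    then have "(\<alpha> + K' / (4 * pi) - R) * (d \<bullet> d) \<le> 0"
      using qf_ge_if_rows_equal[OF R, of \<alpha> d] by (simp add: qf_def)
    moreover have "0 < d \<bullet> d" using d(1) by simp
    ultimately show ?thesis by (simp add: mult_le_0_iff)
  qed
  ultimately have q': "real CARD('n) * (\<alpha> + K' / (4 * pi)) \<le> yukawa_energy K' y'"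
    by (simp add: mult_left_mono)
  have le: "\<And>n. power_energy n y' \<le> power_energy n y" by (rule sharp_power_energy_le[OF s y(1)])
  have W: "yukawa_energy K' y' \<le> yukawa_energy K' y" by (rule yukawa_energy_le(1)[OF le K'0 y y'])
  have one: "(1 :: real ^ 'n) \<noteq> 0" by simp
  have "qf \<alpha> y K' 1 \<le> 0" using q' W by (simp add: qf_ones)
  from ground_state[OF y(2) K'0 one this]
  obtain K where K: "K' \<le> K" "det (\<Gamma> \<alpha> y K) = 0" "\<forall>d. 0 \<le> qf \<alpha> y K d" "\<forall>\<mu>>K. \<forall>d. d \<noteq> 0 \<longrightarrow> 0 < qf \<alpha> y \<mu> d"
    by blast
  have l: "lambda1 \<alpha> y = - K\<^sup>2" using K K'0 by (intro lambda1_eq y) auto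
  show "lambda1 \<alpha> y \<le> lambda1 \<alpha> y'" unfolding l l' using K(1) K'0 by simp
  assume "\<not> sharp y"
  then have "yukawa_energy K' y' \<noteq> yukawa_energy K' y"
    using yukawa_energy_le(2)[OF le K'0 y y'] power_energy_eq_imp_sharp[OF s, of y, OF y(1)] by blast
  \<comment> \<open>At K the form is nonnegative, so a strictly negative value at K' separates the
    two parameters.\<close>
  then have "qf \<alpha> y K' 1 < 0" using q' W by (simp add: qf_ones)
  then have "K \<noteq> K'" using K(3) by (metis not_less)
  then have "K' < K" using K(1) by simp
  then show "lambda1 \<alpha> y < lambda1 \<alpha> y'" unfolding l l' using K'0 by (simp add: power_strict_mono)
qed

section \<open>Rigidity\<close>

definition lin_indep3 :: "real ^ 3 \<Rightarrow> real ^ 3 \<Rightarrow> real ^ 3 \<Rightarrow> bool" where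
  "lin_indep3 a b c \<longleftrightarrow> (\<forall>\<alpha> \<beta> \<gamma>. \<alpha> *\<^sub>R a + \<beta> *\<^sub>R b + \<gamma> *\<^sub>R c = 0 \<longrightarrow> \<alpha> = 0 \<and> \<beta> = 0 \<and> \<gamma> = 0)"

lemma lin_indep3D:
  assumes "lin_indep3 a b c"
  shows "a \<noteq> b" "a \<noteq> c" "b \<noteq> c" "independent {a, b, c}" "span {a, b, c} = UNIV"
proof -
  note ind = assms[unfolded lin_indep3_def, rule_format]
  show ne: "a \<noteq> b" "a \<noteq> c" "b \<noteq> c"
    using ind[of 1 "-1" 0] ind[of 1 0 "-1"] ind[of 0 1 "-1"] by auto
  show i: "independent {a, b, c}"
  proof (rule ccontr)
    assume "\<not> independent {a, b, c}"
    then obtain u where u: "\<exists>v\<in>{a, b, c}. u v \<noteq> 0" "(\<Sum>v\<in>{a, b, c}. u v *\<^sub>R v) = 0"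
      using dependent_finite[of "{a, b, c}"] by auto
    have "u a *\<^sub>R a + u b *\<^sub>R b + u c *\<^sub>R c = 0" using u(2) ne by (simp add: add.assoc)
    from ind[OF this] u(1) show False by auto
  qed
  have "card {a, b, c} = 3" using ne by auto
  then show "span {a, b, c} = UNIV"
    using card_eq_dim[of "{a, b, c}" UNIV] i by (simp add: dim_UNIV)  auto
qed

lemma lin_indep3_repr:
  assumes "lin_indep3 a b c"
  obtains \<alpha> \<beta> \<gamma> where "x = \<alpha> *\<^sub>R a + \<beta> *\<^sub>R b + \<gamma> *\<^sub>R c"
proof -
  have "x \<in> span {a, b, c}" using lin_indep3D(5)[OF assms] by simp
  then obtain \<alpha> \<beta> \<gamma> where "x - \<alpha> *\<^sub>R a - \<beta> *\<^sub>R b - \<gamma> *\<^sub>R c = 0"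
    unfolding span_insert span_empty by auto
  then have "x = \<alpha> *\<^sub>R a + \<beta> *\<^sub>R b + \<gamma> *\<^sub>R c" by (simp add: algebra_simps)
  then show ?thesis by (rule that)
qed

lemma lin_indep3_inner_eq:
  assumes "lin_indep3 a b c" "x \<bullet> a = z \<bullet> a" "x \<bullet> b = z \<bullet> b" "x \<bullet> c = z \<bullet> c"
  shows "x = z"
proof -
  obtain \<alpha> \<beta> \<gamma> where r: "x - z = \<alpha> *\<^sub>R a + \<beta> *\<^sub>R b + \<gamma> *\<^sub>R c" using lin_indep3_repr[OF assms(1)] .
  have "(x - z) \<bullet> (x - z) = (x - z) \<bullet> (\<alpha> *\<^sub>R a + \<beta> *\<^sub>R b + \<gamma> *\<^sub>R c)" by (simp only: r[symmetric])
  also have "\<dots> = 0" using assms by (simp add: inner_add_right inner_diff_left)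
  finally show ?thesis by simp
qed

text \<open>The linear map sending one basis to the other vectors preserves norms because norms are
  expressed by the common Gram matrix.\<close>

lemma orthogonal_transformation_gram:
  assumes ind: "lin_indep3 a b c"
    and gram: "a' \<bullet> a' = a \<bullet> a" "b' \<bullet> b' = b \<bullet> b" "c' \<bullet> c' = c \<bullet> c" "a' \<bullet> b' = a \<bullet> b" "a' \<bullet> c' = a \<bullet> c" "b' \<bullet> c' = b \<bullet> c"
  shows "\<exists>f. orthogonal_transformation f \<and> f a = a' \<and> f b = b' \<and> f c = c'"
proof -
  obtain f where f: "linear f" "\<forall>x\<in>{a, b, c}. f x = (if x = a then a' else if x = b then b' else c')"
    using linear_independent_extend[OF lin_indep3D(4)[OF ind], of "\<lambda>x. if x = a then a' else if x = b then b' else c'"] by blast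
  then have fe: "f a = a'" "f b = b'" "f c = c'" using lin_indep3D[OF ind] by auto
  have "norm (f x) = norm x" for x
  proof -
    obtain \<alpha> \<beta> \<gamma> where x: "x = \<alpha> *\<^sub>R a + \<beta> *\<^sub>R b + \<gamma> *\<^sub>R c" using lin_indep3_repr[OF ind] .
    then have "f x = \<alpha> *\<^sub>R a' + \<beta> *\<^sub>R b' + \<gamma> *\<^sub>R c'"
      using f(1) fe by (simp add: linear_add linear_scale)
    then have "f x \<bullet> f x = x \<bullet> x"
      using gram by (simp add: x inner_add_left inner_add_right inner_commute)
    then show ?thesis by (simp add: norm_eq_sqrt_inner)
  qed
  then show ?thesis using f(1) fe by (intro exI[of _ f]) (auto simp: orthogonal_transformation)
qed

text \<open>The Gram matrix with 1 on the diagonal and t elsewhere has the eigenvalues 1 - t and 1 +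
  2t. The value t = -1/2 of the equilateral triangle is the planar case.\<close>

lemma lin_indep3_equiangular:
  assumes "norm a = 1" "norm b = 1" "norm c = 1" "a \<bullet> b = t" "a \<bullet> c = t" "b \<bullet> c = t" "t \<noteq> 1" "1 + 2 * t \<noteq> 0"
  shows "lin_indep3 a b c"
  unfolding lin_indep3_def
proof (intro allI impI)
  fix \<alpha> \<beta> \<gamma> assume z: "\<alpha> *\<^sub>R a + \<beta> *\<^sub>R b + \<gamma> *\<^sub>R c = 0"
  have n: "a \<bullet> a = 1" "b \<bullet> b = 1" "c \<bullet> c = 1" using assms by (simp_all add: dot_square_norm)
  have "a \<bullet> (\<alpha> *\<^sub>R a + \<beta> *\<^sub>R b + \<gamma> *\<^sub>R c) = 0" "b \<bullet> (\<alpha> *\<^sub>R a + \<beta> *\<^sub>R b + \<gamma> *\<^sub>R c) = 0" "c \<bullet> (\<alpha> *\<^sub>R a + \<beta> *\<^sub>R b + \<gamma> *\<^sub>R c) = 0"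
    unfolding z by simp_all
  then have e: "\<alpha> + \<beta> * t + \<gamma> * t = 0" "\<alpha> * t + \<beta> + \<gamma> * t = 0" "\<alpha> * t + \<beta> * t + \<gamma> = 0"
    using assms n by (simp_all add: inner_add_right inner_commute[of b a] inner_commute[of c a] inner_commute[of c b])
  have "(\<alpha> - \<beta>) * (1 - t) = 0" "(\<alpha> - \<gamma>) * (1 - t) = 0" using e by (simp_all add: algebra_simps)
  then have eq: "\<beta> = \<alpha>" "\<gamma> = \<alpha>" using assms(7) by auto
  then have "\<alpha> * (1 + 2 * t) = 0" using e(1) by (simp add: algebra_simps)
  then show "\<alpha> = 0 \<and> \<beta> = 0 \<and> \<gamma> = 0" using assms(8) eq by simp
qed

lemma congruent_if_orthogonal:
  assumes "orthogonal_transformation f" "f ` A = B"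
  shows "congruent_sets A B"
  unfolding congruent_sets_def
proof (intro exI[of _ f] conjI allI)
  fix p q
  have "dist (f p) (f q) = norm (f (p - q))"
    using assms(1) by (simp add: dist_norm linear_diff orthogonal_transformation_def)
  then show "dist (f p) (f q) = dist p q"
    using assms(1) by (simp add: orthogonal_transformation dist_norm)
qed fact

lemma congruent_if_orthogonal_into:
  fixes y y' :: "'n::finite \<Rightarrow> real ^ 3"
  assumes f: "orthogonal_transformation f" and y: "inj y" "inj y'" and into: "\<And>i. f (y i) \<in> range y'"
  shows "congruent_sets (range y) (range y')"
proof (rule congruent_if_orthogonal[OF f])
  show "f ` range y = range y'"
  proof (rule card_subset_eq)
    have "inj f" using f by (rule orthogonal_transformation_inj)
    then show "card (f ` range y) = card (range y')"
      using y by (simp add: card_image inj_on_subset)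
  qed (use into in auto)
qed

lemma antipode_if_inner:
  fixes a b :: "real ^ 3"
  assumes "norm a = 1" "norm b = 1" "a \<bullet> b = - 1"
  shows "b = - a"
proof -
  have "(a + b) \<bullet> (a + b) = a \<bullet> a + 2 * (a \<bullet> b) + b \<bullet> b"
    by (simp add: inner_add_left inner_add_right inner_commute del: inner_eq_zero_iff)
  also have "\<dots> = 0" using assms by (simp add: dot_square_norm)
  finally have "a + b = 0" by simp
  then show ?thesis by (simp add: add_eq_0_iff)
qed

lemma frame_row:
  fixes y :: "'n::finite \<Rightarrow> real ^ 3"
  assumes y: "\<And>i. norm (y i) = 1" and P: "pow_sum 2 y = (real CARD('n))\<^sup>2 / 3"
  shows "(\<Sum>j\<in>UNIV - {i}. (y i \<bullet> y j)\<^sup>2) = real CARD('n) / 3 - 1"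
  using frame_identity[of y "y i" "y i", OF y P] y[of i]
  by (simp add: sum_diff1 power2_eq_square dot_square_norm)

text \<open>The tight frame property prescribes the row sum N/3 - 1 of squared inner products: 1 for
  N = 6 and 3 for N = 12. Without an antipode it would be 0 and 11/5.\<close>

lemma sharp_antipode:
  fixes y :: "'n::finite \<Rightarrow> real ^ 3"
  assumes s: "sharp y" and N: "CARD('n) = 6 \<or> CARD('n) = 12"
  shows "- y i \<in> range y"
proof (rule ccontr)
  assume n: "- y i \<notin> range y"
  have y: "\<And>i. norm (y i) = 1" using s by (simp add: sharp_def)
  have na: "y i \<bullet> y j \<noteq> - 1" for j using antipode_if_inner[OF y y, of i j] n by (metis rangeI)
  have card: "card (UNIV - {i}) = CARD('n) - 1" by (simp add: card_Diff_singleton)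
  from N show False
  proof
    assume N6: "CARD('n) = 6"
    have "y i \<bullet> y j = 0" if "j \<noteq> i" for j
    proof -
      have "y i \<bullet> y j \<in> {-1, 0}" using s N6 that by (auto simp: sharp_def)
      then show ?thesis using na[of j] by auto
    qed
    then have "(\<Sum>j\<in>UNIV - {i}. (y i \<bullet> y j)\<^sup>2) = (\<Sum>j\<in>UNIV - {i}. 0)"
      by (intro sum.cong) auto
    moreover have "pow_sum 2 y = (real CARD('n))\<^sup>2 / 3" using s N6 by (simp add: sharp_def)
    ultimately show False using frame_row[of y i, OF y] N6 by simp
  next
    assume N12: "CARD('n) = 12"
    have "(y i \<bullet> y j)\<^sup>2 = 1 / 5" if "j \<noteq> i" for j
    proof -
      have "y i \<bullet> y j \<in> {-1, 1 / sqrt 5, - 1 / sqrt 5}" using s N12 that by (auto simp: sharp_def)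
      then show ?thesis using na[of j] by (auto simp: power_divide)
    qed
    then have "(\<Sum>j\<in>UNIV - {i}. (y i \<bullet> y j)\<^sup>2) = (\<Sum>j\<in>UNIV - {i}. 1 / 5)"
      by (intro sum.cong) auto
    moreover have "pow_sum 2 y = (real CARD('n))\<^sup>2 / 3" using s N12 by (simp add: sharp_def)
    ultimately show False using frame_row[of y i, OF y] N12 card by simp
  qed
qed

lemma congruent_if_orthogonal_eq:
  fixes y y' :: "'n::finite \<Rightarrow> real ^ 3"
  assumes f: "orthogonal_transformation f" and eq: "\<And>i. f (y i) = y' i"
  shows "congruent_sets (range y) (range y')"
  by (rule congruent_if_orthogonal[OF f]) (auto simp: image_iff eq[symmetric])

lemma exists_index_not_in:
  fixes S :: "'n::finite set"
  assumes "card S < CARD('n)"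
  obtains i where "i \<notin> S"
  using assms by (metis UNIV_eq_I less_irrefl)

lemma simplex_sum:
  fixes y :: "'n::finite \<Rightarrow> real ^ 3"
  assumes N: "2 \<le> CARD('n)" and y: "\<And>i. norm (y i) = 1" and t: "\<And>i j. i \<noteq> j \<Longrightarrow> y i \<bullet> y j = - 1 / (real CARD('n) - 1)"
  shows "(\<Sum>i\<in>UNIV. y i) = 0"
proof -
  have "(\<Sum>p\<in>offdiag. off_inner y p ^ 1) = (\<Sum>p\<in>(offdiag :: ('n \<times> 'n) set). - 1 / (real CARD('n) - 1))"
    using t by (intro sum.cong) (auto simp: offdiag_def)
  also have "\<dots> = - real CARD('n)"
    unfolding sum_offdiag_const using N by (simp add: power2_eq_square field_simps)
  finally have "pow_sum 1 y = 0" using sum_offdiag_inner_power[of y 1, OF y] by simp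
  then show ?thesis by (simp only: pow_sum_1) simp
qed

text \<open>The points sum to zero, so an orthogonal map that matches all but one of them matches
  the last one too.\<close>

lemma simplex_congruent:
  fixes y y' :: "'n::finite \<Rightarrow> real ^ 3"
  assumes N: "CARD('n) \<in> {2, 3, 4}"
    and y: "\<And>i. norm (y i) = 1" "\<And>i j. i \<noteq> j \<Longrightarrow> y i \<bullet> y j = - 1 / (real CARD('n) - 1)"
    and y': "\<And>i. norm (y' i) = 1" "\<And>i j. i \<noteq> j \<Longrightarrow> y' i \<bullet> y' j = - 1 / (real CARD('n) - 1)"
  shows "congruent_sets (range y) (range y')"
proof -
  have N2: "2 \<le> CARD('n)" using N by auto
  have sum0: "(\<Sum>i\<in>UNIV. y i) = 0" "(\<Sum>i\<in>UNIV. y' i) = 0"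
    using simplex_sum[of y, OF N2 y] simplex_sum[of y', OF N2 y'] by auto
  have last: "f (y l) = y' l"
    if f: "orthogonal_transformation f" and S: "\<And>i. i \<noteq> l \<Longrightarrow> f (y i) = y' i" for f l
  proof -
    have lin: "linear f" using f by (simp add: orthogonal_transformation_def)
    have "f (y l) = f (- (\<Sum>i\<in>UNIV - {l}. y i))" using sum0(1) by (simp add: sum.remove[of UNIV l] add_eq_0_iff2)
    also have "\<dots> = - (\<Sum>i\<in>UNIV - {l}. f (y i))" using lin by (simp add: linear_neg linear_sum)
    also have "\<dots> = - (\<Sum>i\<in>UNIV - {l}. y' i)" using S by simp
    also have "\<dots> = y' l" using sum0(2) by (simp add: sum.remove[of UNIV l] add_eq_0_iff2)
    finally show ?thesis .
  qed
  define t where "t = - 1 / (real CARD('n) - 1)"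
  obtain i :: 'n where True by blast
  obtain j where j: "j \<notin> {i}" by (rule exists_index_not_in[of "{i}"]) (use N in auto)
  from N consider "CARD('n) = 2" | "CARD('n) = 3" | "CARD('n) = 4" by auto
  then show ?thesis
  proof cases
    case 1
    obtain f :: "real ^ 3 \<Rightarrow> real ^ 3" where f: "orthogonal_transformation f" "f (y i) = y' i"
      using orthogonal_transformation_exists[of "y i" "y' i"] y y' by metis
    have U: "m = i \<or> m = j" for m
    proof -
      have "card {i, j} = CARD('n)" using 1 j by auto
      then have "{i, j} = UNIV" by (simp add: card_eq_UNIV_imp_eq_UNIV)
      then show ?thesis by auto
    qed
    have "f (y j) = y' j" by (rule last[OF f(1)]) (use U f in metis)
    then have "f (y m) = y' m" for m using U[of m] f by auto
    then show ?thesis by (rule congruent_if_orthogonal_eq[OF f(1)])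
  next
    case 2
    obtain k where k: "k \<notin> {i, j}" by (rule exists_index_not_in[of "{i, j}"]) (use 2 j in auto)
    have U: "m = i \<or> m = j \<or> m = k" for m
    proof -
      have "card {i, j, k} = CARD('n)" using 2 j k by auto
      then have "{i, j, k} = UNIV" by (simp add: card_eq_UNIV_imp_eq_UNIV)
      then show ?thesis by auto
    qed
    have t: "y i \<bullet> y j = - 1 / 2" "y' i \<bullet> y' j = - 1 / 2" using y(2)[of i j] y'(2)[of i j] 2 j by auto
    \<comment> \<open>Three points on a great circle span only a plane; the normals, of equal
      length, complete them to bases with the same Gram matrix.\<close>
    define n where "n = cross3 (y i) (y j)"
    define n' where "n' = cross3 (y' i) (y' j)"
    have nn: "n \<bullet> n = 3 / 4" "n' \<bullet> n' = 3 / 4"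
      using norm_cross_dot[of "y i" "y j"] norm_cross_dot[of "y' i" "y' j"] t y(1) y'(1)
      by (simp_all add: n_def n'_def dot_square_norm power2_eq_square)
    have on: "y i \<bullet> n = 0" "y j \<bullet> n = 0" "y' i \<bullet> n' = 0" "y' j \<bullet> n' = 0"
      by (simp_all add: n_def n'_def dot_cross_self)
    have unit: "y i \<bullet> y i = 1" "y j \<bullet> y j = 1" "y' i \<bullet> y' i = 1" "y' j \<bullet> y' j = 1" using y y' by (simp_all add: dot_square_norm)
    have "lin_indep3 (y i) (y j) n"
      unfolding lin_indep3_def
    proof (intro allI impI)
      fix \<alpha> \<beta> \<gamma> assume z: "\<alpha> *\<^sub>R y i + \<beta> *\<^sub>R y j + \<gamma> *\<^sub>R n = 0"
      have "y i \<bullet> (\<alpha> *\<^sub>R y i + \<beta> *\<^sub>R y j + \<gamma> *\<^sub>R n) = 0" "y j \<bullet> (\<alpha> *\<^sub>R y i + \<beta> *\<^sub>R y j + \<gamma> *\<^sub>R n) = 0" "n \<bullet> (\<alpha> *\<^sub>R y i + \<beta> *\<^sub>R y j + \<gamma> *\<^sub>R n) = 0"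
        unfolding z by simp_all
      moreover have "n \<bullet> y i = 0" "n \<bullet> y j = 0" "y j \<bullet> y i = - 1 / 2" using on t by (simp_all add: inner_commute)
      ultimately have "\<alpha> - \<beta> / 2 = 0" "\<beta> - \<alpha> / 2 = 0" "\<gamma> * (3 / 4) = 0"
        by (simp_all add: inner_add_right t on unit nn)
      then show "\<alpha> = 0 \<and> \<beta> = 0 \<and> \<gamma> = 0" by auto
    qed
    then have "\<exists>f. orthogonal_transformation f \<and> f (y i) = y' i \<and> f (y j) = y' j \<and> f n = n'"
      by (rule orthogonal_transformation_gram) (use t on unit nn in auto)
    then obtain f where f: "orthogonal_transformation f" "f (y i) = y' i" "f (y j) = y' j" by blast
    have "f (y k) = y' k" by (rule last[OF f(1)]) (use U f in metis)
    then have "f (y m) = y' m" for m using U[of m] f by auto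
    then show ?thesis by (rule congruent_if_orthogonal_eq[OF f(1)])
  next
    case 3
    obtain k where k: "k \<notin> {i, j}" by (rule exists_index_not_in[of "{i, j}"]) (use 3 j in auto)
    have "card {i, j, k} < CARD('n)" using 3 j k by auto
    then obtain l where l: "l \<notin> {i, j, k}" by (rule exists_index_not_in)
    have U: "m = i \<or> m = j \<or> m = k \<or> m = l" for m
    proof -
      have "card {i, j, k, l} = CARD('n)" using 3 j k l by auto
      then have "{i, j, k, l} = UNIV" by (simp add: card_eq_UNIV_imp_eq_UNIV)
      then show ?thesis by auto
    qed
    have t: "y i \<bullet> y j = - 1 / 3" "y i \<bullet> y k = - 1 / 3" "y j \<bullet> y k = - 1 / 3"
      "y' i \<bullet> y' j = - 1 / 3" "y' i \<bullet> y' k = - 1 / 3" "y' j \<bullet> y' k = - 1 / 3"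
      using y(2) y'(2) 3 j k by auto
    have "lin_indep3 (y i) (y j) (y k)"
      by (rule lin_indep3_equiangular[OF y(1) y(1) y(1) t(1-3)]) auto
    then have "\<exists>f. orthogonal_transformation f \<and> f (y i) = y' i \<and> f (y j) = y' j \<and> f (y k) = y' k"
      by (rule orthogonal_transformation_gram) (simp_all add: t y(1) y'(1) dot_square_norm)
    then obtain f where f: "orthogonal_transformation f" "f (y i) = y' i" "f (y j) = y' j" "f (y k) = y' k" by blast
    have "f (y l) = y' l" by (rule last[OF f(1)]) (use U f in metis)
    then have "f (y m) = y' m" for m using U[of m] f by auto
    then show ?thesis by (rule congruent_if_orthogonal_eq[OF f(1)])
  qed
qed

lemma exists_range_not_in:
  fixes y :: "'n::finite \<Rightarrow> 'a"
  assumes "inj y" "finite S" "card S < CARD('n)"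
  obtains i where "y i \<notin> S"
proof -
  have "\<not> range y \<subseteq> S"
    using card_mono[OF assms(2), of "range y"] assms(1,3) by (auto simp: card_image)
  then show ?thesis using that by blast
qed

lemma card_le_list: "card (set xs) \<le> length xs"
  by (rule card_length)

text \<open>Two points are equal, antipodal or orthogonal. Picking a point outside the antipodal
  pairs already found yields an orthogonal basis, and a further point would be orthogonal to all of
  it.\<close>

lemma octahedron_basis:
  fixes y :: "'n::finite \<Rightarrow> real ^ 3"
  assumes s: "sharp y" and N: "CARD('n) = 6"
  obtains a b c where "a \<in> range y" "b \<in> range y" "c \<in> range y" "a \<bullet> b = 0" "a \<bullet> c = 0" "b \<bullet> c = 0"
    "range y \<subseteq> {a, - a, b, - b, c, - c}"
proof -
  have y: "\<And>i. norm (y i) = 1" using s by (simp add: sharp_def)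
  have inj: "inj y" by (rule sharp_inj[OF s])
  have node: "y i = y j \<or> y i = - y j \<or> y i \<bullet> y j = 0" for i j
  proof (cases "i = j")
    case False
    then have "y i \<bullet> y j = - 1 \<or> y i \<bullet> y j = 0" using s N by (auto simp: sharp_def)
    then show ?thesis using antipode_if_inner[OF y y, of j i] by (auto simp: inner_commute)
  qed simp
  obtain i :: 'n where True by blast
  define a where "a = y i"
  have "card {a, - a} < CARD('n)" using card_le_list[of "[a, -a]"] N by simp
  then obtain j where j: "y j \<notin> {a, - a}" using exists_range_not_in[OF inj, of "{a, - a}"] by blast
  define b where "b = y j"
  have "card {a, - a, b, - b} < CARD('n)" using card_le_list[of "[a, -a, b, -b]"] N by simp
  then obtain k where k: "y k \<notin> {a, - a, b, - b}" using exists_range_not_in[OF inj, of "{a, - a, b, - b}"] by blast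
  define c where "c = y k"
  have "b \<bullet> a = 0" using node[of j i] j unfolding a_def b_def by blast
  moreover have "c \<bullet> a = 0" "c \<bullet> b = 0" using node[of k i] node[of k j] k unfolding a_def b_def c_def by blast+
  ultimately have o: "a \<bullet> b = 0" "a \<bullet> c = 0" "b \<bullet> c = 0" by (simp_all add: inner_commute)
  have ind: "lin_indep3 a b c"
    by (rule lin_indep3_equiangular[OF _ _ _ o]) (simp_all add: a_def b_def c_def y)
  have "y m \<in> {a, - a, b, - b, c, - c}" for m
  proof (rule ccontr)
    assume "y m \<notin> {a, - a, b, - b, c, - c}"
    then have "y m \<bullet> a = 0" "y m \<bullet> b = 0" "y m \<bullet> c = 0"
      using node[of m i] node[of m j] node[of m k] by (auto simp: a_def b_def c_def)
    then have "y m = 0" by (intro lin_indep3_inner_eq[OF ind]) auto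
    then show False using y[of m] by simp
  qed
  then show ?thesis using that[of a b c] o by (auto simp: a_def b_def c_def)
qed

lemma octahedron_congruent:
  fixes y y' :: "'n::finite \<Rightarrow> real ^ 3"
  assumes s: "sharp y" "sharp y'" and N: "CARD('n) = 6"
  shows "congruent_sets (range y) (range y')"
proof -
  obtain a b c where r: "a \<in> range y" "b \<in> range y" "c \<in> range y" "a \<bullet> b = 0" "a \<bullet> c = 0" "b \<bullet> c = 0"
    "range y \<subseteq> {a, - a, b, - b, c, - c}" by (rule octahedron_basis[OF s(1) N])
  obtain a' b' c' where r': "a' \<in> range y'" "b' \<in> range y'" "c' \<in> range y'" "a' \<bullet> b' = 0" "a' \<bullet> c' = 0" "b' \<bullet> c' = 0"
    "range y' \<subseteq> {a', - a', b', - b', c', - c'}" by (rule octahedron_basis[OF s(2) N])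
  have u: "norm a = 1" "norm b = 1" "norm c = 1" "norm a' = 1" "norm b' = 1" "norm c' = 1"
    using r r' s by (auto simp: sharp_def)
  have "lin_indep3 a b c" by (rule lin_indep3_equiangular[where t = 0]) (auto simp: r u)
  then have "\<exists>f. orthogonal_transformation f \<and> f a = a' \<and> f b = b' \<and> f c = c'"
    by (rule orthogonal_transformation_gram) (simp_all add: r r' u dot_square_norm)
  then obtain f where f: "orthogonal_transformation f" "f a = a'" "f b = b'" "f c = c'" by blast
  have lin: "linear f" using f by (simp add: orthogonal_transformation_def)
  have neg: "- x \<in> range y'" if "x \<in> range y'" for x
    using that sharp_antipode[OF s(2)] N by auto
  have "f (y i) \<in> range y'" for i
  proof -
    have "y i \<in> {a, - a, b, - b, c, - c}" using r(7) by auto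
    then show ?thesis using r' neg f by (auto simp: linear_neg[OF lin])
  qed
  then show ?thesis using congruent_if_orthogonal_into[OF f(1)] sharp_inj s by blast
qed

definition ico :: real where
  "ico = 1 / sqrt 5"

lemma ico_props: "ico\<^sup>2 = 1 / 5" "ico * ico = 1 / 5" "0 < ico" "ico < 1"
  by (simp_all add: ico_def power_divide)

lemma sharp_12_iff:
  fixes y :: "'n::finite \<Rightarrow> real ^ 3"
  assumes "CARD('n) = 12"
  shows "sharp y \<longleftrightarrow> (\<forall>i. norm (y i) = 1) \<and> (\<forall>i j. i \<noteq> j \<longrightarrow> y i \<bullet> y j \<in> {-1, ico, - ico}) \<and>
    pow_sum 1 y = 0 \<and> pow_sum 2 y = 48"
  by (simp add: sharp_def assms ico_def)

lemma sharp_6_iff: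
  fixes y :: "'n::finite \<Rightarrow> real ^ 3"
  assumes "CARD('n) = 6"
  shows "sharp y \<longleftrightarrow> (\<forall>i. norm (y i) = 1) \<and> (\<forall>i j. i \<noteq> j \<longrightarrow> y i \<bullet> y j \<in> {-1, 0}) \<and>
    pow_sum 1 y = 0 \<and> pow_sum 2 y = 12"
  by (simp add: sharp_def assms)

lemma unit_neq_uminus:
  fixes p :: "real ^ 3"
  assumes "p \<bullet> p = 1"
  shows "p \<noteq> - p"
proof
  assume "p = - p"
  then have "p \<bullet> p = - (p \<bullet> p)" by (metis inner_minus_right)
  then show False using assms by simp
qed

lemma inner_ico_neq:
  fixes p q :: "real ^ 3"
  assumes "p \<bullet> p = 1" "p \<bullet> q = ico"
  shows "q \<noteq> p" "q \<noteq> - p"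
  using assms ico_props by auto

lemma icosahedron_node:
  fixes y :: "'n::finite \<Rightarrow> real ^ 3"
  assumes s: "sharp y" and N: "CARD('n) = 12" and "p \<in> range y" "q \<in> range y" "q \<noteq> p" "q \<noteq> - p"
  shows "p \<bullet> q = ico \<or> p \<bullet> q = - ico"
proof -
  obtain i j where ij: "p = y i" "q = y j" using assms by blast
  have "p \<bullet> q \<in> {-1, ico, - ico}" 
  proof -
    have "i \<noteq> j" using ij assms(5) by blast
    then show ?thesis using s unfolding sharp_12_iff[OF N] ij by blast
  qed
  moreover have "p \<bullet> q \<noteq> - 1" using antipode_if_inner[of p q] s assms(6) ij by (auto simp: sharp_def)
  ultimately show ?thesis by auto
qed

lemma icosahedron_frame:
  fixes y :: "'n::finite \<Rightarrow> real ^ 3"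
  assumes s: "sharp y" and N: "CARD('n) = 12"
  shows "(\<Sum>x\<in>range y. (p \<bullet> x) * (q \<bullet> x)) = 4 * (p \<bullet> q)"
proof -
  have y: "\<And>i. norm (y i) = 1" using s by (simp add: sharp_def)
  have "pow_sum 2 y = (real CARD('n))\<^sup>2 / 3" using s N by (simp add: sharp_def)
  from frame_identity[of y p q, OF y this] show ?thesis
    using sharp_inj[OF s] N by (simp add: sum.reindex)
qed

text \<open>Replacing points by their antipodes, it suffices to find a third point whose products
  with \<open>a\<close> and \<open>b\<close> have the same sign; the frame identity supplies
  it.\<close>

lemma icosahedron_triple:
  fixes y :: "'n::finite \<Rightarrow> real ^ 3"
  assumes s: "sharp y" and N: "CARD('n) = 12"
  obtains a b c where "a \<in> range y" "b \<in> range y" "c \<in> range y" "a \<bullet> b = ico" "a \<bullet> c = ico" "b \<bullet> c = ico"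
proof -
  have inj: "inj y" by (rule sharp_inj[OF s])
  have unit: "p \<bullet> p = 1" if "p \<in> range y" for p using that s by (auto simp: sharp_def dot_square_norm)
  have neg: "- p \<in> range y" if "p \<in> range y" for p using that sharp_antipode[OF s] N by auto
  note node = icosahedron_node[OF s N]
  obtain a where a: "a \<in> range y" by blast
  have "card {a, - a} < CARD('n)" using card_le_list[of "[a, -a]"] N by simp
  then obtain j where "y j \<notin> {a, - a}" using exists_range_not_in[OF inj, of "{a, - a}"] by blast
  then have "a \<bullet> y j = ico \<or> a \<bullet> (- y j) = ico" using node[OF a, of "y j"] by auto
  then obtain b where b: "b \<in> range y" "a \<bullet> b = ico" using neg by blast
  have ne: "b \<noteq> a" "b \<noteq> - a" "a \<noteq> - a" "b \<noteq> - b"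
    using unit_neq_uminus[OF unit[OF a]] unit_neq_uminus[OF unit[OF b(1)]] unit[OF a] b(2) ico_props by auto
  define D where "D = {a, - a, b, - b}"
  have D: "D \<subseteq> range y" "finite D" using a b neg by (auto simp: D_def)
  have cD: "card D = 4" using ne by (auto simp: D_def card_insert_if)
  \<comment> \<open>The four points of \<open>D\<close> alone contribute 4 \<open>ico\<close>, the
    full frame sum. If the signs disagreed at all eight other points, these would contribute -8/5 in
    addition.\<close>
  have "\<exists>x \<in> range y - D. (a \<bullet> x) * (b \<bullet> x) \<noteq> - 1 / 5"
  proof (rule ccontr)
    assume "\<not> ?thesis"
    then have "(\<Sum>x\<in>range y - D. (a \<bullet> x) * (b \<bullet> x)) = (\<Sum>x\<in>range y - D. - 1 / 5)"
      by (intro sum.cong) auto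
    also have "\<dots> = real (card (range y - D)) * (- 1 / 5)" by simp
    also have "card (range y - D) = 8" using D cD inj N by (simp add: card_Diff_subset card_image)
    finally have rest: "(\<Sum>x\<in>range y - D. (a \<bullet> x) * (b \<bullet> x)) = - 8 / 5" by simp
    have notin: "a \<notin> {- a, b, - b}" "- a \<notin> {b, - b}" "b \<notin> {- b}"
      using ne by (metis insert_iff empty_iff minus_minus)+
    have "(\<Sum>x\<in>D. (a \<bullet> x) * (b \<bullet> x)) =
        (a \<bullet> a) * (b \<bullet> a) + ((a \<bullet> - a) * (b \<bullet> - a) + ((a \<bullet> b) * (b \<bullet> b) + (a \<bullet> - b) * (b \<bullet> - b)))"
      unfolding D_def
      by (simp only: sum.insert[OF _ notin(1)] sum.insert[OF _ notin(2)] sum.insert[OF _ notin(3)] finite.intros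
          sum.insert[OF finite.emptyI] empty_iff not_False_eq_True sum.empty add_0_right)
    also have "\<dots> = 4 * ico"
      using unit[OF a] unit[OF b(1)] b(2) by (simp add: inner_commute[of b a])
    finally have "(\<Sum>x\<in>D. (a \<bullet> x) * (b \<bullet> x)) = 4 * ico" .
    then have "4 * ico = - 8 / 5 + 4 * ico"
      using icosahedron_frame[OF s N, of a b] sum.subset_diff[OF D(1), of "\<lambda>x. (a \<bullet> x) * (b \<bullet> x)"] rest b(2) by simp
    then show False by simp
  qed
  then obtain x where x: "x \<in> range y" "x \<notin> D" "(a \<bullet> x) * (b \<bullet> x) \<noteq> - 1 / 5" by blast
  have xa: "a \<bullet> x = ico \<or> a \<bullet> x = - ico" and xb: "b \<bullet> x = ico \<or> b \<bullet> x = - ico"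
    using node[OF a x(1)] node[OF b(1) x(1)] x(2) by (auto simp: D_def)
  then have "a \<bullet> x = ico \<and> b \<bullet> x = ico \<or> a \<bullet> (- x) = ico \<and> b \<bullet> (- x) = ico"
    using x(3) ico_props(2) by auto
  then obtain c where "c \<in> range y" "a \<bullet> c = ico" "b \<bullet> c = ico" using x(1) neg by blast
  then show ?thesis using that a b by blast
qed

text \<open>
  Three points with pairwise inner products \<open>ico\<close> form a basis. A unit vector with all three inner products
  equal to \<open>ico\<close> does not exist, so the remaining six points are told apart by the six
  other sign patterns that are not constant.
\<close>

lemma icosahedron_no_constant_pattern:
  fixes a b c w :: "real ^ 3"
  assumes "norm a = 1" "norm b = 1" "norm c = 1" "norm w = 1" "a \<bullet> b = ico" "a \<bullet> c = ico" "b \<bullet> c = ico"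
    and "w \<bullet> a = w \<bullet> b" "w \<bullet> a = w \<bullet> c" "(w \<bullet> a)\<^sup>2 = 1 / 5"
  shows False
proof -
  have ind: "lin_indep3 a b c"
    by (rule lin_indep3_equiangular[OF assms(1,2,3,5,6,7)]) (use ico_props in auto)
  define r where "r = (w \<bullet> a) / (1 + 2 * ico)"
  have pos: "1 + 2 * ico > 0" using ico_props by linarith
  have u: "a \<bullet> a = 1" "b \<bullet> b = 1" "c \<bullet> c = 1" "w \<bullet> w = 1" using assms by (simp_all add: dot_square_norm)
  define v where "v = a + b + c"
  have v: "v \<bullet> a = 1 + 2 * ico" "v \<bullet> b = 1 + 2 * ico" "v \<bullet> c = 1 + 2 * ico"
    using u assms by (simp_all add: v_def inner_add_left inner_commute[of b a] inner_commute[of c a] inner_commute[of c b])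
  \<comment> \<open>Equal products force w to be a multiple of a + b + c; unit length then leads to
    1 + 2 \<open>ico\<close> = 3/5, impossible for positive \<open>ico\<close>.\<close>
  have "w = r *\<^sub>R v"
    by (rule lin_indep3_inner_eq[OF ind]) (use v pos assms in \<open>simp_all add: r_def\<close>)
  then have "w \<bullet> w = r * (v \<bullet> w)" by simp
  also have "v \<bullet> w = w \<bullet> v" by (rule inner_commute)
  also have "w \<bullet> v = 3 * (w \<bullet> a)" using assms by (simp add: v_def inner_add_right)
  finally have ww: "1 = r * (3 * (w \<bullet> a))" using u by simp
  have rr: "r * (1 + 2 * ico) = w \<bullet> a" using pos by (simp add: r_def)
  have "1 + 2 * ico = (r * (3 * (w \<bullet> a))) * (1 + 2 * ico)" by (simp only: ww[symmetric] mult_1)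
  also have "\<dots> = (r * (1 + 2 * ico)) * (3 * (w \<bullet> a))" by (simp only: mult.assoc mult.commute mult.left_commute)
  also have "\<dots> = 3 * (w \<bullet> a)\<^sup>2" unfolding rr by (simp add: power2_eq_square)
  finally have "1 + 2 * ico = 3 / 5" using assms(10) by simp
  then show False using ico_props by linarith
qed

text \<open>The products with a basis determine a point, so six points fill six admissible patterns.
  The set \<open>T\<close> does not mention the configuration, which makes points of two
  configurations correspond.\<close>

lemma icosahedron_patterns:
  fixes y :: "'n::finite \<Rightarrow> real ^ 3"
  assumes s: "sharp y" and N: "CARD('n) = 12"
    and abc: "a \<in> range y" "b \<in> range y" "c \<in> range y" "a \<bullet> b = ico" "a \<bullet> c = ico" "b \<bullet> c = ico"
  defines "R \<equiv> range y - {a, - a, b, - b, c, - c}"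
    and "T \<equiv> {ico, - ico} \<times> {ico, - ico} \<times> {ico, - ico} - {(ico, ico, ico), (- ico, - ico, - ico)}"
  shows "(\<lambda>w. (w \<bullet> a, w \<bullet> b, w \<bullet> c)) ` R = T"
proof -
  have inj: "inj y" by (rule sharp_inj[OF s])
  have norm: "norm p = 1" if "p \<in> range y" for p using that s by (auto simp: sharp_def)
  then have unit: "p \<bullet> p = 1" if "p \<in> range y" for p using that by (simp add: dot_square_norm)
  have neg: "- p \<in> range y" if "p \<in> range y" for p using that sharp_antipode[OF s] N by auto
  have ind: "lin_indep3 a b c"
    by (rule lin_indep3_equiangular[OF _ _ _ abc(4,5,6)]) (use ico_props norm abc in auto)
  have i0: "ico \<noteq> - ico" and ico0: "ico \<noteq> 0" using ico_props by simp_all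
  have sub: "(\<lambda>w. (w \<bullet> a, w \<bullet> b, w \<bullet> c)) ` R \<subseteq> T"
  proof (rule image_subsetI)
    fix w assume w: "w \<in> R"
    then have wr: "w \<in> range y" by (simp add: R_def)
    have n: "w \<bullet> a = ico \<or> w \<bullet> a = - ico" "w \<bullet> b = ico \<or> w \<bullet> b = - ico" "w \<bullet> c = ico \<or> w \<bullet> c = - ico"
      using icosahedron_node[OF s N abc(1) wr] icosahedron_node[OF s N abc(2) wr] icosahedron_node[OF s N abc(3) wr] w
      by (auto simp: R_def inner_commute[of w])
    have "(w \<bullet> a)\<^sup>2 = 1 / 5" using n(1) ico_props(1) by auto
    then have "\<not> (w \<bullet> a = w \<bullet> b \<and> w \<bullet> a = w \<bullet> c)"
      using icosahedron_no_constant_pattern[of a b c w] norm abc wr by blast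
    with n show "(w \<bullet> a, w \<bullet> b, w \<bullet> c) \<in> T"
      by (elim disjE) (simp_all add: T_def ico0)
  qed
  have inj': "inj_on (\<lambda>w. (w \<bullet> a, w \<bullet> b, w \<bullet> c)) R"
    by (intro inj_onI lin_indep3_inner_eq[OF ind]) auto
  have ne: "b \<noteq> a" "b \<noteq> - a" "c \<noteq> a" "c \<noteq> - a" "c \<noteq> b" "c \<noteq> - b" "a \<noteq> - a" "b \<noteq> - b" "c \<noteq> - c"
    by (fact unit_neq_uminus[OF unit[OF abc(1)]] unit_neq_uminus[OF unit[OF abc(2)]] unit_neq_uminus[OF unit[OF abc(3)]]
      inner_ico_neq[OF unit[OF abc(1)] abc(4)] inner_ico_neq[OF unit[OF abc(1)] abc(5)] inner_ico_neq[OF unit[OF abc(2)] abc(6)])+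
  then have "card {a, - a, b, - b, c, - c} = 6" by (auto simp: card_insert_if)
  then have "card R = 6"
    unfolding R_def using abc neg inj N by (subst card_Diff_subset) (auto simp: card_image)
  then have "card ((\<lambda>w. (w \<bullet> a, w \<bullet> b, w \<bullet> c)) ` R) = 6" using inj' by (simp add: card_image)
  moreover have "card T = 6"
  proof -
    have "card ({ico, - ico} \<times> {ico, - ico} \<times> {ico, - ico}) = 8" using i0 by (simp add: card_cartesian_product)
    then show ?thesis unfolding T_def using i0 by (subst card_Diff_subset) auto
  qed
  moreover have "finite T" by (simp add: T_def)
  ultimately show ?thesis using sub by (intro card_subset_eq) auto
qed

lemma icosahedron_congruent:
  fixes y y' :: "'n::finite \<Rightarrow> real ^ 3"
  assumes s: "sharp y" "sharp y'" and N: "CARD('n) = 12"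
  shows "congruent_sets (range y) (range y')"
proof -
  obtain a b c where r: "a \<in> range y" "b \<in> range y" "c \<in> range y" "a \<bullet> b = ico" "a \<bullet> c = ico" "b \<bullet> c = ico"
    by (rule icosahedron_triple[OF s(1) N])
  obtain a' b' c' where r': "a' \<in> range y'" "b' \<in> range y'" "c' \<in> range y'" "a' \<bullet> b' = ico" "a' \<bullet> c' = ico" "b' \<bullet> c' = ico"
    by (rule icosahedron_triple[OF s(2) N])
  have u: "norm a = 1" "norm b = 1" "norm c = 1" "norm a' = 1" "norm b' = 1" "norm c' = 1"
    using r r' s by (auto simp: sharp_def)
  have t: "ico \<noteq> 1" "1 + 2 * ico \<noteq> 0" using ico_props by auto
  have ind: "lin_indep3 a b c" by (rule lin_indep3_equiangular[OF u(1,2,3) r(4,5,6) t])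
  have ind': "lin_indep3 a' b' c'" by (rule lin_indep3_equiangular[OF u(4,5,6) r'(4,5,6) t])
  have "\<exists>f. orthogonal_transformation f \<and> f a = a' \<and> f b = b' \<and> f c = c'"
    using ind by (rule orthogonal_transformation_gram) (simp_all only: r r' u dot_square_norm)
  then obtain f where f: "orthogonal_transformation f" "f a = a'" "f b = b'" "f c = c'" by blast
  have lin: "linear f" using f by (simp add: orthogonal_transformation_def)
  have neg: "- x \<in> range y'" if "x \<in> range y'" for x
    using that sharp_antipode[OF s(2)] N by auto
  have "f w \<in> range y'" if w: "w \<in> range y" for w
  proof (cases "w \<in> {a, - a, b, - b, c, - c}")
    case True
    then show ?thesis using r' neg f by (auto simp: linear_neg[OF lin])
  next
    case False
    \<comment> \<open>The pattern of w also occurs in \<open>y'\<close>; the point realising it must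
      be the image of w, since both have the same products with a basis.\<close>
    then have "(w \<bullet> a, w \<bullet> b, w \<bullet> c) \<in> (\<lambda>w. (w \<bullet> a, w \<bullet> b, w \<bullet> c)) ` (range y - {a, - a, b, - b, c, - c})"
      using w by blast
    then have "(w \<bullet> a, w \<bullet> b, w \<bullet> c) \<in> (\<lambda>w. (w \<bullet> a', w \<bullet> b', w \<bullet> c')) ` (range y' - {a', - a', b', - b', c', - c'})"
      unfolding icosahedron_patterns[OF s(1) N r] icosahedron_patterns[OF s(2) N r'] .
    then obtain w' where w': "w' \<in> range y'" "w \<bullet> a = w' \<bullet> a'" "w \<bullet> b = w' \<bullet> b'" "w \<bullet> c = w' \<bullet> c'" by auto
    have "f w \<bullet> f z = w \<bullet> z" for z using f(1) by (simp add: orthogonal_transformation_def)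
    then have "f w \<bullet> a' = w \<bullet> a" "f w \<bullet> b' = w \<bullet> b" "f w \<bullet> c' = w \<bullet> c" using f(2-4) by metis+
    then have "f w = w'" by (intro lin_indep3_inner_eq[OF ind']) (simp_all add: w')
    then show ?thesis using w' by simp
  qed
  then show ?thesis using congruent_if_orthogonal_into[OF f(1)] sharp_inj s by blast
qed

lemma sharp_congruent:
  fixes y y' :: "'n::finite \<Rightarrow> real ^ 3"
  assumes s: "sharp y" "sharp y'"
  shows "congruent_sets (range y) (range y')"
proof -
  have "CARD('n) \<in> {2, 3, 4} \<or> CARD('n) = 6 \<or> CARD('n) = 12" using s(1) by (auto simp: sharp_def)
  then show ?thesis
    using octahedron_congruent[OF s] icosahedron_congruent[OF s] simplex_congruent[of y y'] s
    unfolding sharp_def by auto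
qed

text \<open>\<open>sharp\<close> depends only on the Gram matrix up to relabelling of the
  points.\<close>

lemma sharp_reindex:
  fixes y z :: "'n::finite \<Rightarrow> real ^ 3"
  assumes s: "sharp z" and \<pi>: "bij \<pi>" and gram: "\<And>i j. y i \<bullet> y j = z (\<pi> i) \<bullet> z (\<pi> j)"
  shows "sharp y"
proof -
  have n: "norm (y i) = norm (z (\<pi> i))" for i by (simp add: norm_eq_sqrt_inner gram)
  have P: "pow_sum k y = pow_sum k z" for k
    unfolding pow_sum_def gram
    using sum.reindex_bij_betw[OF \<pi>, of "\<lambda>i. \<Sum>j\<in>UNIV. (z i \<bullet> z j) ^ k"] sum.reindex_bij_betw[OF \<pi>, of "\<lambda>j. (z (\<pi> _) \<bullet> z j) ^ k"]
    by simp
  have "\<pi> i \<noteq> \<pi> j" if "i \<noteq> j" for i j using that \<pi> by (auto dest: bij_is_inj injD)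
  then have "\<forall>i j. i \<noteq> j \<longrightarrow> y i \<bullet> y j \<in> S" if "\<forall>i j. i \<noteq> j \<longrightarrow> z i \<bullet> z j \<in> S" for S
    using that unfolding gram by blast
  note node = this[of "{- 1 / (real CARD('n) - 1)}", unfolded singleton_iff] this[of "{-1, 0}"] this[of "{-1, 1 / sqrt 5, - 1 / sqrt 5}"]
  from s show ?thesis unfolding sharp_def P
    by (elim conj_forward disj_forward) (assumption | erule node | simp add: n)+
qed

text \<open>The isometry is not assumed to fix the origin. Inner products of unit vectors are
  nevertheless functions of their distances, so the Gram matrices agree up to relabelling.\<close>

lemma sharp_if_congruent:
  fixes y y' :: "'n::finite \<Rightarrow> real ^ 3"
  assumes s: "sharp y'" and y: "\<And>i. norm (y i) = 1" "inj y" and c: "congruent_sets (range y) (range y')"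
  shows "sharp y"
proof -
  obtain f :: "real ^ 3 \<Rightarrow> real ^ 3" where f: "\<And>p q. dist (f p) (f q) = dist p q" "f ` range y = range y'"
    using c by (auto simp: congruent_sets_def)
  have inj': "inj y'" by (rule sharp_inj[OF s])
  define \<pi> where "\<pi> i = inv y' (f (y i))" for i
  have \<pi>: "y' (\<pi> i) = f (y i)" for i
    unfolding \<pi>_def by (rule f_inv_into_f) (use f(2) in auto)
  have "inj \<pi>"
  proof (rule injI)
    fix i j assume "\<pi> i = \<pi> j"
    then have "f (y i) = f (y j)" using \<pi> by metis
    then have "dist (y i) (y j) = 0" using f(1)[of "y i" "y j"] by simp
    then show "i = j" using y(2) by (auto dest: injD)
  qed
  then have "bij \<pi>" by (simp add: bij_def finite_UNIV_inj_surj)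
  moreover have "y i \<bullet> y j = y' (\<pi> i) \<bullet> y' (\<pi> j)" for i j
  proof -
    have i: "p \<bullet> q = 1 - (dist p q)\<^sup>2 / 2" if "norm p = 1" "norm q = 1" for p q :: "real ^ 3"
      using that by (simp add: dist_norm power2_norm_eq_inner inner_diff_left inner_diff_right inner_commute) (simp add: dot_square_norm diff_divide_distrib)
    have "norm (y' k) = 1" for k using s by (simp add: sharp_def)
    from i[OF this this, of "\<pi> i" "\<pi> j"] i[OF y(1) y(1), of i j] show ?thesis by (simp add: \<pi> f(1))
  qed
  ultimately show ?thesis by (rule sharp_reindex[OF s])
qed

section \<open>The symmetric configurations\<close>

text \<open>Antipodes cancel in the sum of the points. In each row of squared inner products the
  point and its antipode give 1 each, the others \<open>v\<close>; v = 0 with N = 6 gives 12, and v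
  = 1/5 with N = 12 gives 48.\<close>

lemma antipodal_pow_sums:
  fixes y :: "'n::finite \<Rightarrow> real ^ 3"
  assumes inj: "inj y" and y: "\<And>i. norm (y i) = 1" and neg: "\<And>i. - y i \<in> range y"
    and node: "\<And>i j. y j \<noteq> y i \<Longrightarrow> y j \<noteq> - y i \<Longrightarrow> (y i \<bullet> y j)\<^sup>2 = v"
  shows "pow_sum 1 y = 0" "pow_sum 2 y = real CARD('n) * (2 + (real CARD('n) - 2) * v)"
proof -
  have "(\<Sum>i\<in>UNIV. y i) = (\<Sum>x\<in>range y. x)" using inj by (simp add: sum.reindex)
  also have "\<dots> = (\<Sum>x\<in>range y. - x)"
    by (rule sum.reindex_bij_witness[of _ uminus uminus]) (use neg in auto)
  also have "\<dots> = - (\<Sum>i\<in>UNIV. y i)" using inj by (simp add: sum.reindex sum_negf)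
  finally have "(\<Sum>i\<in>UNIV. y i) \<bullet> (\<Sum>i\<in>UNIV. y i) = - ((\<Sum>i\<in>UNIV. y i) \<bullet> (\<Sum>i\<in>UNIV. y i))"
    by (metis inner_minus_right)
  then show "pow_sum 1 y = 0" unfolding pow_sum_1 power2_norm_eq_inner by linarith
  have "(\<Sum>j\<in>UNIV. (y i \<bullet> y j)\<^sup>2) = 2 + (real CARD('n) - 2) * v" for i
  proof -
    have u: "y i \<bullet> y i = 1" using y by (simp add: dot_square_norm)
    have ne: "y i \<noteq> - y i" using u by (rule unit_neq_uminus)
    have D: "{y i, - y i} \<subseteq> range y" "card {y i, - y i} = 2" using neg ne by auto
    have "(\<Sum>j\<in>UNIV. (y i \<bullet> y j)\<^sup>2) = (\<Sum>x\<in>range y. (y i \<bullet> x)\<^sup>2)" using inj by (simp add: sum.reindex)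
    also have "\<dots> = (\<Sum>x\<in>range y - {y i, - y i}. (y i \<bullet> x)\<^sup>2) + (\<Sum>x\<in>{y i, - y i}. (y i \<bullet> x)\<^sup>2)"
      by (rule sum.subset_diff[OF D(1)]) simp
    also have "(\<Sum>x\<in>{y i, - y i}. (y i \<bullet> x)\<^sup>2) = 2" using ne u by simp
    also have "(\<Sum>x\<in>range y - {y i, - y i}. (y i \<bullet> x)\<^sup>2) = (\<Sum>x\<in>range y - {y i, - y i}. v)"
      using node by (intro sum.cong) auto
    also have "\<dots> = (real CARD('n) - 2) * v"
    proof -
      have "card (range y - {y i, - y i}) = CARD('n) - 2" using D inj by (subst card_Diff_subset) (auto simp: card_image)
      moreover have "2 \<le> CARD('n)" using card_mono[OF _ D(1)] D(2) inj by (simp add: card_image)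
      ultimately show ?thesis by (simp add: of_nat_diff)
    qed
    finally show ?thesis by simp
  qed
  then show "pow_sum 2 y = real CARD('n) * (2 + (real CARD('n) - 2) * v)" by (simp add: pow_sum_def)
qed

lemma antipodal_pair_sharp:
  fixes y :: "'n::finite \<Rightarrow> real ^ 3"
  assumes inj: "inj y" and N: "CARD('n) = 2" and c: "antipodal_pair (range y)"
  shows "sharp y"
proof -
  obtain p where p: "norm p = 1" "range y = {p, - p}" using c by (auto simp: antipodal_pair_def)
  have y: "y i = p \<or> y i = - p" for i using p(2) by blast
  then have "norm (y i) = 1" for i using p(1) by (metis norm_minus_cancel)
  moreover have "y i \<bullet> y j = - 1" if "i \<noteq> j" for i j
  proof -
    have "y i \<noteq> y j" using inj that by (auto dest: injD)
    then show ?thesis using y[of i] y[of j] p(1) by (auto simp: dot_square_norm)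
  qed
  ultimately show ?thesis using N by (simp add: sharp_def)
qed

lemma great_circle_triangle_sharp:
  fixes y :: "'n::finite \<Rightarrow> real ^ 3"
  assumes inj: "inj y" and N: "CARD('n) = 3" and c: "great_circle_triangle (range y)"
  shows "sharp y"
proof -
  have 2: "cos (2 * pi / 3) = - 1 / 2" "sin (2 * pi / 3) = sqrt 3 / 2"
    using cos_120 sin_120 by simp_all
  have "4 * pi / 3 = 2 * pi - 2 * pi / 3" by simp
  then have 4: "cos (4 * pi / 3) = - 1 / 2" "sin (4 * pi / 3) = - (sqrt 3 / 2)"
    using 2 by (simp_all only: cos_2pi_minus sin_2pi_minus)
  obtain u v where uv: "norm u = 1" "norm v = 1" "u \<bullet> v = 0"
    "range y = {u, (- 1 / 2) *\<^sub>R u + (sqrt 3 / 2) *\<^sub>R v, (- 1 / 2) *\<^sub>R u + (- (sqrt 3 / 2)) *\<^sub>R v}"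
    using c unfolding great_circle_triangle_def 2 4 by (auto simp: orthogonal_def)
  define b where "b = (- 1 / 2) *\<^sub>R u + (sqrt 3 / 2) *\<^sub>R v"
  define d where "d = (- 1 / 2) *\<^sub>R u + (- (sqrt 3 / 2)) *\<^sub>R v"
  have n: "u \<bullet> u = 1" "v \<bullet> v = 1" "v \<bullet> u = 0" using uv by (simp_all add: dot_square_norm inner_commute)
  have g: "b \<bullet> b = 1" "d \<bullet> d = 1" "u \<bullet> b = - 1 / 2" "b \<bullet> u = - 1 / 2" "u \<bullet> d = - 1 / 2" "d \<bullet> u = - 1 / 2" "b \<bullet> d = - 1 / 2" "d \<bullet> b = - 1 / 2"
    using uv(3) by (simp_all add: b_def d_def inner_add_left inner_add_right inner_diff_left inner_diff_right n)
  have y: "y i = u \<or> y i = b \<or> y i = d" for i using uv(4) unfolding b_def d_def by blast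
  have "norm (y i) = 1" for i using y[of i] n g by (auto simp: norm_eq_sqrt_inner)
  moreover have "y i \<bullet> y j = - 1 / 2" if "i \<noteq> j" for i j
  proof -
    have "y i \<noteq> y j" using inj that by (auto dest: injD)
    then show ?thesis using y[of i] y[of j] g by auto
  qed
  ultimately show ?thesis using N by (simp add: sharp_def)
qed

text \<open>Four vectors in R^3 are dependent, so the Gram matrix with 1 on the diagonal and t
  elsewhere is singular. As t is not 1, the kernel vector has equal entries, and 1 + 3t = 0.\<close>

lemma tetrahedron_sharp:
  fixes y :: "'n::finite \<Rightarrow> real ^ 3"
  assumes inj: "inj y" and N: "CARD('n) = 4" and c: "inscribed_tetrahedron (range y)"
  shows "sharp y"
proof -
  have y: "norm (y i) = 1" for i
  proof -
    have "y i \<in> sphere 0 1" using c unfolding inscribed_tetrahedron_def by blast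
    then show ?thesis by simp
  qed
  obtain d where pw: "pairwise (\<lambda>p q. dist p q = d) (range y)" using c unfolding inscribed_tetrahedron_def by blast
  have d: "dist (y i) (y j) = d" if "i \<noteq> j" for i j
  proof -
    have "y i \<noteq> y j" using that inj by (simp add: inj_eq)
    then show ?thesis using pw unfolding pairwise_def by blast
  qed
  define t where "t = 1 - d\<^sup>2 / 2"
  have t: "y i \<bullet> y j = t" if "i \<noteq> j" for i j
  proof -
    have "(dist (y i) (y j))\<^sup>2 = y i \<bullet> y i + y j \<bullet> y j - 2 * (y i \<bullet> y j)"
      by (simp add: dist_norm power2_norm_eq_inner inner_diff_left inner_diff_right inner_commute[of "y j" "y i"])
    then have "(dist (y i) (y j))\<^sup>2 = 2 - 2 * (y i \<bullet> y j)" using y by (simp add: dot_square_norm)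
    then show ?thesis using d[OF that] by (simp add: t_def diff_divide_distrib)
  qed
  obtain i :: 'n where True by blast
  obtain j where j: "j \<notin> {i}" by (rule exists_index_not_in[of "{i}"]) (use N in auto)
  have ij: "i \<noteq> j" using j by blast
  then have "dist (y i) (y j) \<noteq> 0" using inj by (simp add: inj_eq)
  then have "d \<noteq> 0" using d[OF ij] by simp
  then have t1: "t \<noteq> 1" by (simp add: t_def)
  have "dependent (range y)"
    using inj N by (intro dependent_biggerset) (auto simp: card_image)
  then obtain u where u: "\<exists>x\<in>range y. u x \<noteq> 0" "(\<Sum>x\<in>range y. u x *\<^sub>R x) = 0"
    using dependent_finite[of "range y"] by auto
  define c where "c k = u (y k)" for k
  have c: "\<exists>k. c k \<noteq> 0" "(\<Sum>k\<in>UNIV. c k *\<^sub>R y k) = 0"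
    using u inj by (auto simp: c_def sum.reindex)
  have row: "c k * (1 - t) = - t * (\<Sum>m\<in>UNIV. c m)" for k
  proof -
    have "0 = y k \<bullet> (\<Sum>m\<in>UNIV. c m *\<^sub>R y m)" by (simp add: c(2))
    also have "\<dots> = (\<Sum>m\<in>UNIV. c m * (y k \<bullet> y m))" by (simp add: inner_sum_right)
    also have "\<dots> = c k * 1 + (\<Sum>m\<in>UNIV - {k}. c m * t)"
      using t y by (subst sum.remove[of UNIV k]) (auto simp: dot_square_norm intro!: sum.cong)
    also have "\<dots> = c k * (1 - t) + t * (\<Sum>m\<in>UNIV. c m)"
      unfolding sum_distrib_right[symmetric] by (simp add: sum_diff1 algebra_simps)
    finally show ?thesis by simp
  qed
  have eq: "c k = c i" for k
  proof -
    have "c k * (1 - t) = c i * (1 - t)" using row[of k] row[of i] by linarith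
    then show ?thesis using t1 by simp
  qed
  obtain k where "c k \<noteq> 0" using c(1) by blast
  then have "c i \<noteq> 0" using eq[of k] by simp
  have "(\<Sum>m\<in>UNIV. c m) = (\<Sum>m\<in>(UNIV :: 'n set). c i)" by (intro sum.cong refl eq)
  then have "(\<Sum>m\<in>UNIV. c m) = 4 * c i" by (simp add: N)
  then have "c i * (1 + 3 * t) = 0" using row[of i] by (simp add: algebra_simps)
  then have "t = - 1 / 3" using \<open>c i \<noteq> 0\<close> by simp
  then show ?thesis using N y t by (simp add: sharp_def)
qed

text \<open>Removes the orthogonal map, so that inner products can be computed from the explicit
  vertices.\<close>

lemma orthogonal_preimage:
  fixes y :: "'n::finite \<Rightarrow> real ^ 3"
  assumes f: "orthogonal_transformation f" and y: "range y = f ` B" "inj y"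
  obtains z where "inj z" "range z = B" "\<And>i j. y i \<bullet> y j = z i \<bullet> z j"
proof -
  have "\<exists>b\<in>B. y i = f b" for i using y(1) by blast
  then obtain z where z: "\<And>i. z i \<in> B" "\<And>i. y i = f (z i)" by metis
  have fi: "inj f" using f by (rule orthogonal_transformation_inj)
  have "inj z" using y(2) z(2) by (auto simp: inj_def)
  moreover have "range z = B"
  proof
    show "range z \<subseteq> B" using z by auto
    show "B \<subseteq> range z"
    proof
      fix b assume "b \<in> B"
      then obtain i where "f b = y i" using y(1) by (metis imageE imageI)
      then have "b = z i" using fi z(2) by (auto dest: injD)
      then show "b \<in> range z" by simp
    qed
  qed
  moreover have "y i \<bullet> y j = z i \<bullet> z j" for i j
    using f by (simp add: z(2) orthogonal_transformation_def)
  ultimately show ?thesis by (rule that)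
qed

lemma octahedron_sharp:
  fixes y :: "'n::finite \<Rightarrow> real ^ 3"
  assumes inj: "inj y" and N: "CARD('n) = 6" and c: "inscribed_octahedron (range y)"
  shows "sharp y"
proof -
  obtain f :: "real ^ 3 \<Rightarrow> real ^ 3" where f: "orthogonal_transformation f" "range y = f ` (\<Union>i. {axis i 1, - axis i 1})"
    using c by (auto simp: inscribed_octahedron_def)
  obtain z :: "'n \<Rightarrow> real ^ 3" where z: "inj z" "range z = (\<Union>i. {axis i 1, - axis i 1})" "\<And>i j. y i \<bullet> y j = z i \<bullet> z j"
    using orthogonal_preimage[OF f inj] by blast
  have zi: "\<exists>k. z i = axis k 1 \<or> z i = - axis k 1" for i using z(2) by blast
  have n: "norm (z i) = 1" for i using zi[of i] by (auto simp: norm_axis_1)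
  have neg: "- z i \<in> range z" for i using zi[of i] unfolding z(2) by auto
  have node: "z i \<bullet> z j = 0" if "z j \<noteq> z i" "z j \<noteq> - z i" for i j
    using zi[of i] zi[of j] that by (auto simp: inner_axis_axis)
  have "pow_sum 1 z = 0" "pow_sum 2 z = real CARD('n) * (2 + (real CARD('n) - 2) * 0)"
    using antipodal_pow_sums[of z 0, OF z(1) n neg] node by auto
  moreover have "z i \<bullet> z j \<in> {-1, 0}" if "i \<noteq> j" for i j
  proof -
    have "z j \<noteq> z i" using that z(1) by (auto dest: injD)
    then show ?thesis using node[of j i] n[of i] by (cases "z j = - z i") (auto simp: dot_square_norm)
  qed
  ultimately have "sharp z" using N n by (simp add: sharp_6_iff)
  then show ?thesis by (rule sharp_reindex[of z id]) (use z in auto)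
qed

text \<open>Two vertices of different cyclic type have only one nonzero coordinate in common,
  contributing plus or minus phi. Within one type the products are plus or minus (1 - phi^2), which
  equals minus or plus phi.\<close>

lemma icosahedron_vertex_inner:
  fixes \<phi> :: real
  assumes \<phi>: "\<phi> = (1 + sqrt 5) / 2"
    and V: "V = (\<Union>s \<in> {1, -1}. \<Union>t \<in> {\<phi>, - \<phi>}. {vector [0, s, t], vector [s, t, 0], vector [t, 0, s] :: real ^ 3})"
    and vw: "v \<in> V" "w \<in> V" "w \<noteq> v" "w \<noteq> - v"
  shows "v \<bullet> w = \<phi> \<or> v \<bullet> w = - \<phi>"
proof -
  have F: "\<phi> * \<phi> = 1 + \<phi>" by (simp add: \<phi> field_simps)
  have neg: "- vector [p, q, r] = (vector [- p, - q, - r] :: real ^ 3)" for p q r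
    by (simp add: vec_eq_iff forall_3)
  show ?thesis using vw unfolding V by (auto simp: inner_3 neg F)
qed

lemma icosahedron_sharp:
  fixes y :: "'n::finite \<Rightarrow> real ^ 3"
  assumes inj: "inj y" and N: "CARD('n) = 12" and c: "inscribed_icosahedron (range y)"
  shows "sharp y"
proof -
  define \<phi> :: real where "\<phi> = (1 + sqrt 5) / 2"
  define V where "V = (\<Union>s \<in> {1, -1}. \<Union>t \<in> {\<phi>, - \<phi>}. {vector [0, s, t], vector [s, t, 0], vector [t, 0, s] :: real ^ 3})"
  define m where "m = sqrt (1 + \<phi>\<^sup>2)"
  have m: "m > 0" "m\<^sup>2 = 1 + \<phi>\<^sup>2" by (auto simp: m_def add_pos_nonneg)
  have F: "\<phi>\<^sup>2 = 1 + \<phi>" by (simp add: \<phi>_def field_simps power2_eq_square)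
  \<comment> \<open>The squared length of a vertex before scaling is 1 + phi^2 = sqrt 5 phi, so the
    normalised products are plus or minus 1 / sqrt 5.\<close>
  have ratio: "\<phi> / m\<^sup>2 = ico"
  proof -
    have "m\<^sup>2 = sqrt 5 * \<phi>" unfolding m(2) F by (simp add: \<phi>_def field_simps)
    moreover have "\<phi> > 0" by (simp add: \<phi>_def add_pos_nonneg)
    ultimately show ?thesis by (simp add: ico_def)
  qed
  obtain f :: "real ^ 3 \<Rightarrow> real ^ 3" where f: "orthogonal_transformation f" "range y = f ` ((\<lambda>p. p /\<^sub>R m) ` V)"
    using c unfolding inscribed_icosahedron_def Let_def \<phi>_def[symmetric] m_def[symmetric]
    by (auto simp: V_def image_UN)
  obtain z :: "'n \<Rightarrow> real ^ 3" where z: "inj z" "range z = (\<lambda>p. p /\<^sub>R m) ` V" "\<And>i j. y i \<bullet> y j = z i \<bullet> z j"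
    using orthogonal_preimage[OF f inj] by blast
  have "\<exists>v\<in>V. z i = v /\<^sub>R m" for i using z(2) by blast
  then obtain v where v: "\<And>i. v i \<in> V" "\<And>i. z i = v i /\<^sub>R m" by metis
  have zz: "z i \<bullet> z j = (v i \<bullet> v j) / m\<^sup>2" for i j by (simp add: v(2) power2_eq_square divide_inverse)
  have "x \<bullet> x = m\<^sup>2" if "x \<in> V" for x
    unfolding m(2) using that by (auto simp: V_def inner_3 power2_eq_square)
  then have "z i \<bullet> z i = 1" for i using m(1) v(1) by (simp add: zz)
  then have n: "norm (z i) = 1" for i by (simp add: norm_eq_sqrt_inner)
  have negV: "- x \<in> V" if "x \<in> V" for x
  proof -
    have neg: "- vector [p, q, r] = (vector [- p, - q, - r] :: real ^ 3)" for p q r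
      by (simp add: vec_eq_iff forall_3)
    show ?thesis using that by (auto simp: V_def neg)
  qed
  have neg: "- z i \<in> range z" for i
    using negV[OF v(1)[of i]] unfolding z(2) v(2)[of i] by (auto simp: image_iff intro!: bexI[of _ "- v i"])
  have node: "z i \<bullet> z j = ico \<or> z i \<bullet> z j = - ico" if "z j \<noteq> z i" "z j \<noteq> - z i" for i j
  proof -
    have "v j \<noteq> v i" "v j \<noteq> - v i" using that by (auto simp: v(2))
    then have "v i \<bullet> v j = \<phi> \<or> v i \<bullet> v j = - \<phi>"
      using icosahedron_vertex_inner[OF \<phi>_def V_def v(1) v(1)] by blast
    then show ?thesis using ratio by (auto simp: zz)
  qed
  have "(z i \<bullet> z j)\<^sup>2 = 1 / 5" if "z j \<noteq> z i" "z j \<noteq> - z i" for i j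
    using node[OF that] ico_props(1) by auto
  then have "pow_sum 1 z = 0" "pow_sum 2 z = real CARD('n) * (2 + (real CARD('n) - 2) * (1 / 5))"
    using antipodal_pow_sums[of z "1 / 5", OF z(1) n neg] by auto
  moreover have "z i \<bullet> z j \<in> {-1, ico, - ico}" if "i \<noteq> j" for i j
  proof -
    have "z j \<noteq> z i" using that z(1) by (auto dest: injD)
    then show ?thesis using node[of j i] n[of i] by (cases "z j = - z i") (auto simp: dot_square_norm)
  qed
  ultimately have "sharp z" using N n by (simp add: sharp_12_iff)
  then show ?thesis by (rule sharp_reindex[of z id]) (use z in auto)
qed

lemma symmetric_configuration_sharp:
  fixes y :: "'n::finite \<Rightarrow> real ^ 3"
  assumes "inj y" "symmetric_configuration CARD('n) (range y)"
  shows "sharp y"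
  using assms(2) unfolding symmetric_configuration_def
  by (elim disjE conjE) (rule antipodal_pair_sharp[OF assms(1)] great_circle_triangle_sharp[OF assms(1)]
      tetrahedron_sharp[OF assms(1)] octahedron_sharp[OF assms(1)] icosahedron_sharp[OF assms(1)], assumption, assumption)+

theorem theorem4p1:
  fixes y y' :: "'n::finite \<Rightarrow> real ^ 3" and \<alpha> :: real
  assumes "CARD('n) \<in> {2, 3, 4, 6, 12}"
    and "inj y'" and "symmetric_configuration CARD('n) (range y')"
    and "y \<in> spherical_configurations"
    and "\<alpha> < (INF z \<in> (spherical_configurations :: ('n \<Rightarrow> real ^ 3) set). \<alpha>_crit z)"
  shows "lambda1 \<alpha> y \<le> lambda1 \<alpha> y' \<and>
         (lambda1 \<alpha> y < lambda1 \<alpha> y' \<longleftrightarrow> \<not> congruent_sets (range y) (range y'))"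
proof -
  have s: "sharp y'" by (rule symmetric_configuration_sharp) fact+
  have y: "norm (y i) = 1" "inj y" for i
  proof -
    have "y i \<in> sphere 0 1" using assms(4) unfolding spherical_configurations_def by blast
    then show "norm (y i) = 1" by simp
  qed (use assms(4) in \<open>simp add: spherical_configurations_def\<close>)
  have y': "\<And>i. norm (y' i) = 1" "inj y'" using s assms(2) by (auto simp: sharp_def)
  then have "y' \<in> spherical_configurations" by (auto simp: spherical_configurations_def)
  \<comment> \<open>In the reals the infimum lies below every value only for a set bounded
    below.\<close>
  moreover have "bdd_below (\<alpha>_crit ` (spherical_configurations :: ('n \<Rightarrow> real ^ 3) set))"
    by (rule bdd_belowI[of _ 0]) (auto simp: spherical_configurations_def \<alpha>_crit(2))
  ultimately have "\<alpha> < \<alpha>_crit y" "\<alpha> < \<alpha>_crit y'"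
    using assms(4,5) cINF_lower by (meson less_le_trans)+
  note opt = lambda1_sharp_optimal[OF s y \<open>\<alpha> < \<alpha>_crit y'\<close>]
  show ?thesis
  proof (cases "congruent_sets (range y) (range y')")
    case True
    then have "sharp y" using sharp_if_congruent[OF s y] by blast
    \<comment> \<open>For congruent sets both configurations are \<open>sharp\<close>, and the
      comparison with exchanged roles gives equality.\<close>
    then have "lambda1 \<alpha> y' \<le> lambda1 \<alpha> y" using lambda1_sharp_optimal(1)[of y y', OF _ y' \<open>\<alpha> < \<alpha>_crit y\<close>] by blast
    then show ?thesis using opt(1) True by simp
  next
    case False
    then have "\<not> sharp y" using sharp_congruent[OF _ s] by blast
    then show ?thesis using opt False by simp
  qed
qed

end
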